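(* Let $(\Gamma,\Pi)$ be a finitely separated digraph, $\mathbb F$ a field, $\mathbb F\Gamma$ the path algebra and $L(\Gamma,\Pi)$ the Leavitt path algebra over $\mathbb F$. The composition of the forgetful functor $\mathfrak M_{L(\Gamma,\Pi)}\to\mathfrak M_{\mathbb F\Gamma}$ with the functor $\underline{\ \ }\otimes_{\mathbb F\Gamma}L(\Gamma,\Pi):\mathfrak M_{\mathbb F\Gamma}\to\mathfrak M_{L(\Gamma,\Pi)}$ is naturally equivalent to the identity functor on $\mathfrak M_{L(\Gamma,\Pi)}$.
   Context: A digraph $\Gamma=(V,E,s,t)$ has vertex set $V$, arrow set $E$ (both possibly infinite) and source and target maps $s,t:E\to V$; write $se,te$ for $s(e),t(e)$. A separated digraph is a pair $(\Gamma,\Pi)$ where $\Pi$ is a partition of $E$ such that arrows in the same part $X\in\Pi$ have the same source, denoted $sX$. It is finitely separated if every $X\in\Pi$ is finite. The path algebra $\mathbb F\Gamma$ has as $\mathbb F$-basis all paths of $\Gamma$ (including the vertices as paths of length $0$), the product $pq$ of two paths being their concatenation if the target of $p$ is the source of $q$ and $0$ otherwise. $L(\Gamma,\Pi)$ is the (not necessarily unital) $\mathbb F$-algebra generated by $V\sqcup E\sqcup E^*$, where $E^*=\{e^*: e\in E\}$, $s(e^* )=te$, $t(e^* )=se$, subject to: (V) $vw=\delta_{v,w}v$ for $v,w\in V$; (E) $s(e)e=e=e\,t(e)$ for $e\in E\sqcup E^*$; (SCK1) $e^*f=\delta_{e,f}\,te$ for $e,f\in X$, $X\in\Pi$; (SCK2)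 $sX=\sum_{e\in X}ee^*$ for every finite $X\in\Pi$. There is a natural homomorphism $\mathbb F\Gamma\to L(\Gamma,\Pi)$ making $L(\Gamma,\Pi)$ an $\mathbb F\Gamma$-bimodule. For an algebra $A$ among these, a right $A$-module $M$ is unital if $MA=M$, and $\mathfrak M_A$ denotes the category of unital right $A$-modules. The forgetful functor restricts the action along $\mathbb F\Gamma\to L(\Gamma,\Pi)$. *)

theory Defs
  imports
    "HOL-Algebra.Module"
    "HOL-Algebra.QuotRing"
    "HOL-Algebra.Generated_Groups"
    "HOL-Library.Disjoint_Sets"
    "Graph_Theory.Arc_Walk"
begin

section \<open>Separated digraphs\<close>

text \<open>
  The source and target maps are \<^const>\<open>tail\<close> and \<^const>\<open>head\<close>;
  vertex and arrow sets may be infinite.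
\<close>

locale separated_digraph = wf_digraph \<Gamma>
  for \<Gamma> :: "('v, 'e) pre_digraph" +
  fixes \<P> :: "'e set set"
  assumes partition: "partition_on (arcs \<Gamma>) \<P>"
    and same_source: "\<lbrakk>X \<in> \<P>; e \<in> X; f \<in> X\<rbrakk> \<Longrightarrow> tail \<Gamma> e = tail \<Gamma> f"

locale finitely_separated_digraph = separated_digraph +
  assumes finite_parts: "X \<in> \<P> \<Longrightarrow> finite X"


section \<open>Free modules, quotients and (non-unital) algebras\<close>

text \<open>
  Algebras over \<open>F\<close> are not assumed to have an identity. They are stored in the record type
  \<^type>\<open>module\<close> of the library, whose field \<^const>\<open>one\<close> is then irrelevant. For records that
  are just vector spaces, the field \<^const>\<open>mult\<close> is irrelevant as well. Irrelevant fields are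
  filled with \<^const>\<open>undefined\<close>.
\<close>

definition free_mod :: "('k, 'z) ring_scheme \<Rightarrow> 'x set \<Rightarrow> ('k, 'x \<Rightarrow> 'k) module" where
  "free_mod F X =
    \<lparr>carrier = {f. (\<forall>x\<in>X. f x \<in> carrier F) \<and> (\<forall>x. x \<notin> X \<longrightarrow> f x = \<zero>\<^bsub>F\<^esub>) \<and>
       finite {x. f x \<noteq> \<zero>\<^bsub>F\<^esub>}},
     mult = undefined,
     one = undefined,
     zero = (\<lambda>_. \<zero>\<^bsub>F\<^esub>),
     add = (\<lambda>f g x. f x \<oplus>\<^bsub>F\<^esub> g x),
     smult = (\<lambda>c f x. c \<otimes>\<^bsub>F\<^esub> f x)\<rparr>"

definition basis_elem :: "('k, 'z) ring_scheme \<Rightarrow> 'x \<Rightarrow> 'x \<Rightarrow> 'k" where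
  "basis_elem F x = (\<lambda>y. if y = x then \<one>\<^bsub>F\<^esub> else \<zero>\<^bsub>F\<^esub>)"

definition lin_ext ::
  "('k, 'z) ring_scheme \<Rightarrow> ('k, 'm, 'y) module_scheme \<Rightarrow> ('x \<Rightarrow> 'm) \<Rightarrow> ('x \<Rightarrow> 'k) \<Rightarrow> 'm" where
  "lin_ext F M h f = (\<Oplus>\<^bsub>M\<^esub>x\<in>{x. f x \<noteq> \<zero>\<^bsub>F\<^esub>}. f x \<odot>\<^bsub>M\<^esub> h x)"

definition span_gen ::
  "('k, 'z) ring_scheme \<Rightarrow> ('k, 'm, 'y) module_scheme \<Rightarrow> 'm set \<Rightarrow> 'm set" where
  "span_gen F M S = \<Inter>{H. submodule H F M \<and> S \<subseteq> H}"

text \<open>Two-sided ideal, closed under scalars, of a non-unital algebra \<open>A\<close>.\<close>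

definition ideal_gen ::
  "('k, 'z) ring_scheme \<Rightarrow> ('k, 'a, 'y) module_scheme \<Rightarrow> 'a set \<Rightarrow> 'a set" where
  "ideal_gen F A S = \<Inter>{I. submodule I F A \<and> S \<subseteq> I \<and>
     (\<forall>x\<in>I. \<forall>a\<in>carrier A. a \<otimes>\<^bsub>A\<^esub> x \<in> I \<and> x \<otimes>\<^bsub>A\<^esub> a \<in> I)}"

text \<open>
  The map on cosets of \<open>H\<close> (to cosets of \<open>K\<close> in \<open>N\<close>) induced by \<open>h\<close>; as for \<^const>\<open>rcoset_mult\<close>,
  the cosets in the union all coincide when \<open>h\<close> respects \<open>H\<close> and \<open>K\<close>.
\<close>

definition induced :: "('n, 'y) ring_scheme \<Rightarrow> 'n set \<Rightarrow> ('m \<Rightarrow> 'n) \<Rightarrow> 'm set \<Rightarrow> 'n set" where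
  "induced N K h X = (\<Union>x\<in>X. K +>\<^bsub>N\<^esub> h x)"

definition quotient_alg :: "('k, 'a, 'y) module_scheme \<Rightarrow> 'a set \<Rightarrow> ('k, 'a set) module" where
  "quotient_alg A I =
    \<lparr>carrier = a_rcosets\<^bsub>A\<^esub> I,
     mult = rcoset_mult A I,
     one = undefined,
     zero = I,
     add = set_add A,
     smult = (\<lambda>c. induced A I (\<lambda>x. c \<odot>\<^bsub>A\<^esub> x))\<rparr>"

text \<open>The free non-unital algebra on \<open>G\<close>: its basis consists of the nonempty words.\<close>

definition free_alg :: "('k, 'z) ring_scheme \<Rightarrow> 'g set \<Rightarrow> ('k, 'g list \<Rightarrow> 'k) module" where
  "free_alg F G = (free_mod F {w \<in> lists G. w \<noteq> []})
    \<lparr>mult := (\<lambda>f g w. \<Oplus>\<^bsub>F\<^esub>i\<in>{..length w}. f (take i w) \<otimes>\<^bsub>F\<^esub> g (drop i w))\<rparr>"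


section \<open>The path algebra\<close>

text \<open>
  A path is a pair of its source and its list of arrows, so that \<open>(v, [])\<close> is the vertex \<open>v\<close> as a
  path of length \<open>0\<close>. The product of two finitely supported functions on paths is the bilinear
  extension of concatenation: its value at \<open>p\<close> runs over all ways to write \<open>p\<close> as a concatenation.
\<close>

definition paths :: "('v, 'e) pre_digraph \<Rightarrow> ('v \<times> 'e list) set" where
  "paths \<Gamma> = {(u, es). \<exists>v. pre_digraph.awalk \<Gamma> u es v}"

definition path_target :: "('v, 'e) pre_digraph \<Rightarrow> 'v \<Rightarrow> 'e list \<Rightarrow> 'v" where
  "path_target \<Gamma> u es = last (pre_digraph.awalk_verts \<Gamma> u es)"

definition path_alg ::
  "('k, 'z) ring_scheme \<Rightarrow> ('v, 'e) pre_digraph \<Rightarrow> ('k, 'v \<times> 'e list \<Rightarrow> 'k) module" where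
  "path_alg F \<Gamma> = (free_mod F (paths \<Gamma>))
    \<lparr>mult := (\<lambda>f g (u, es). \<Oplus>\<^bsub>F\<^esub>i\<in>{..length es}.
       f (u, take i es) \<otimes>\<^bsub>F\<^esub> g (path_target \<Gamma> u (take i es), drop i es))\<rparr>"


section \<open>The Leavitt path algebra\<close>

datatype ('v, 'e) letter = Vert 'v | Arr 'e | Ghost 'e

definition letters :: "('v, 'e) pre_digraph \<Rightarrow> ('v, 'e) letter set" where
  "letters \<Gamma> = Vert ` verts \<Gamma> \<union> Arr ` arcs \<Gamma> \<union> Ghost ` arcs \<Gamma>"

abbreviation lpa_free ::
  "('k, 'z) ring_scheme \<Rightarrow> ('v, 'e) pre_digraph \<Rightarrow> ('k, ('v, 'e) letter list \<Rightarrow> 'k) module" where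
  "lpa_free F \<Gamma> \<equiv> free_alg F (letters \<Gamma>)"

definition rels_V ::
  "('k, 'z) ring_scheme \<Rightarrow> ('v, 'e) pre_digraph \<Rightarrow> (('v, 'e) letter list \<Rightarrow> 'k) set" where
  "rels_V F \<Gamma> =
    {basis_elem F [Vert v, Vert w] \<ominus>\<^bsub>lpa_free F \<Gamma>\<^esub>
       (if v = w then basis_elem F [Vert v] else \<zero>\<^bsub>lpa_free F \<Gamma>\<^esub>) | v w.
     v \<in> verts \<Gamma> \<and> w \<in> verts \<Gamma>}"

definition rels_E ::
  "('k, 'z) ring_scheme \<Rightarrow> ('v, 'e) pre_digraph \<Rightarrow> (('v, 'e) letter list \<Rightarrow> 'k) set" where
  "rels_E F \<Gamma> = (\<Union>e\<in>arcs \<Gamma>.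
    {basis_elem F [Vert (tail \<Gamma> e), Arr e] \<ominus>\<^bsub>lpa_free F \<Gamma>\<^esub> basis_elem F [Arr e],
     basis_elem F [Arr e, Vert (head \<Gamma> e)] \<ominus>\<^bsub>lpa_free F \<Gamma>\<^esub> basis_elem F [Arr e],
     basis_elem F [Vert (head \<Gamma> e), Ghost e] \<ominus>\<^bsub>lpa_free F \<Gamma>\<^esub> basis_elem F [Ghost e],
     basis_elem F [Ghost e, Vert (tail \<Gamma> e)] \<ominus>\<^bsub>lpa_free F \<Gamma>\<^esub> basis_elem F [Ghost e]})"

definition rels_SCK1 ::
  "('k, 'z) ring_scheme \<Rightarrow> ('v, 'e) pre_digraph \<Rightarrow> 'e set set \<Rightarrow>
    (('v, 'e) letter list \<Rightarrow> 'k) set" where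
  "rels_SCK1 F \<Gamma> \<P> =
    {basis_elem F [Ghost e, Arr f] \<ominus>\<^bsub>lpa_free F \<Gamma>\<^esub>
       (if e = f then basis_elem F [Vert (head \<Gamma> e)] else \<zero>\<^bsub>lpa_free F \<Gamma>\<^esub>) | e f X.
     X \<in> \<P> \<and> e \<in> X \<and> f \<in> X}"

text \<open>The common source of the arrows in \<open>X\<close> is written as \<^term>\<open>tail \<Gamma> e\<close> for \<^prop>\<open>e \<in> X\<close>.\<close>

definition rels_SCK2 ::
  "('k, 'z) ring_scheme \<Rightarrow> ('v, 'e) pre_digraph \<Rightarrow> 'e set set \<Rightarrow>
    (('v, 'e) letter list \<Rightarrow> 'k) set" where
  "rels_SCK2 F \<Gamma> \<P> =
    {basis_elem F [Vert (tail \<Gamma> e)] \<ominus>\<^bsub>lpa_free F \<Gamma>\<^esub>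
       (\<Oplus>\<^bsub>lpa_free F \<Gamma>\<^esub>f\<in>X. basis_elem F [Arr f, Ghost f]) | e X.
     X \<in> \<P> \<and> finite X \<and> e \<in> X}"

definition lpa_ideal ::
  "('k, 'z) ring_scheme \<Rightarrow> ('v, 'e) pre_digraph \<Rightarrow> 'e set set \<Rightarrow>
    (('v, 'e) letter list \<Rightarrow> 'k) set" where
  "lpa_ideal F \<Gamma> \<P> = ideal_gen F (lpa_free F \<Gamma>)
     (rels_V F \<Gamma> \<union> rels_E F \<Gamma> \<union> rels_SCK1 F \<Gamma> \<P> \<union> rels_SCK2 F \<Gamma> \<P>)"

definition leavitt_path_alg ::
  "('k, 'z) ring_scheme \<Rightarrow> ('v, 'e) pre_digraph \<Rightarrow> 'e set set \<Rightarrow>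
    ('k, (('v, 'e) letter list \<Rightarrow> 'k) set) module" where
  "leavitt_path_alg F \<Gamma> \<P> = quotient_alg (lpa_free F \<Gamma>) (lpa_ideal F \<Gamma> \<P>)"

text \<open>
  The natural homomorphism from the path algebra. The path \<open>e\<^sub>1\<dots>e\<^sub>n\<close> starting at \<open>u\<close> is sent to the
  class of \<open>u e\<^sub>1\<dots>e\<^sub>n\<close>; by (E) the leading \<open>u\<close> may be dropped for \<open>n > 0\<close>.
\<close>

definition path_alg_to_lpa ::
  "('k, 'z) ring_scheme \<Rightarrow> ('v, 'e) pre_digraph \<Rightarrow> 'e set set \<Rightarrow>
    ('v \<times> 'e list \<Rightarrow> 'k) \<Rightarrow> (('v, 'e) letter list \<Rightarrow> 'k) set" where
  "path_alg_to_lpa F \<Gamma> \<P> x = lpa_ideal F \<Gamma> \<P> +>\<^bsub>lpa_free F \<Gamma>\<^esub>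
     lin_ext F (lpa_free F \<Gamma>) (\<lambda>(u, es). basis_elem F (Vert u # map Arr es)) x"


section \<open>Categories of unital right modules\<close>

record ('k, 'a, 'm) rmodule = "('k, 'm) module" +
  ract :: "'m \<Rightarrow> 'a \<Rightarrow> 'm"  (infixl "\<triangleleft>\<index>" 70)

locale right_module = Module.module F M
  for F :: "('k, 'z) ring_scheme" (structure)
    and A :: "('k, 'a, 'y) module_scheme"
    and M :: "('k, 'a, 'm, 'w) rmodule_scheme" (structure) +
  assumes act_closed: "\<lbrakk>m \<in> carrier M; a \<in> carrier A\<rbrakk> \<Longrightarrow> m \<triangleleft>\<^bsub>M\<^esub> a \<in> carrier M"
    and act_add_left: "\<lbrakk>m \<in> carrier M; n \<in> carrier M; a \<in> carrier A\<rbrakk> \<Longrightarrow>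
      (m \<oplus>\<^bsub>M\<^esub> n) \<triangleleft>\<^bsub>M\<^esub> a = m \<triangleleft>\<^bsub>M\<^esub> a \<oplus>\<^bsub>M\<^esub> n \<triangleleft>\<^bsub>M\<^esub> a"
    and act_add_right: "\<lbrakk>m \<in> carrier M; a \<in> carrier A; b \<in> carrier A\<rbrakk> \<Longrightarrow>
      m \<triangleleft>\<^bsub>M\<^esub> (a \<oplus>\<^bsub>A\<^esub> b) = m \<triangleleft>\<^bsub>M\<^esub> a \<oplus>\<^bsub>M\<^esub> m \<triangleleft>\<^bsub>M\<^esub> b"
    and act_smult_left: "\<lbrakk>c \<in> carrier F; m \<in> carrier M; a \<in> carrier A\<rbrakk> \<Longrightarrow>
      (c \<odot>\<^bsub>M\<^esub> m) \<triangleleft>\<^bsub>M\<^esub> a = c \<odot>\<^bsub>M\<^esub> (m \<triangleleft>\<^bsub>M\<^esub> a)"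
    and act_smult_right: "\<lbrakk>c \<in> carrier F; m \<in> carrier M; a \<in> carrier A\<rbrakk> \<Longrightarrow>
      m \<triangleleft>\<^bsub>M\<^esub> (c \<odot>\<^bsub>A\<^esub> a) = c \<odot>\<^bsub>M\<^esub> (m \<triangleleft>\<^bsub>M\<^esub> a)"
    and act_assoc: "\<lbrakk>m \<in> carrier M; a \<in> carrier A; b \<in> carrier A\<rbrakk> \<Longrightarrow>
      m \<triangleleft>\<^bsub>M\<^esub> (a \<otimes>\<^bsub>A\<^esub> b) = (m \<triangleleft>\<^bsub>M\<^esub> a) \<triangleleft>\<^bsub>M\<^esub> b"

text \<open>\<open>MA\<close> is the additive subgroup generated by the products, hence \<open>MA = M\<close> is the last axiom.\<close>

locale unital_right_module = right_module +
  assumes unital: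
    "generate (add_monoid M) {m \<triangleleft>\<^bsub>M\<^esub> a | m a. m \<in> carrier M \<and> a \<in> carrier A} = carrier M"

text \<open>
  Objects and morphisms of the category of unital right \<open>A\<close>-modules. Morphisms are extensional
  functions, so that equality of morphisms is equality in HOL.
\<close>

definition right_mods ::
  "('k, 'z) ring_scheme \<Rightarrow> ('k, 'a, 'y) module_scheme \<Rightarrow> ('k, 'a, 'm) rmodule set" where
  "right_mods F A = {M. unital_right_module F A M}"

definition mod_hom ::
  "('k, 'z) ring_scheme \<Rightarrow> ('k, 'a, 'y) module_scheme \<Rightarrow>
    ('k, 'a, 'm) rmodule \<Rightarrow> ('k, 'a, 'n) rmodule \<Rightarrow> ('m \<Rightarrow> 'n) set" where
  "mod_hom F A M N = {f \<in> carrier M \<rightarrow>\<^sub>E carrier N.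
     (\<forall>x\<in>carrier M. \<forall>y\<in>carrier M. f (x \<oplus>\<^bsub>M\<^esub> y) = f x \<oplus>\<^bsub>N\<^esub> f y) \<and>
     (\<forall>c\<in>carrier F. \<forall>x\<in>carrier M. f (c \<odot>\<^bsub>M\<^esub> x) = c \<odot>\<^bsub>N\<^esub> f x) \<and>
     (\<forall>x\<in>carrier M. \<forall>a\<in>carrier A. f (x \<triangleleft>\<^bsub>M\<^esub> a) = f x \<triangleleft>\<^bsub>N\<^esub> a)}"

definition mod_id :: "('k, 'a, 'm) rmodule \<Rightarrow> 'm \<Rightarrow> 'm" where
  "mod_id M = (\<lambda>x\<in>carrier M. x)"

definition mod_iso ::
  "('k, 'z) ring_scheme \<Rightarrow> ('k, 'a, 'y) module_scheme \<Rightarrow>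
    ('k, 'a, 'm) rmodule \<Rightarrow> ('k, 'a, 'n) rmodule \<Rightarrow> ('m \<Rightarrow> 'n) set" where
  "mod_iso F A M N = {f \<in> mod_hom F A M N. \<exists>g\<in>mod_hom F A N M.
     compose (carrier M) g f = mod_id M \<and> compose (carrier N) f g = mod_id N}"

record ('k, 'a, 'm, 'b, 'n) mod_functor =
  fobj :: "('k, 'a, 'm) rmodule \<Rightarrow> ('k, 'b, 'n) rmodule"
  fmor :: "('k, 'a, 'm) rmodule \<Rightarrow> ('k, 'a, 'm) rmodule \<Rightarrow> ('m \<Rightarrow> 'm) \<Rightarrow> 'n \<Rightarrow> 'n"

definition is_functor ::
  "('k, 'z) ring_scheme \<Rightarrow> ('k, 'a, 'y) module_scheme \<Rightarrow> ('k, 'b, 'x) module_scheme \<Rightarrow>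
    ('k, 'a, 'm, 'b, 'n) mod_functor \<Rightarrow> bool" where
  "is_functor F A B T \<longleftrightarrow>
    (\<forall>M\<in>right_mods F A. fobj T M \<in> right_mods F B) \<and>
    (\<forall>M\<in>right_mods F A. \<forall>N\<in>right_mods F A. \<forall>f\<in>mod_hom F A M N.
       fmor T M N f \<in> mod_hom F B (fobj T M) (fobj T N)) \<and>
    (\<forall>M\<in>right_mods F A. fmor T M M (mod_id M) = mod_id (fobj T M)) \<and>
    (\<forall>M\<in>right_mods F A. \<forall>N\<in>right_mods F A. \<forall>P\<in>right_mods F A.
       \<forall>f\<in>mod_hom F A M N. \<forall>g\<in>mod_hom F A N P.
       fmor T M P (compose (carrier M) g f) =
       compose (carrier (fobj T M)) (fmor T N P g) (fmor T M N f))"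

definition id_functor :: "('k, 'a, 'm, 'a, 'm) mod_functor" where
  "id_functor = \<lparr>fobj = (\<lambda>M. M), fmor = (\<lambda>M N f. f)\<rparr>"

definition comp_functor ::
  "('k, 'b, 'n, 'c, 'p) mod_functor \<Rightarrow> ('k, 'a, 'm, 'b, 'n) mod_functor \<Rightarrow>
    ('k, 'a, 'm, 'c, 'p) mod_functor" where
  "comp_functor S T =
    \<lparr>fobj = (\<lambda>M. fobj S (fobj T M)),
     fmor = (\<lambda>M N f. fmor S (fobj T M) (fobj T N) (fmor T M N f))\<rparr>"

text \<open>
  The values of \<open>S\<close> and \<open>T\<close> may have carriers in different types \<open>'n\<close> and \<open>'p\<close>; module homomorphisms
  between them make sense regardless.
\<close>

definition naturally_equivalent ::
  "('k, 'z) ring_scheme \<Rightarrow> ('k, 'a, 'y) module_scheme \<Rightarrow> ('k, 'b, 'x) module_scheme \<Rightarrow>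
    ('k, 'a, 'm, 'b, 'n) mod_functor \<Rightarrow> ('k, 'a, 'm, 'b, 'p) mod_functor \<Rightarrow> bool" where
  "naturally_equivalent F A B S T \<longleftrightarrow>
    is_functor F A B S \<and> is_functor F A B T \<and>
    (\<exists>\<eta>. (\<forall>M\<in>right_mods F A. \<eta> M \<in> mod_iso F B (fobj S M) (fobj T M)) \<and>
         (\<forall>M\<in>right_mods F A. \<forall>N\<in>right_mods F A. \<forall>f\<in>mod_hom F A M N.
            compose (carrier (fobj S M)) (\<eta> N) (fmor S M N f) =
            compose (carrier (fobj S M)) (fmor T M N f) (\<eta> M)))"


section \<open>Restriction and tensor product\<close>

definition restriction_functor ::
  "('a \<Rightarrow> 'b) \<Rightarrow> ('k, 'b, 'm, 'a, 'm) mod_functor" where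
  "restriction_functor \<phi> =
    \<lparr>fobj = (\<lambda>M. \<lparr>carrier = carrier M, mult = mult M, one = one M, zero = zero M, add = add M,
                  smult = smult M, ract = (\<lambda>m a. m \<triangleleft>\<^bsub>M\<^esub> \<phi> a)\<rparr>),
     fmor = (\<lambda>M N f. f)\<rparr>"

text \<open>An \<open>A\<close>-\<open>B\<close>-bimodule.\<close>

record ('k, 'a, 'b, 'n) bimodule = "('k, 'b, 'n) rmodule" +
  lact :: "'a \<Rightarrow> 'n \<Rightarrow> 'n"  (infixr "\<triangleright>\<index>" 70)

definition algebra_bimodule ::
  "('a \<Rightarrow> 'b) \<Rightarrow> ('k, 'b) module \<Rightarrow> ('k, 'a, 'b, 'b) bimodule" where
  "algebra_bimodule \<phi> B =
    \<lparr>carrier = carrier B, mult = mult B, one = one B, zero = zero B, add = add B, smult = smult B,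
     ract = (\<lambda>x b. x \<otimes>\<^bsub>B\<^esub> b), lact = (\<lambda>a x. \<phi> a \<otimes>\<^bsub>B\<^esub> x)\<rparr>"

text \<open>
  The tensor product of \<open>M\<close> and \<open>N\<close> over \<open>A\<close> is the free vector space on pairs modulo bilinearity
  over \<open>F\<close> and balancedness over \<open>A\<close>.
\<close>

abbreviation pair_mod ::
  "('k, 'z) ring_scheme \<Rightarrow> ('k, 'a, 'm) rmodule \<Rightarrow> ('k, 'a, 'b, 'n) bimodule \<Rightarrow>
    ('k, 'm \<times> 'n \<Rightarrow> 'k) module" where
  "pair_mod F M N \<equiv> free_mod F (carrier M \<times> carrier N)"

definition tensor_rels ::
  "('k, 'z) ring_scheme \<Rightarrow> ('k, 'a, 'y) module_scheme \<Rightarrow>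
    ('k, 'a, 'm) rmodule \<Rightarrow> ('k, 'a, 'b, 'n) bimodule \<Rightarrow> ('m \<times> 'n \<Rightarrow> 'k) set" where
  "tensor_rels F A M N =
    (let T = pair_mod F M N; pr = (\<lambda>m n. basis_elem F (m, n)) in span_gen F T
     ({pr (m \<oplus>\<^bsub>M\<^esub> m') n \<ominus>\<^bsub>T\<^esub> (pr m n \<oplus>\<^bsub>T\<^esub> pr m' n) | m m' n.
         m \<in> carrier M \<and> m' \<in> carrier M \<and> n \<in> carrier N} \<union>
      {pr m (n \<oplus>\<^bsub>N\<^esub> n') \<ominus>\<^bsub>T\<^esub> (pr m n \<oplus>\<^bsub>T\<^esub> pr m n') | m n n'.
         m \<in> carrier M \<and> n \<in> carrier N \<and> n' \<in> carrier N} \<union>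
      {pr (c \<odot>\<^bsub>M\<^esub> m) n \<ominus>\<^bsub>T\<^esub> c \<odot>\<^bsub>T\<^esub> pr m n | c m n.
         c \<in> carrier F \<and> m \<in> carrier M \<and> n \<in> carrier N} \<union>
      {pr m (c \<odot>\<^bsub>N\<^esub> n) \<ominus>\<^bsub>T\<^esub> c \<odot>\<^bsub>T\<^esub> pr m n | c m n.
         c \<in> carrier F \<and> m \<in> carrier M \<and> n \<in> carrier N} \<union>
      {pr (m \<triangleleft>\<^bsub>M\<^esub> a) n \<ominus>\<^bsub>T\<^esub> pr m (a \<triangleright>\<^bsub>N\<^esub> n) | m a n.
         m \<in> carrier M \<and> a \<in> carrier A \<and> n \<in> carrier N}))"

definition tensor ::
  "('k, 'z) ring_scheme \<Rightarrow> ('k, 'a, 'y) module_scheme \<Rightarrow>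
    ('k, 'a, 'm) rmodule \<Rightarrow> ('k, 'a, 'b, 'n) bimodule \<Rightarrow> ('k, 'b, ('m \<times> 'n \<Rightarrow> 'k) set) rmodule" where
  "tensor F A M N =
    (let T = pair_mod F M N; R = tensor_rels F A M N in
     \<lparr>carrier = a_rcosets\<^bsub>T\<^esub> R,
      mult = undefined,
      one = undefined,
      zero = R,
      add = set_add T,
      smult = (\<lambda>c. induced T R (\<lambda>t. c \<odot>\<^bsub>T\<^esub> t)),
      ract = (\<lambda>X b. induced T R (lin_ext F T (\<lambda>(m, n). basis_elem F (m, n \<triangleleft>\<^bsub>N\<^esub> b))) X)\<rparr>)"

definition tensor_mor ::
  "('k, 'z) ring_scheme \<Rightarrow> ('k, 'a, 'y) module_scheme \<Rightarrow> ('k, 'a, 'b, 'n) bimodule \<Rightarrow>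
    ('k, 'a, 'm) rmodule \<Rightarrow> ('k, 'a, 'm) rmodule \<Rightarrow> ('m \<Rightarrow> 'm) \<Rightarrow>
    ('m \<times> 'n \<Rightarrow> 'k) set \<Rightarrow> ('m \<times> 'n \<Rightarrow> 'k) set" where
  "tensor_mor F A N M M' f = (\<lambda>X\<in>carrier (tensor F A M N).
     induced (pair_mod F M' N) (tensor_rels F A M' N)
       (lin_ext F (pair_mod F M' N) (\<lambda>(m, n). basis_elem F (f m, n))) X)"

definition tensor_functor ::
  "('k, 'z) ring_scheme \<Rightarrow> ('k, 'a, 'y) module_scheme \<Rightarrow> ('k, 'a, 'b, 'n) bimodule \<Rightarrow>
    ('k, 'a, 'm, 'b, ('m \<times> 'n \<Rightarrow> 'k) set) mod_functor" where
  "tensor_functor F A N = \<lparr>fobj = (\<lambda>M. tensor F A M N), fmor = tensor_mor F A N\<rparr>"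

definition forgetful_functor ::
  "('k, 'z) ring_scheme \<Rightarrow> ('v, 'e) pre_digraph \<Rightarrow> 'e set set \<Rightarrow>
    ('k, (('v, 'e) letter list \<Rightarrow> 'k) set, 'm, 'v \<times> 'e list \<Rightarrow> 'k, 'm) mod_functor" where
  "forgetful_functor F \<Gamma> \<P> = restriction_functor (path_alg_to_lpa F \<Gamma> \<P>)"

definition lpa_tensor_functor ::
  "('k, 'z) ring_scheme \<Rightarrow> ('v, 'e) pre_digraph \<Rightarrow> 'e set set \<Rightarrow>
    ('k, 'v \<times> 'e list \<Rightarrow> 'k, 'm, (('v, 'e) letter list \<Rightarrow> 'k) set,
     ('m \<times> (('v, 'e) letter list \<Rightarrow> 'k) set \<Rightarrow> 'k) set) mod_functor" where
  "lpa_tensor_functor F \<Gamma> \<P> = tensor_functor F (path_alg F \<Gamma>)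
     (algebra_bimodule (path_alg_to_lpa F \<Gamma> \<P>) (leavitt_path_alg F \<Gamma> \<P>))"

end

theory Submission
  imports Defs
begin

text \<open>
  For a unital right \<open>L\<close>-module \<open>M\<close> the counit \<open>M \<otimes> L \<rightarrow> M\<close>, \<open>m \<otimes> x \<mapsto> mx\<close>, is shown to be
  bijective. Everything reduces to \<open>my \<otimes> x = m \<otimes> yx\<close> in the tensor product over the path algebra
  for all \<open>y \<in> L\<close>: the elements \<open>y\<close> with this property form a subalgebra containing the image of the
  path algebra, and it contains the ghost arrows \<open>e\<^sup>*\<close> because
  \<open>me\<^sup>* \<otimes> x = \<Sum>\<^sub>f me\<^sup>* \<otimes> ff\<^sup>*x = \<Sum>\<^sub>f me\<^sup>*f \<otimes> f\<^sup>*x = m \<otimes> e\<^sup>*x\<close>, where \<open>f\<close> runs over the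
  finite part of \<open>e\<close>. Sums \<open>u\<close> of vertices are local units of \<open>L\<close>, so every element \<open>z\<close> of the tensor
  product is \<open>\<epsilon>(z) \<otimes> u\<close> for some \<open>u\<close>, where \<open>\<epsilon>\<close> is the counit, and \<open>\<epsilon>\<close> is injective.
\<close>

section \<open>Linear maps and submodules\<close>

text \<open>SCK1 and SCK2 say that the row of arrows of a finite part and the column of their ghosts
  are mutually inverse matrices, with vertices in place of 1. So L arises from the path algebra by
  adjoining inverses of matrices, as in noncommutative localization, and ghosts slide for the reason
  that entries of an inverse matrix pass through a tensor product over the smaller ring. Each use of
  a unit must choose one that is large enough for all elements at hand. Hence the notion of being
  fixed from some finite set of vertices on, which survives sums. The encodings cause the remaining
  work: free modules are finitely supported functions and quotients are sets of cosets, so every map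
  out of L or out of a tensor product must be shown to respect cosets. Linearity is a predicate on
  plain functions between records of possibly different types, and identities are tested on
  generators.\<close>

definition lin_map ::
  "('k, 'z) ring_scheme \<Rightarrow> ('k, 'm, 'x) module_scheme \<Rightarrow> ('k, 'n, 'y) module_scheme \<Rightarrow>
    ('m \<Rightarrow> 'n) \<Rightarrow> bool" where
  "lin_map F M N h \<longleftrightarrow> h \<in> carrier M \<rightarrow> carrier N \<and>
    (\<forall>x\<in>carrier M. \<forall>y\<in>carrier M. h (x \<oplus>\<^bsub>M\<^esub> y) = h x \<oplus>\<^bsub>N\<^esub> h y) \<and>
    (\<forall>c\<in>carrier F. \<forall>x\<in>carrier M. h (c \<odot>\<^bsub>M\<^esub> x) = c \<odot>\<^bsub>N\<^esub> h x)"

lemma lin_mapI: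
  assumes "\<And>x. x \<in> carrier M \<Longrightarrow> h x \<in> carrier N"
    and "\<And>x y. \<lbrakk>x \<in> carrier M; y \<in> carrier M\<rbrakk> \<Longrightarrow> h (x \<oplus>\<^bsub>M\<^esub> y) = h x \<oplus>\<^bsub>N\<^esub> h y"
    and "\<And>c x. \<lbrakk>c \<in> carrier F; x \<in> carrier M\<rbrakk> \<Longrightarrow> h (c \<odot>\<^bsub>M\<^esub> x) = c \<odot>\<^bsub>N\<^esub> h x"
  shows "lin_map F M N h"
  using assms by (auto simp: lin_map_def)

lemma lin_map_closed: "\<lbrakk>lin_map F M N h; x \<in> carrier M\<rbrakk> \<Longrightarrow> h x \<in> carrier N"
  by (auto simp: lin_map_def)

lemma lin_map_add:
  "\<lbrakk>lin_map F M N h; x \<in> carrier M; y \<in> carrier M\<rbrakk> \<Longrightarrow> h (x \<oplus>\<^bsub>M\<^esub> y) = h x \<oplus>\<^bsub>N\<^esub> h y"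
  by (auto simp: lin_map_def)

lemma lin_map_smult:
  "\<lbrakk>lin_map F M N h; c \<in> carrier F; x \<in> carrier M\<rbrakk> \<Longrightarrow> h (c \<odot>\<^bsub>M\<^esub> x) = c \<odot>\<^bsub>N\<^esub> h x"
  by (auto simp: lin_map_def)

lemma lin_map_comp:
  assumes "lin_map F M N h" "lin_map F N P g"
  shows "lin_map F M P (\<lambda>x. g (h x))"
  using assms by (auto simp: lin_map_def Pi_iff)

lemma lin_map_zero:
  assumes "Module.module F M" "Module.module F N" "lin_map F M N h"
  shows "h \<zero>\<^bsub>M\<^esub> = \<zero>\<^bsub>N\<^esub>"
proof -
  interpret M: Module.module F M by fact
  interpret N: Module.module F N by fact
  \<comment> \<open>The zero vector is 0 times itself, so compatibility with scalars
    suffices.\<close>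
  have "h (\<zero>\<^bsub>F\<^esub> \<odot>\<^bsub>M\<^esub> \<zero>\<^bsub>M\<^esub>) = \<zero>\<^bsub>F\<^esub> \<odot>\<^bsub>N\<^esub> h \<zero>\<^bsub>M\<^esub>"
    by (intro lin_map_smult[OF assms(3)]) auto
  then show ?thesis
    using lin_map_closed[OF assms(3) M.zero_closed] by simp
qed

lemma (in Module.module) a_inv_eq_smult:
  "x \<in> carrier M \<Longrightarrow> \<ominus>\<^bsub>M\<^esub> x = (\<ominus> \<one>) \<odot>\<^bsub>M\<^esub> x"
  using smult_l_minus[OF R.one_closed] by simp

lemma lin_map_minus:
  assumes "Module.module F M" "Module.module F N" "lin_map F M N h" "x \<in> carrier M"
    "y \<in> carrier M"
  shows "h (x \<ominus>\<^bsub>M\<^esub> y) = h x \<ominus>\<^bsub>N\<^esub> h y"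
proof -
  interpret M: Module.module F M by fact
  interpret N: Module.module F N by fact
  note h = lin_map_closed[OF assms(3)]
  show ?thesis
    unfolding a_minus_def M.a_inv_eq_smult[OF assms(5)] N.a_inv_eq_smult[OF h[OF assms(5)]]
    using assms by (simp add: lin_map_add lin_map_smult)
qed

lemma lin_map_finsum:
  assumes "Module.module F M" "Module.module F N" "lin_map F M N h" "finite S"
    "\<And>i. i \<in> S \<Longrightarrow> f i \<in> carrier M"
  shows "h (\<Oplus>\<^bsub>M\<^esub>i\<in>S. f i) = (\<Oplus>\<^bsub>N\<^esub>i\<in>S. h (f i))"
proof -
  interpret M: Module.module F M by fact
  interpret N: Module.module F N by fact
  note h = lin_map_closed[OF assms(3)]
  show ?thesis
    using assms(4,5)
  proof (induction S rule: finite_induct)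
    case empty
    then show ?case using lin_map_zero[OF assms(1-3)] by simp
  next
    case (insert a S)
    then have "f \<in> S \<rightarrow> carrier M" "f a \<in> carrier M" "(\<lambda>i. h (f i)) \<in> S \<rightarrow> carrier N" "h (f a) \<in> carrier N"
      using h by auto
    with insert show ?case
      by (simp add: M.finsum_insert N.finsum_insert lin_map_add[OF assms(3)])
  qed
qed

text \<open>Additive inverses need no separate check, since they are multiples by the scalar
  -1.\<close>

lemma (in Module.module) submodule_if_smult_add:
  assumes "H \<subseteq> carrier M" "\<zero>\<^bsub>M\<^esub> \<in> H"
    and "\<And>x y. \<lbrakk>x \<in> H; y \<in> H\<rbrakk> \<Longrightarrow> x \<oplus>\<^bsub>M\<^esub> y \<in> H"
    and "\<And>c x. \<lbrakk>c \<in> carrier R; x \<in> H\<rbrakk> \<Longrightarrow> c \<odot>\<^bsub>M\<^esub> x \<in> H"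
  shows "submodule H R M"
proof (rule submoduleI)
  show "\<ominus>\<^bsub>M\<^esub> a \<in> H" if "a \<in> H" for a
    using that assms(1) assms(4)[of "\<ominus> \<one>" a] a_inv_eq_smult[of a] by auto
qed (use assms in auto)

lemma submodule_zero: "\<lbrakk>Module.module F M; submodule H F M\<rbrakk> \<Longrightarrow> \<zero>\<^bsub>M\<^esub> \<in> H"
  using subgroup.one_closed[of H "add_monoid M"] by (simp add: submodule_def)

lemma submodule_vimage:
  assumes M: "Module.module F M" and N: "Module.module F N" and h: "lin_map F M N h"
    and K: "submodule K F N"
  shows "submodule {x \<in> carrier M. h x \<in> K} F M"
proof -
  interpret M: Module.module F M by fact
  interpret N: Module.module F N by fact
  show ?thesis
  proof (rule M.submodule_if_smult_add)
    show "\<zero>\<^bsub>M\<^esub> \<in> {x \<in> carrier M. h x \<in> K}"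
      by (simp add: lin_map_zero[OF M N h] submodule_zero[OF N K])
  qed (auto simp: lin_map_add[OF h] lin_map_smult[OF h] intro: N.submoduleE[OF K])
qed

text \<open>Later identities between linear maps are proved in this form: the equalizer is a
  submodule, so an induction principle for free modules, for L or for tensor products leaves only
  generators to compare.\<close>

lemma submodule_equalizer:
  assumes M: "Module.module F M" and N: "Module.module F N" and h: "lin_map F M N h"
    and g: "lin_map F M N g"
  shows "submodule {x \<in> carrier M. h x = g x} F M"
proof -
  interpret M: Module.module F M by fact
  show ?thesis
    by (rule M.submodule_if_smult_add)
      (auto simp: lin_map_zero[OF M N] h g lin_map_add[OF h] lin_map_smult[OF h]
        lin_map_add[OF g] lin_map_smult[OF g])
qed

lemma submodule_Int:
  assumes M: "Module.module F M" and \<open>\<H> \<noteq> {}\<close> "\<And>H. H \<in> \<H> \<Longrightarrow> submodule H F M"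
  shows "submodule (\<Inter>\<H>) F M"
proof -
  interpret M: Module.module F M by fact
  note E = M.submoduleE[OF assms(3)]
  obtain H0 where "H0 \<in> \<H>"
    using assms(2) by auto
  show ?thesis
  proof (rule M.submodule_if_smult_add)
    show "\<Inter>\<H> \<subseteq> carrier M"
      using E(1)[OF \<open>H0 \<in> \<H>\<close>] \<open>H0 \<in> \<H>\<close> by auto
  qed (auto intro: E(4,5) submodule_zero[OF M assms(3)])
qed

lemma span_gen_submodule:
  assumes M: "Module.module F M" and "S \<subseteq> carrier M"
  shows "submodule (span_gen F M S) F M"
  unfolding span_gen_def
proof (rule submodule_Int[OF M])
  show "{H. submodule H F M \<and> S \<subseteq> H} \<noteq> {}"
    using assms Module.module.carrier_is_submodule[OF M] by auto
qed simp

lemma span_gen_incl: "S \<subseteq> span_gen F M S"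
  by (auto simp: span_gen_def)

lemma span_gen_minimal: "\<lbrakk>submodule H F M; S \<subseteq> H\<rbrakk> \<Longrightarrow> span_gen F M S \<subseteq> H"
  by (auto simp: span_gen_def)

text \<open>Unitality is stated with the additive subgroup generated by the products m a. As c (m a)
  = (c m) a, these generators are stable under scalars, and so is the group that they generate, by
  induction on how its elements arise. This makes the subgroup accessible to linear
  arguments.\<close>

lemma generate_submodule:
  assumes M: "Module.module F M" and S: "S \<subseteq> carrier M"
    and sm: "\<And>c x. \<lbrakk>c \<in> carrier F; x \<in> S\<rbrakk> \<Longrightarrow> c \<odot>\<^bsub>M\<^esub> x \<in> S"
  shows "submodule (generate (add_monoid M) S) F M"
proof -
  interpret M: Module.module F M by fact
  have G: "subgroup (generate (add_monoid M) S) (add_monoid M)"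
    using M.add.generate_is_subgroup S by simp
  have sub: "generate (add_monoid M) S \<subseteq> carrier M"
    using subgroup.subset[OF G] by simp
  show ?thesis
  proof (rule M.submodule_if_smult_add[OF sub])
    show "\<zero>\<^bsub>M\<^esub> \<in> generate (add_monoid M) S"
      using subgroup.one_closed[OF G] by simp
    show "x \<oplus>\<^bsub>M\<^esub> y \<in> generate (add_monoid M) S"
      if "x \<in> generate (add_monoid M) S" "y \<in> generate (add_monoid M) S" for x y
      using subgroup.m_closed[OF G that] by simp
    fix c x assume c: "c \<in> carrier F" and "x \<in> generate (add_monoid M) S"
    from this(2) show "c \<odot>\<^bsub>M\<^esub> x \<in> generate (add_monoid M) S"
    proof (induction rule: generate.induct)
      case one
      then show ?case using c subgroup.one_closed[OF G] by simp
    next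
      case (incl h)
      then show ?case using sm[OF c] by (simp add: generate.incl)
    next
      case (inv h)
      have "c \<odot>\<^bsub>M\<^esub> (\<ominus>\<^bsub>M\<^esub> h) = \<ominus>\<^bsub>M\<^esub> (c \<odot>\<^bsub>M\<^esub> h)"
        using inv S c by (auto simp: M.smult_r_minus)
      then show ?case
        using generate.inv[OF sm[OF c inv], of "add_monoid M"] by (simp add: a_inv_def)
    next
      case (eng h1 h2)
      then have "h1 \<in> carrier M" "h2 \<in> carrier M"
        using sub by auto
      then have "c \<odot>\<^bsub>M\<^esub> (h1 \<oplus>\<^bsub>M\<^esub> h2) = c \<odot>\<^bsub>M\<^esub> h1 \<oplus>\<^bsub>M\<^esub> c \<odot>\<^bsub>M\<^esub> h2"
        using c by (simp add: M.smult_r_distr)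
      then show ?case
        using generate.eng[OF eng.IH] by simp
    qed
  qed
qed

lemma lin_map_plus:
  assumes "Module.module F N" and h: "lin_map F M N h" and g: "lin_map F M N g"
  shows "lin_map F M N (\<lambda>x. h x \<oplus>\<^bsub>N\<^esub> g x)"
proof -
  interpret N: Module.module F N by fact
  note s = lin_map_closed[OF h] lin_map_closed[OF g]
  show ?thesis
    by (rule lin_mapI)
      (simp_all add: s lin_map_add[OF h] lin_map_add[OF g] lin_map_smult[OF h] lin_map_smult[OF g]
        N.smult_r_distr N.a_ac)
qed

lemma lin_map_smult_fun:
  assumes "Module.module F N" and h: "lin_map F M N h" and c: "c \<in> carrier F"
  shows "lin_map F M N (\<lambda>x. c \<odot>\<^bsub>N\<^esub> h x)"
proof -
  interpret N: Module.module F N by fact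
  show ?thesis
    by (rule lin_mapI)
      (simp_all add: lin_map_closed[OF h] lin_map_add[OF h] lin_map_smult[OF h] c
        N.smult_r_distr N.smult_assoc1[symmetric] N.R.m_comm)
qed

lemma lin_map_const_zero:
  assumes "Module.module F N"
  shows "lin_map F M N (\<lambda>x. \<zero>\<^bsub>N\<^esub>)"
proof -
  interpret N: Module.module F N by fact
  show ?thesis by (rule lin_mapI) simp_all
qed

lemma lin_map_restrict:
  assumes "Module.module F M" and h: "lin_map F M N h"
  shows "lin_map F M N (restrict h (carrier M))"
proof -
  interpret M: Module.module F M by fact
  show ?thesis
    by (rule lin_mapI) (simp_all add: lin_map_closed[OF h] lin_map_add[OF h] lin_map_smult[OF h])
qed

text \<open>The module axioms mention neither a multiplication nor an action, so the free algebra,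
  the path algebra, a restricted module and the bimodule L inherit them from the modules that they
  extend.\<close>

lemma module_cong:
  assumes M: "Module.module F M"
    and eq: "carrier M' = carrier M" "zero M' = zero M" "add M' = add M" "smult M' = smult M"
  shows "Module.module F M'"
proof -
  interpret Module.module F M by (rule M)
  show ?thesis
    by (intro moduleI abelian_groupI)
      (auto simp: eq a_ac smult_l_distr smult_r_distr smult_assoc1 is_cring intro: M.add.l_inv_ex)
qed

lemma submodule_cong:
  fixes M M' :: "('k, 'm, 'x) module_scheme"
  assumes "carrier M' = carrier M" "zero M' = zero M" "add M' = add M" "smult M' = smult M"
  shows "submodule H F M' \<longleftrightarrow> submodule H F M"
  unfolding submodule_def submodule_axioms_def using assms by simp

section \<open>Free modules\<close>

context
  fixes F :: "('k, 'z) ring_scheme"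
  assumes F: "cring F"
begin

interpretation F: cring F by (rule F)

lemma free_mod_simps [simp]:
  "zero (free_mod F X) = (\<lambda>_. \<zero>\<^bsub>F\<^esub>)"
  "f \<oplus>\<^bsub>free_mod F X\<^esub> g = (\<lambda>x. f x \<oplus>\<^bsub>F\<^esub> g x)"
  "c \<odot>\<^bsub>free_mod F X\<^esub> f = (\<lambda>x. c \<otimes>\<^bsub>F\<^esub> f x)"
  by (simp_all add: free_mod_def)

lemma free_mod_carrier:
  "f \<in> carrier (free_mod F X) \<longleftrightarrow> (\<forall>x. f x \<in> carrier F) \<and> (\<forall>x. x \<notin> X \<longrightarrow> f x = \<zero>\<^bsub>F\<^esub>) \<and>
    finite {x. f x \<noteq> \<zero>\<^bsub>F\<^esub>}"
  by (auto simp: free_mod_def)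

lemma free_mod_module: "Module.module F (free_mod F X)"
proof (intro moduleI abelian_groupI F)
  fix f g assume f: "f \<in> carrier (free_mod F X)" and g: "g \<in> carrier (free_mod F X)"
  have "{x. f x \<oplus>\<^bsub>F\<^esub> g x \<noteq> \<zero>\<^bsub>F\<^esub>} \<subseteq> {x. f x \<noteq> \<zero>\<^bsub>F\<^esub>} \<union> {x. g x \<noteq> \<zero>\<^bsub>F\<^esub>}"
    by auto
  from finite_subset[OF this] show "f \<oplus>\<^bsub>free_mod F X\<^esub> g \<in> carrier (free_mod F X)"
    using f g by (simp add: free_mod_carrier)
next
  fix c f assume c: "c \<in> carrier F" and f: "f \<in> carrier (free_mod F X)"
  have "{x. c \<otimes>\<^bsub>F\<^esub> f x \<noteq> \<zero>\<^bsub>F\<^esub>} \<subseteq> {x. f x \<noteq> \<zero>\<^bsub>F\<^esub>}"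
    using c by auto
  from finite_subset[OF this] show "c \<odot>\<^bsub>free_mod F X\<^esub> f \<in> carrier (free_mod F X)"
    using c f by (simp add: free_mod_carrier)
next
  fix f assume f: "f \<in> carrier (free_mod F X)"
  have "{x. \<ominus>\<^bsub>F\<^esub> f x \<noteq> \<zero>\<^bsub>F\<^esub>} \<subseteq> {x. f x \<noteq> \<zero>\<^bsub>F\<^esub>}"
    using f by auto
  from finite_subset[OF this] have "(\<lambda>x. \<ominus>\<^bsub>F\<^esub> f x) \<in> carrier (free_mod F X)"
    using f by (simp add: free_mod_carrier)
  moreover have "(\<lambda>x. \<ominus>\<^bsub>F\<^esub> f x) \<oplus>\<^bsub>free_mod F X\<^esub> f = \<zero>\<^bsub>free_mod F X\<^esub>"
    using f by (auto simp: free_mod_carrier F.l_neg)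
  ultimately show "\<exists>g\<in>carrier (free_mod F X). g \<oplus>\<^bsub>free_mod F X\<^esub> f = \<zero>\<^bsub>free_mod F X\<^esub>"
    by blast
qed (auto simp: free_mod_carrier F.a_ac F.l_distr F.r_distr F.m_assoc)

lemma basis_elem_closed [intro]: "x \<in> X \<Longrightarrow> basis_elem F x \<in> carrier (free_mod F X)"
proof -
  assume "x \<in> X"
  moreover have "finite {y. (if y = x then \<one>\<^bsub>F\<^esub> else \<zero>\<^bsub>F\<^esub>) \<noteq> \<zero>\<^bsub>F\<^esub>}"
    by (rule finite_subset[of _ "{x}"]) auto
  ultimately show ?thesis
    by (auto simp: free_mod_carrier basis_elem_def)
qed

lemma free_mod_induct:
  assumes H: "submodule H F (free_mod F X)" and b: "\<And>x. x \<in> X \<Longrightarrow> basis_elem F x \<in> H"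
    and f: "f \<in> carrier (free_mod F X)"
  shows "f \<in> H"
proof -
  interpret M: Module.module F "free_mod F X" by (rule free_mod_module)
  \<comment> \<open>Induction over a finite set bounding the support, for all functions at once: the
    induction hypothesis is applied to the function with its value at \<open>a\<close>
    erased.\<close>
  have "\<forall>f \<in> carrier (free_mod F X). {x. f x \<noteq> \<zero>\<^bsub>F\<^esub>} \<subseteq> S \<longrightarrow> f \<in> H" if "finite S" for S
    using that
  proof (induction S rule: finite_induct)
    case empty
    have "f = (\<lambda>_. \<zero>\<^bsub>F\<^esub>)" if "{x. f x \<noteq> \<zero>\<^bsub>F\<^esub>} \<subseteq> {}" for f :: "_ \<Rightarrow> 'k"
      using that by auto
    then show ?case
      using submodule_zero[OF free_mod_module H] by auto
  next
    case (insert a S)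
    show ?case
    proof (intro ballI impI)
      fix f assume f: "f \<in> carrier (free_mod F X)" and s: "{x. f x \<noteq> \<zero>\<^bsub>F\<^esub>} \<subseteq> insert a S"
      show "f \<in> H"
      proof (cases "a \<in> X")
        case True
        let ?g = "\<lambda>x. if x = a then \<zero>\<^bsub>F\<^esub> else f x"
        have "finite {x. ?g x \<noteq> \<zero>\<^bsub>F\<^esub>}"
          by (rule finite_subset[of _ "{x. f x \<noteq> \<zero>\<^bsub>F\<^esub>}"]) (use f in \<open>auto simp: free_mod_carrier\<close>)
        then have "?g \<in> carrier (free_mod F X)"
          using f by (simp add: free_mod_carrier)
        moreover have "{x. ?g x \<noteq> \<zero>\<^bsub>F\<^esub>} \<subseteq> S"
          using s by auto
        ultimately have "?g \<in> H"
          using bspec[OF insert.IH, of ?g] by blast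
        moreover have "f a \<odot>\<^bsub>free_mod F X\<^esub> basis_elem F a \<in> H"
          using f by (intro M.submoduleE(4)[OF H] b True) (simp add: free_mod_carrier)
        moreover have "f = ?g \<oplus>\<^bsub>free_mod F X\<^esub> (f a \<odot>\<^bsub>free_mod F X\<^esub> basis_elem F a)"
          using f by (auto simp: free_mod_carrier basis_elem_def)
        ultimately show ?thesis
          using M.submoduleE(5)[OF H] by metis
      next
        case False
        then have "f a = \<zero>\<^bsub>F\<^esub>"
          using f by (simp add: free_mod_carrier)
        with s have "{x. f x \<noteq> \<zero>\<^bsub>F\<^esub>} \<subseteq> S"
          by auto
        with f insert.IH show ?thesis
          by blast
      qed
    qed
  qed
  with f show ?thesis
    by (auto simp: free_mod_carrier)
qed

lemma lin_map_free_eqI: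
  assumes N: "Module.module F N" and h: "lin_map F (free_mod F X) N h"
    and g: "lin_map F (free_mod F X) N g"
    and "\<And>x. x \<in> X \<Longrightarrow> h (basis_elem F x) = g (basis_elem F x)"
    and f: "f \<in> carrier (free_mod F X)"
  shows "h f = g f"
  using free_mod_induct[OF submodule_equalizer[OF free_mod_module N h g] _ f] assms(4)
    basis_elem_closed by auto

text \<open>\<open>lin_ext\<close> sums over the exact support, which shrinks when values cancel. A
  fixed larger set lets f, g and f + g, or f and c f, be compared term by term.\<close>

lemma lin_ext_superset:
  assumes M: "Module.module F M" and h: "h \<in> X \<rightarrow> carrier M" and f: "f \<in> carrier (free_mod F X)"
    and S: "finite S" "{x. f x \<noteq> \<zero>\<^bsub>F\<^esub>} \<subseteq> S" "S \<subseteq> X"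
  shows "lin_ext F M h f = (\<Oplus>\<^bsub>M\<^esub>x\<in>S. f x \<odot>\<^bsub>M\<^esub> h x)"
proof -
  interpret M: Module.module F M by (rule M)
  have c: "f x \<in> carrier F" for x
    using f by (simp add: free_mod_carrier)
  have h': "h x \<in> carrier M" if "x \<in> S" for x
    using that S h by auto
  show ?thesis
    unfolding lin_ext_def
    by (rule M.add.finprod_mono_neutral_cong_left[OF S(1,2)]) (auto simp: c h' Pi_iff)
qed

lemma lin_ext_lin_map:
  assumes M: "Module.module F M" and h: "h \<in> X \<rightarrow> carrier M"
  shows "lin_map F (free_mod F X) M (lin_ext F M h)"
proof (rule lin_mapI)
  interpret M: Module.module F M by (rule M)
  interpret X: Module.module F "free_mod F X" by (rule free_mod_module)
  fix f assume f: "f \<in> carrier (free_mod F X)"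
  let ?S = "{x. f x \<noteq> \<zero>\<^bsub>F\<^esub>}"
  have fS: "finite ?S" "?S \<subseteq> X" and fc: "f x \<in> carrier F" for x
    using f by (auto simp: free_mod_carrier)
  have h': "h x \<in> carrier M" if "x \<in> X" for x
    using that h by auto
  show "lin_ext F M h f \<in> carrier M"
    unfolding lin_ext_def by (rule M.finsum_closed) (use fc fS h' in auto)
  fix c assume c: "c \<in> carrier F"
  have "lin_ext F M h (c \<odot>\<^bsub>free_mod F X\<^esub> f) =
    (\<Oplus>\<^bsub>M\<^esub>x\<in>?S. (c \<odot>\<^bsub>free_mod F X\<^esub> f) x \<odot>\<^bsub>M\<^esub> h x)"
    by (rule lin_ext_superset[OF M h]) (use fS f c X.smult_closed in auto)
  also have "\<dots> = (\<Oplus>\<^bsub>M\<^esub>x\<in>?S. c \<odot>\<^bsub>M\<^esub> (f x \<odot>\<^bsub>M\<^esub> h x))"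
    by (rule M.finsum_cong') (use fc fS h' c in \<open>auto simp: M.smult_assoc1\<close>)
  also have "\<dots> = c \<odot>\<^bsub>M\<^esub> lin_ext F M h f"
    unfolding lin_ext_def
    by (rule M.finsum_smult_ldistr[symmetric]) (use fc fS h' c in auto)
  finally show "lin_ext F M h (c \<odot>\<^bsub>free_mod F X\<^esub> f) = c \<odot>\<^bsub>M\<^esub> lin_ext F M h f" .
next
  interpret M: Module.module F M by (rule M)
  interpret X: Module.module F "free_mod F X" by (rule free_mod_module)
  fix f g assume f: "f \<in> carrier (free_mod F X)" and g: "g \<in> carrier (free_mod F X)"
  let ?S = "{x. f x \<noteq> \<zero>\<^bsub>F\<^esub>} \<union> {x. g x \<noteq> \<zero>\<^bsub>F\<^esub>}"
  have S: "finite ?S" "?S \<subseteq> X" and fc: "f x \<in> carrier F" and gc: "g x \<in> carrier F" for x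
    using f g by (auto simp: free_mod_carrier)
  have h': "h x \<in> carrier M" if "x \<in> ?S" for x
    using that S h by auto
  have "lin_ext F M h (f \<oplus>\<^bsub>free_mod F X\<^esub> g) =
    (\<Oplus>\<^bsub>M\<^esub>x\<in>?S. (f \<oplus>\<^bsub>free_mod F X\<^esub> g) x \<odot>\<^bsub>M\<^esub> h x)"
    by (rule lin_ext_superset[OF M h X.a_closed[OF f g] S(1) _ S(2)]) auto
  also have "\<dots> = (\<Oplus>\<^bsub>M\<^esub>x\<in>?S. f x \<odot>\<^bsub>M\<^esub> h x \<oplus>\<^bsub>M\<^esub> g x \<odot>\<^bsub>M\<^esub> h x)"
    by (rule M.finsum_cong') (use fc gc h' in \<open>auto simp: M.smult_l_distr\<close>)
  also have "\<dots> = (\<Oplus>\<^bsub>M\<^esub>x\<in>?S. f x \<odot>\<^bsub>M\<^esub> h x) \<oplus>\<^bsub>M\<^esub> (\<Oplus>\<^bsub>M\<^esub>x\<in>?S. g x \<odot>\<^bsub>M\<^esub> h x)"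
    by (rule M.finsum_addf) (use fc gc h' in auto)
  also have "\<dots> = lin_ext F M h f \<oplus>\<^bsub>M\<^esub> lin_ext F M h g"
    using lin_ext_superset[OF M h f S(1) _ S(2)] lin_ext_superset[OF M h g S(1) _ S(2)] by auto
  finally show "lin_ext F M h (f \<oplus>\<^bsub>free_mod F X\<^esub> g) = lin_ext F M h f \<oplus>\<^bsub>M\<^esub> lin_ext F M h g" .
qed

lemma lin_ext_basis:
  assumes M: "Module.module F M" and h: "h \<in> X \<rightarrow> carrier M" and x: "x \<in> X"
  shows "lin_ext F M h (basis_elem F x) = h x"
proof -
  interpret M: Module.module F M by (rule M)
  have hx: "h x \<in> carrier M"
    using h x by auto
  have "lin_ext F M h (basis_elem F x) = (\<Oplus>\<^bsub>M\<^esub>y\<in>{x}. basis_elem F x y \<odot>\<^bsub>M\<^esub> h y)"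
    by (rule lin_ext_superset[OF M h basis_elem_closed]) (use x in \<open>auto simp: basis_elem_def\<close>)
  then show ?thesis
    using hx by (simp add: basis_elem_def)
qed

end

section \<open>Quotients\<close>

text \<open>Only the four fields that make up the quotient module are prescribed, so that one theory
  serves both \<open>quotient_alg\<close> and \<open>tensor\<close>, whose records differ in their
  further fields.\<close>

locale module_quotient = Module.module F M
  for F :: "('k, 'z) ring_scheme" (structure)
    and M :: "('k, 'm, 'x) module_scheme" (structure) +
  fixes H :: "'m set" and Q :: "('k, 'm set, 'y) module_scheme"
  assumes sub: "submodule H F M"
    and carrier_Q: "carrier Q = a_rcosets\<^bsub>M\<^esub> H"
    and zero_Q: "zero Q = H"
    and add_Q: "add Q = set_add M"
    and smult_Q: "smult Q = (\<lambda>c. induced M H (\<lambda>x. c \<odot>\<^bsub>M\<^esub> x))"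
begin

lemma coset_subgroup: "abelian_subgroup H M"
  using sub by (intro abelian_subgroupI3) (auto simp: additive_subgroup_def submodule_def
    intro: abelian_group_axioms)

lemma coset_in: "x \<in> carrier M \<Longrightarrow> H +>\<^bsub>M\<^esub> x \<in> carrier Q"
  using submoduleE(1)[OF sub] by (simp add: carrier_Q a_rcosetsI)

lemma coset_ex: "X \<in> carrier Q \<Longrightarrow> \<exists>x\<in>carrier M. X = H +>\<^bsub>M\<^esub> x"
  by (auto simp: carrier_Q A_RCOSETS_def')

lemma coset_eq_iff:
  assumes "x \<in> carrier M" "y \<in> carrier M"
  shows "H +>\<^bsub>M\<^esub> x = H +>\<^bsub>M\<^esub> y \<longleftrightarrow> x \<ominus>\<^bsub>M\<^esub> y \<in> H"
proof -
  interpret H: abelian_subgroup H M by (rule coset_subgroup)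
  show ?thesis
    using H.a_repr_independence'[of x y] H.a_repr_independenceD[of x y] H.a_rcos_module[OF assms(2,1)]
      H.a_rcos_self[OF assms(1)] assms
    by (auto simp: a_minus_def)
qed

lemma coset_self: "x \<in> carrier M \<Longrightarrow> x \<in> H +>\<^bsub>M\<^esub> x"
  using abelian_subgroup.a_rcos_self[OF coset_subgroup] .

lemma coset_mem:
  assumes "x \<in> carrier M" "y \<in> H +>\<^bsub>M\<^esub> x"
  shows "y \<in> carrier M" "H +>\<^bsub>M\<^esub> y = H +>\<^bsub>M\<^esub> x"
  using assms abelian_subgroup.a_elemrcos_carrier[OF coset_subgroup]
    abelian_subgroup.a_repr_independence'[OF coset_subgroup] by blast+

lemma coset_add:
  "\<lbrakk>x \<in> carrier M; y \<in> carrier M\<rbrakk> \<Longrightarrow>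
    (H +>\<^bsub>M\<^esub> x) \<oplus>\<^bsub>Q\<^esub> (H +>\<^bsub>M\<^esub> y) = H +>\<^bsub>M\<^esub> (x \<oplus>\<^bsub>M\<^esub> y)"
  using abelian_subgroup.a_rcos_sum[OF coset_subgroup] by (simp add: add_Q)

end

text \<open>As h sends H into K, all members of a coset of H yield the same coset of K, and the
  union in \<open>induced\<close> has only one distinct member. Source and target are independent,
  because maps between tensor products of different modules are needed.\<close>

lemma induced_coset:
  assumes q: "module_quotient F M H Q" and r: "module_quotient F N K R"
    and h: "lin_map F M N h" and HK: "\<And>x. x \<in> H \<Longrightarrow> h x \<in> K" and x: "x \<in> carrier M"
  shows "induced N K h (H +>\<^bsub>M\<^esub> x) = K +>\<^bsub>N\<^esub> h x"
proof -
  interpret q: module_quotient F M H Q by (rule q)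
  interpret r: module_quotient F N K R by (rule r)
  have "K +>\<^bsub>N\<^esub> h y = K +>\<^bsub>N\<^esub> h x" if "y \<in> H +>\<^bsub>M\<^esub> x" for y
  proof -
    have y: "y \<in> carrier M" "y \<ominus>\<^bsub>M\<^esub> x \<in> H"
      using q.coset_mem[OF x that] q.coset_eq_iff x by auto
    have "h y \<ominus>\<^bsub>N\<^esub> h x \<in> K"
      using HK[OF y(2)] lin_map_minus[OF q.module_axioms r.module_axioms h y(1) x] by simp
    then show ?thesis
      using r.coset_eq_iff lin_map_closed[OF h] x y by blast
  qed
  then show ?thesis
    using q.coset_self[OF x] unfolding induced_def by blast
qed

context module_quotient
begin

lemma coset_smult:
  assumes "c \<in> carrier F" "x \<in> carrier M"
  shows "c \<odot>\<^bsub>Q\<^esub> (H +>\<^bsub>M\<^esub> x) = H +>\<^bsub>M\<^esub> (c \<odot>\<^bsub>M\<^esub> x)"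
proof -
  have "lin_map F M M (\<lambda>x. c \<odot>\<^bsub>M\<^esub> x)"
    by (rule lin_mapI)
      (use assms in \<open>auto simp: smult_r_distr smult_assoc1[symmetric] m_comm\<close>)
  from induced_coset[OF module_quotient_axioms module_quotient_axioms this _ assms(2)]
  show ?thesis
    using submoduleE(4)[OF sub assms(1)] by (simp add: smult_Q)
qed

lemma quotient_module: "Module.module F Q"
proof (intro moduleI abelian_groupI)
  have z: "\<zero>\<^bsub>Q\<^esub> = H +>\<^bsub>M\<^esub> \<zero>\<^bsub>M\<^esub>"
    using submoduleE(1)[OF sub] by (simp add: zero_Q)
  show "\<zero>\<^bsub>Q\<^esub> \<in> carrier Q"
    using z coset_in by simp
  show "cring F" ..
  fix X Y assume X: "X \<in> carrier Q"
  obtain x where x: "x \<in> carrier M" "X = H +>\<^bsub>M\<^esub> x"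
    using coset_ex[OF X] by blast
  show "\<zero>\<^bsub>Q\<^esub> \<oplus>\<^bsub>Q\<^esub> X = X"
    using x by (simp add: z coset_add)
  show "\<one> \<odot>\<^bsub>Q\<^esub> X = X"
    using x by (simp add: coset_smult)
  have "(H +>\<^bsub>M\<^esub> \<ominus>\<^bsub>M\<^esub> x) \<oplus>\<^bsub>Q\<^esub> X = \<zero>\<^bsub>Q\<^esub>"
    using x by (simp add: z coset_add M.l_neg)
  then show "\<exists>Y\<in>carrier Q. Y \<oplus>\<^bsub>Q\<^esub> X = \<zero>\<^bsub>Q\<^esub>"
    using coset_in[of "\<ominus>\<^bsub>M\<^esub> x"] x by auto
  assume Y: "Y \<in> carrier Q"
  obtain y where y: "y \<in> carrier M" "Y = H +>\<^bsub>M\<^esub> y"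
    using coset_ex[OF Y] by blast
  show "X \<oplus>\<^bsub>Q\<^esub> Y \<in> carrier Q" "X \<oplus>\<^bsub>Q\<^esub> Y = Y \<oplus>\<^bsub>Q\<^esub> X"
    using x y by (simp_all add: coset_add coset_in M.a_comm)
  { fix Z assume "Z \<in> carrier Q"
    then obtain z where z: "z \<in> carrier M" "Z = H +>\<^bsub>M\<^esub> z"
      using coset_ex by blast
    show "X \<oplus>\<^bsub>Q\<^esub> Y \<oplus>\<^bsub>Q\<^esub> Z = X \<oplus>\<^bsub>Q\<^esub> (Y \<oplus>\<^bsub>Q\<^esub> Z)"
      using x y z by (simp add: coset_add M.a_assoc) }
  fix c assume c: "c \<in> carrier F"
  show "c \<odot>\<^bsub>Q\<^esub> (X \<oplus>\<^bsub>Q\<^esub> Y) = c \<odot>\<^bsub>Q\<^esub> X \<oplus>\<^bsub>Q\<^esub> c \<odot>\<^bsub>Q\<^esub> Y"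
    using x y c by (simp add: coset_add coset_smult smult_r_distr)
next
  fix c X assume c: "c \<in> carrier F" and X: "X \<in> carrier Q"
  obtain x where x: "x \<in> carrier M" "X = H +>\<^bsub>M\<^esub> x"
    using coset_ex[OF X] by blast
  show "c \<odot>\<^bsub>Q\<^esub> X \<in> carrier Q"
    using x c by (simp add: coset_smult coset_in)
  fix d assume d: "d \<in> carrier F"
  show "(d \<oplus> c) \<odot>\<^bsub>Q\<^esub> X = d \<odot>\<^bsub>Q\<^esub> X \<oplus>\<^bsub>Q\<^esub> c \<odot>\<^bsub>Q\<^esub> X"
    "(d \<otimes> c) \<odot>\<^bsub>Q\<^esub> X = d \<odot>\<^bsub>Q\<^esub> (c \<odot>\<^bsub>Q\<^esub> X)"
    using x c d by (simp_all add: coset_smult coset_add smult_l_distr smult_assoc1)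
qed

lemma coset_lin_map: "lin_map F M Q (\<lambda>x. H +>\<^bsub>M\<^esub> x)"
  by (rule lin_mapI) (simp_all add: coset_in coset_add coset_smult)

lemma coset_zero_iff: "x \<in> carrier M \<Longrightarrow> H +>\<^bsub>M\<^esub> x = \<zero>\<^bsub>Q\<^esub> \<longleftrightarrow> x \<in> H"
  using coset_eq_iff[of x "\<zero>\<^bsub>M\<^esub>"] submoduleE(1)[OF sub] M.minus_equality[of "\<zero>\<^bsub>M\<^esub>" "\<zero>\<^bsub>M\<^esub>"]
  by (simp add: zero_Q a_minus_def)

lemma lin_map_quotientI:
  assumes h: "lin_map F M N (\<lambda>x. g (H +>\<^bsub>M\<^esub> x))"
  shows "lin_map F Q N g"
proof (rule lin_mapI)
  note l = lin_map_closed[OF h] lin_map_add[OF h] lin_map_smult[OF h]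
  fix X assume X: "X \<in> carrier Q"
  then obtain x where x: "x \<in> carrier M" "X = H +>\<^bsub>M\<^esub> x"
    using coset_ex by blast
  show "g X \<in> carrier N"
    using l x by simp
  show "g (c \<odot>\<^bsub>Q\<^esub> X) = c \<odot>\<^bsub>N\<^esub> g X" if "c \<in> carrier F" for c
    using l x that by (simp add: coset_smult)
  fix Y assume Y: "Y \<in> carrier Q"
  then obtain y where y: "y \<in> carrier M" "Y = H +>\<^bsub>M\<^esub> y"
    using coset_ex by blast
  show "g (X \<oplus>\<^bsub>Q\<^esub> Y) = g X \<oplus>\<^bsub>N\<^esub> g Y"
    using l x y by (simp add: coset_add)
qed

lemma quotient_factor:
  assumes N: "Module.module F N" and h: "lin_map F M N h" and "\<And>x. x \<in> H \<Longrightarrow> h x = \<zero>\<^bsub>N\<^esub>"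
  shows "\<exists>g. lin_map F Q N g \<and> (\<forall>x\<in>carrier M. g (H +>\<^bsub>M\<^esub> x) = h x)"
proof -
  interpret N: Module.module F N by (rule N)
  \<comment> \<open>The value at an arbitrarily chosen representative: two representatives differ by
    an element of H, which h kills.\<close>
  let ?g = "\<lambda>X. h (SOME x. x \<in> X)"
  have g: "?g (H +>\<^bsub>M\<^esub> x) = h x" if x: "x \<in> carrier M" for x
  proof -
    have "(SOME y. y \<in> H +>\<^bsub>M\<^esub> x) \<in> H +>\<^bsub>M\<^esub> x" (is "?y \<in> _")
      using coset_self[OF x] by (rule someI)
    from coset_mem[OF x this] have y: "?y \<in> carrier M" "?y \<ominus>\<^bsub>M\<^esub> x \<in> H"
      using coset_eq_iff x by auto
    then have "h ?y \<ominus>\<^bsub>N\<^esub> h x = \<zero>\<^bsub>N\<^esub>"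
      using assms(3) lin_map_minus[OF module_axioms N h y(1) x] by metis
    then show ?thesis
      using lin_map_closed[OF h] x y N.minus_equality[of "h ?y" "\<ominus>\<^bsub>N\<^esub> h x"]
      by (simp add: a_minus_def)
  qed
  have "lin_map F M N (\<lambda>x. ?g (H +>\<^bsub>M\<^esub> x))"
    using h by (simp add: lin_map_def g Pi_iff)
  from lin_map_quotientI[OF this] g show ?thesis
    by blast
qed

end

section \<open>Non-unital algebras\<close>

locale nonunital_algebra = Module.module F A
  for F :: "('k, 'z) ring_scheme" (structure)
    and A :: "('k, 'a, 'y) module_scheme" (structure) +
  assumes mult_closed: "\<lbrakk>x \<in> carrier A; y \<in> carrier A\<rbrakk> \<Longrightarrow> x \<otimes>\<^bsub>A\<^esub> y \<in> carrier A"
    and mult_add_left: "\<lbrakk>x \<in> carrier A; y \<in> carrier A; z \<in> carrier A\<rbrakk> \<Longrightarrow>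
      (x \<oplus>\<^bsub>A\<^esub> y) \<otimes>\<^bsub>A\<^esub> z = x \<otimes>\<^bsub>A\<^esub> z \<oplus>\<^bsub>A\<^esub> y \<otimes>\<^bsub>A\<^esub> z"
    and mult_add_right: "\<lbrakk>x \<in> carrier A; y \<in> carrier A; z \<in> carrier A\<rbrakk> \<Longrightarrow>
      x \<otimes>\<^bsub>A\<^esub> (y \<oplus>\<^bsub>A\<^esub> z) = x \<otimes>\<^bsub>A\<^esub> y \<oplus>\<^bsub>A\<^esub> x \<otimes>\<^bsub>A\<^esub> z"
    and mult_smult_left: "\<lbrakk>c \<in> carrier F; x \<in> carrier A; y \<in> carrier A\<rbrakk> \<Longrightarrow>
      (c \<odot>\<^bsub>A\<^esub> x) \<otimes>\<^bsub>A\<^esub> y = c \<odot>\<^bsub>A\<^esub> (x \<otimes>\<^bsub>A\<^esub> y)"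
    and mult_smult_right: "\<lbrakk>c \<in> carrier F; x \<in> carrier A; y \<in> carrier A\<rbrakk> \<Longrightarrow>
      x \<otimes>\<^bsub>A\<^esub> (c \<odot>\<^bsub>A\<^esub> y) = c \<odot>\<^bsub>A\<^esub> (x \<otimes>\<^bsub>A\<^esub> y)"
    and mult_assoc: "\<lbrakk>x \<in> carrier A; y \<in> carrier A; z \<in> carrier A\<rbrakk> \<Longrightarrow>
      (x \<otimes>\<^bsub>A\<^esub> y) \<otimes>\<^bsub>A\<^esub> z = x \<otimes>\<^bsub>A\<^esub> (y \<otimes>\<^bsub>A\<^esub> z)"
begin

lemma mult_left_lin_map: "y \<in> carrier A \<Longrightarrow> lin_map F A A (\<lambda>x. x \<otimes>\<^bsub>A\<^esub> y)"
  by (rule lin_mapI) (simp_all add: mult_closed mult_add_left mult_smult_left)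

lemma mult_right_lin_map: "x \<in> carrier A \<Longrightarrow> lin_map F A A (\<lambda>y. x \<otimes>\<^bsub>A\<^esub> y)"
  by (rule lin_mapI) (simp_all add: mult_closed mult_add_right mult_smult_right)

end

locale algebra_ideal = nonunital_algebra F A
  for F :: "('k, 'z) ring_scheme" (structure)
    and A :: "('k, 'a, 'y) module_scheme" (structure) +
  fixes I :: "'a set"
  assumes ideal_submodule: "submodule I F A"
    and ideal_left: "\<lbrakk>x \<in> I; a \<in> carrier A\<rbrakk> \<Longrightarrow> a \<otimes>\<^bsub>A\<^esub> x \<in> I"
    and ideal_right: "\<lbrakk>x \<in> I; a \<in> carrier A\<rbrakk> \<Longrightarrow> x \<otimes>\<^bsub>A\<^esub> a \<in> I"
begin

sublocale quotient: module_quotient F A I "quotient_alg A I"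
  by (intro module_quotient.intro module_quotient_axioms.intro module_axioms ideal_submodule)
    (simp_all only: quotient_alg_def module.simps partial_object.simps monoid.simps ring.simps)

text \<open>\<open>rcoset_mult\<close> is a union over both cosets, so every product of
  representatives must give the same coset. The factors are exchanged one at a time: x' y' - x y' =
  (x' - x) y' uses that I is a right ideal, x y' - x y = x (y' - y) that it is a left ideal.\<close>

lemma coset_mult:
  assumes x: "x \<in> carrier A" and y: "y \<in> carrier A"
  shows "(I +>\<^bsub>A\<^esub> x) \<otimes>\<^bsub>quotient_alg A I\<^esub> (I +>\<^bsub>A\<^esub> y) = I +>\<^bsub>A\<^esub> (x \<otimes>\<^bsub>A\<^esub> y)"
proof -
  have "I +>\<^bsub>A\<^esub> (x' \<otimes>\<^bsub>A\<^esub> y') = I +>\<^bsub>A\<^esub> (x \<otimes>\<^bsub>A\<^esub> y)"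
    if "x' \<in> I +>\<^bsub>A\<^esub> x" "y' \<in> I +>\<^bsub>A\<^esub> y" for x' y'
  proof -
    note mx = quotient.coset_mem[OF x that(1)] and my = quotient.coset_mem[OF y that(2)]
    have x': "x' \<in> carrier A" "x' \<ominus>\<^bsub>A\<^esub> x \<in> I" and y': "y' \<in> carrier A" "y' \<ominus>\<^bsub>A\<^esub> y \<in> I"
      using mx my quotient.coset_eq_iff[OF mx(1) x] quotient.coset_eq_iff[OF my(1) y] by simp_all
    have "(x' \<ominus>\<^bsub>A\<^esub> x) \<otimes>\<^bsub>A\<^esub> y' = x' \<otimes>\<^bsub>A\<^esub> y' \<ominus>\<^bsub>A\<^esub> x \<otimes>\<^bsub>A\<^esub> y'"
      "x \<otimes>\<^bsub>A\<^esub> (y' \<ominus>\<^bsub>A\<^esub> y) = x \<otimes>\<^bsub>A\<^esub> y' \<ominus>\<^bsub>A\<^esub> x \<otimes>\<^bsub>A\<^esub> y"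
      using lin_map_minus[OF module_axioms module_axioms mult_left_lin_map[OF y'(1)] x'(1) x]
        lin_map_minus[OF module_axioms module_axioms mult_right_lin_map[OF x] y'(1) y] .
    with ideal_left[OF y'(2) x] ideal_right[OF x'(2) y'(1)]
    have "I +>\<^bsub>A\<^esub> (x' \<otimes>\<^bsub>A\<^esub> y') = I +>\<^bsub>A\<^esub> (x \<otimes>\<^bsub>A\<^esub> y')"
      "I +>\<^bsub>A\<^esub> (x \<otimes>\<^bsub>A\<^esub> y') = I +>\<^bsub>A\<^esub> (x \<otimes>\<^bsub>A\<^esub> y)"
      using quotient.coset_eq_iff[OF mult_closed[OF x'(1) y'(1)] mult_closed[OF x y'(1)]]
        quotient.coset_eq_iff[OF mult_closed[OF x y'(1)] mult_closed[OF x y]] by simp_all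
    then show ?thesis
      by (rule trans)
  qed
  then have "rcoset_mult A I (I +>\<^bsub>A\<^esub> x) (I +>\<^bsub>A\<^esub> y) =
      (\<Union>x'\<in>I +>\<^bsub>A\<^esub> x. \<Union>y'\<in>I +>\<^bsub>A\<^esub> y. I +>\<^bsub>A\<^esub> (x \<otimes>\<^bsub>A\<^esub> y))"
    unfolding rcoset_mult_def by (intro SUP_cong) auto
  also have "\<dots> = I +>\<^bsub>A\<^esub> (x \<otimes>\<^bsub>A\<^esub> y)"
    using quotient.coset_self[OF x] quotient.coset_self[OF y] by auto
  finally show ?thesis
    by (simp only: quotient_alg_def monoid.simps)
qed

lemma quotient_nonunital_algebra: "nonunital_algebra F (quotient_alg A I)"
proof (intro nonunital_algebra.intro nonunital_algebra_axioms.intro quotient.quotient_module)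
  note s = coset_mult quotient.coset_add quotient.coset_smult quotient.coset_in mult_closed
    mult_add_left mult_add_right mult_smult_left mult_smult_right mult_assoc
  fix X Y assume X: "X \<in> carrier (quotient_alg A I)" and Y: "Y \<in> carrier (quotient_alg A I)"
  obtain x y where xy: "x \<in> carrier A" "X = I +>\<^bsub>A\<^esub> x" "y \<in> carrier A" "Y = I +>\<^bsub>A\<^esub> y"
    using quotient.coset_ex[OF X] quotient.coset_ex[OF Y] by blast
  then show "X \<otimes>\<^bsub>quotient_alg A I\<^esub> Y \<in> carrier (quotient_alg A I)"
    by (simp add: s)
  fix c assume "c \<in> carrier F"
  with xy show "(c \<odot>\<^bsub>quotient_alg A I\<^esub> X) \<otimes>\<^bsub>quotient_alg A I\<^esub> Y =
      c \<odot>\<^bsub>quotient_alg A I\<^esub> (X \<otimes>\<^bsub>quotient_alg A I\<^esub> Y)"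
    "X \<otimes>\<^bsub>quotient_alg A I\<^esub> (c \<odot>\<^bsub>quotient_alg A I\<^esub> Y) =
      c \<odot>\<^bsub>quotient_alg A I\<^esub> (X \<otimes>\<^bsub>quotient_alg A I\<^esub> Y)"
    by (simp_all add: s)
next
  note s = coset_mult quotient.coset_add quotient.coset_smult quotient.coset_in mult_closed
    mult_add_left mult_add_right mult_smult_left mult_smult_right mult_assoc
  fix X Y Z
  assume X: "X \<in> carrier (quotient_alg A I)" and Y: "Y \<in> carrier (quotient_alg A I)"
    and Z: "Z \<in> carrier (quotient_alg A I)"
  obtain x y z where xyz: "x \<in> carrier A" "X = I +>\<^bsub>A\<^esub> x" "y \<in> carrier A" "Y = I +>\<^bsub>A\<^esub> y"
      "z \<in> carrier A" "Z = I +>\<^bsub>A\<^esub> z"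
    using quotient.coset_ex[OF X] quotient.coset_ex[OF Y] quotient.coset_ex[OF Z] by blast
  then show "(X \<oplus>\<^bsub>quotient_alg A I\<^esub> Y) \<otimes>\<^bsub>quotient_alg A I\<^esub> Z =
       X \<otimes>\<^bsub>quotient_alg A I\<^esub> Z \<oplus>\<^bsub>quotient_alg A I\<^esub> Y \<otimes>\<^bsub>quotient_alg A I\<^esub> Z"
    "X \<otimes>\<^bsub>quotient_alg A I\<^esub> (Y \<oplus>\<^bsub>quotient_alg A I\<^esub> Z) =
       X \<otimes>\<^bsub>quotient_alg A I\<^esub> Y \<oplus>\<^bsub>quotient_alg A I\<^esub> X \<otimes>\<^bsub>quotient_alg A I\<^esub> Z"
    "X \<otimes>\<^bsub>quotient_alg A I\<^esub> Y \<otimes>\<^bsub>quotient_alg A I\<^esub> Z =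
       X \<otimes>\<^bsub>quotient_alg A I\<^esub> (Y \<otimes>\<^bsub>quotient_alg A I\<^esub> Z)"
    by (simp_all add: s)
qed

end

lemma ideal_gen_incl: "S \<subseteq> ideal_gen F A S"
  by (auto simp: ideal_gen_def)

lemma ideal_gen_ideal:
  assumes A: "nonunital_algebra F A" and S: "S \<subseteq> carrier A"
  shows "algebra_ideal F A (ideal_gen F A S)"
proof -
  interpret nonunital_algebra F A by (rule A)
  show ?thesis
  proof (intro algebra_ideal.intro algebra_ideal_axioms.intro A)
    show "submodule (ideal_gen F A S) F A"
      unfolding ideal_gen_def
    proof (rule submodule_Int[OF module_axioms])
      \<comment> \<open>The intersection of an empty family would be the whole type; here the
        algebra itself is a member.\<close>
      show "{I. submodule I F A \<and> S \<subseteq> I \<and>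
          (\<forall>x\<in>I. \<forall>a\<in>carrier A. a \<otimes>\<^bsub>A\<^esub> x \<in> I \<and> x \<otimes>\<^bsub>A\<^esub> a \<in> I)} \<noteq> {}"
        using S carrier_is_submodule mult_closed by (auto intro!: exI[of _ "carrier A"])
    qed simp
  qed (auto simp: ideal_gen_def)
qed

section \<open>Convolution products\<close>

text \<open>
  Common shape of the products of the free algebra and of the path algebra: \<open>w\<close> has
  \<open>n w + 1\<close> factorisations, the \<open>i\<close>-th one being \<open>w = a w i \<cdot> b w i\<close>.
\<close>

definition convolution ::
  "('k, 'z) ring_scheme \<Rightarrow> ('x \<Rightarrow> nat) \<Rightarrow> ('x \<Rightarrow> nat \<Rightarrow> 'x) \<Rightarrow> ('x \<Rightarrow> nat \<Rightarrow> 'x) \<Rightarrow>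
    ('x \<Rightarrow> 'k) \<Rightarrow> ('x \<Rightarrow> 'k) \<Rightarrow> 'x \<Rightarrow> 'k" where
  "convolution F n a b f g w = (\<Oplus>\<^bsub>F\<^esub>i\<in>{..n w}. f (a w i) \<otimes>\<^bsub>F\<^esub> g (b w i))"

text \<open>\<open>factor_inj\<close> says that a pair of factors determines both the element and
  the place of the cut. It gives finite supports of products and makes the product of two basis
  elements a basis element or zero. \<open>factor_closed\<close> keeps the support of a product
  inside X.\<close>

locale factorisation = F: cring F
  for F :: "('k, 'z) ring_scheme" +
  fixes X :: "'x set" and n :: "'x \<Rightarrow> nat" and a b :: "'x \<Rightarrow> nat \<Rightarrow> 'x"
  assumes factor_inj: "\<lbrakk>i \<le> n w; j \<le> n v; a w i = a v j; b w i = b v j\<rbrakk> \<Longrightarrow> w = v \<and> i = j"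
    and factor_closed: "\<lbrakk>i \<le> n w; a w i \<in> X; b w i \<in> X\<rbrakk> \<Longrightarrow> w \<in> X"
begin

lemmas carrier_iff = free_mod_carrier[OF F.is_cring]

lemma convolution_closed:
  assumes f: "f \<in> carrier (free_mod F X)" and g: "g \<in> carrier (free_mod F X)"
  shows "convolution F n a b f g \<in> carrier (free_mod F X)"
proof -
  have fc: "f x \<in> carrier F" "g x \<in> carrier F" for x
    using f g by (simp_all add: carrier_iff)
  have z: "convolution F n a b f g w = \<zero>\<^bsub>F\<^esub>"
    if "\<And>i. i \<le> n w \<Longrightarrow> f (a w i) = \<zero>\<^bsub>F\<^esub> \<or> g (b w i) = \<zero>\<^bsub>F\<^esub>" for w
    unfolding convolution_def
    by (rule F.add.finprod_one_eqI) (use that fc in fastforce)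
  \<comment> \<open>A nonzero value at w needs a cut i whose two factors lie in the supports of f
    and g. By \<open>factor_inj\<close> these pairs (w, i) embed into the product of the two
    supports, so there are finitely many.\<close>
  let ?S = "{(w, i). i \<le> n w \<and> f (a w i) \<noteq> \<zero>\<^bsub>F\<^esub> \<and> g (b w i) \<noteq> \<zero>\<^bsub>F\<^esub>}"
  let ?h = "\<lambda>(w, i). (a w i, b w i)"
  have "?h ` ?S \<subseteq> {x. f x \<noteq> \<zero>\<^bsub>F\<^esub>} \<times> {x. g x \<noteq> \<zero>\<^bsub>F\<^esub>}"
    by auto
  moreover have "finite ({x. f x \<noteq> \<zero>\<^bsub>F\<^esub>} \<times> {x. g x \<noteq> \<zero>\<^bsub>F\<^esub>})"
    using f g by (simp add: carrier_iff)
  ultimately have "finite (?h ` ?S)"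
    by (rule finite_subset)
  moreover have "inj_on ?h ?S"
    using factor_inj by (auto simp: inj_on_def)
  ultimately have "finite ?S"
    by (rule finite_imageD)
  moreover have "{w. convolution F n a b f g w \<noteq> \<zero>\<^bsub>F\<^esub>} \<subseteq> fst ` ?S"
    using z by force
  ultimately have "finite {w. convolution F n a b f g w \<noteq> \<zero>\<^bsub>F\<^esub>}"
    by (meson finite_imageI finite_subset)
  moreover have "convolution F n a b f g w = \<zero>\<^bsub>F\<^esub>" if "w \<notin> X" for w
  proof (rule z)
    fix i assume "i \<le> n w"
    then have "a w i \<notin> X \<or> b w i \<notin> X"
      using factor_closed that by blast
    then show "f (a w i) = \<zero>\<^bsub>F\<^esub> \<or> g (b w i) = \<zero>\<^bsub>F\<^esub>"
      using f g by (auto simp: carrier_iff)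
  qed
  moreover have "convolution F n a b f g w \<in> carrier F" for w
    unfolding convolution_def by (rule F.finsum_closed) (use fc in auto)
  ultimately show ?thesis
    by (simp add: carrier_iff)
qed

lemma convolution_left_lin_map:
  assumes g: "g \<in> carrier (free_mod F X)"
  shows "lin_map F (free_mod F X) (free_mod F X) (\<lambda>f. convolution F n a b f g)"
proof (rule lin_mapI)
  fix f assume f: "f \<in> carrier (free_mod F X)"
  then show "convolution F n a b f g \<in> carrier (free_mod F X)"
    using g by (rule convolution_closed)
  have c: "f x \<in> carrier F" "g x \<in> carrier F" for x
    using f g by (simp_all add: carrier_iff)
  { fix f' assume "f' \<in> carrier (free_mod F X)"
    then have c': "f' x \<in> carrier F" for x
      by (simp add: carrier_iff)
    show "convolution F n a b (f \<oplus>\<^bsub>free_mod F X\<^esub> f') g =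
      convolution F n a b f g \<oplus>\<^bsub>free_mod F X\<^esub> convolution F n a b f' g"
      by (rule ext) (simp add: free_mod_simps[OF F.is_cring] convolution_def c c' F.l_distr
          F.finsum_addf Pi_iff) }
  fix d assume "d \<in> carrier F"
  then show "convolution F n a b (d \<odot>\<^bsub>free_mod F X\<^esub> f) g =
      d \<odot>\<^bsub>free_mod F X\<^esub> convolution F n a b f g"
    by (intro ext) (simp add: free_mod_simps[OF F.is_cring] convolution_def c F.m_assoc
        F.finsum_rdistr Pi_iff)
qed

lemma convolution_right_lin_map:
  assumes f: "f \<in> carrier (free_mod F X)"
  shows "lin_map F (free_mod F X) (free_mod F X) (\<lambda>g. convolution F n a b f g)"
proof (rule lin_mapI)
  fix g assume g: "g \<in> carrier (free_mod F X)"
  show "convolution F n a b f g \<in> carrier (free_mod F X)"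
    using f g by (rule convolution_closed)
  have c: "f x \<in> carrier F" "g x \<in> carrier F" for x
    using f g by (simp_all add: carrier_iff)
  { fix g' assume "g' \<in> carrier (free_mod F X)"
    then have c': "g' x \<in> carrier F" for x
      by (simp add: carrier_iff)
    show "convolution F n a b f (g \<oplus>\<^bsub>free_mod F X\<^esub> g') =
      convolution F n a b f g \<oplus>\<^bsub>free_mod F X\<^esub> convolution F n a b f g'"
      by (rule ext) (simp add: free_mod_simps[OF F.is_cring] convolution_def c c' F.r_distr
          F.finsum_addf Pi_iff) }
  fix d assume "d \<in> carrier F"
  then show "convolution F n a b f (d \<odot>\<^bsub>free_mod F X\<^esub> g) =
      d \<odot>\<^bsub>free_mod F X\<^esub> convolution F n a b f g"
    by (intro ext) (simp add: free_mod_simps[OF F.is_cring] convolution_def c F.m_lcomm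
        F.finsum_rdistr Pi_iff)
qed

lemma convolution_basis:
  assumes i: "i \<le> n w"
  shows "convolution F n a b (basis_elem F (a w i)) (basis_elem F (b w i)) = basis_elem F w"
proof
  fix v
  let ?f = "\<lambda>j. basis_elem F (a w i) (a v j) \<otimes>\<^bsub>F\<^esub> basis_elem F (b w i) (b v j)"
  have "?f j = (if v = w \<and> j = i then \<one>\<^bsub>F\<^esub> else \<zero>\<^bsub>F\<^esub>)" if "j \<le> n v" for j
    using factor_inj[OF that i] by (auto simp: basis_elem_def)
  then have "convolution F n a b (basis_elem F (a w i)) (basis_elem F (b w i)) v =
    (\<Oplus>\<^bsub>F\<^esub>j\<in>{..n v}. if v = w \<and> j = i then \<one>\<^bsub>F\<^esub> else \<zero>\<^bsub>F\<^esub>)"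
    unfolding convolution_def by (intro F.finsum_cong') auto
  also have "\<dots> = basis_elem F w v"
    using F.add.finprod_singleton_swap[of i "{..n v}" "\<lambda>_. \<one>\<^bsub>F\<^esub>"] i
    by (cases "v = w") (auto simp: basis_elem_def)
  finally show "convolution F n a b (basis_elem F (a w i)) (basis_elem F (b w i)) v =
    basis_elem F w v" .
qed

text \<open>A convolution sees only pairs that occur as the two factors of a cut. This is how
  non-composable paths come to multiply to zero.\<close>

lemma convolution_basis_zero:
  assumes "\<And>w i. \<lbrakk>i \<le> n w; a w i = p; b w i = q\<rbrakk> \<Longrightarrow> False"
  shows "convolution F n a b (basis_elem F p) (basis_elem F q) = (\<lambda>_. \<zero>\<^bsub>F\<^esub>)"
proof
  fix v show "convolution F n a b (basis_elem F p) (basis_elem F q) v = \<zero>\<^bsub>F\<^esub>"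
    unfolding convolution_def
    by (rule F.add.finprod_one_eqI) (use assms in \<open>auto simp: basis_elem_def\<close>)
qed

end

section \<open>The free algebra\<close>

context
  fixes F :: "('k, 'z) ring_scheme" and G :: "'g set"
  assumes F: "cring F"
begin

interpretation F: cring F by (rule F)

text \<open>The cuts 0 and \<open>length w\<close> leave an empty factor. They contribute nothing,
  because elements of the free algebra vanish on the empty word.\<close>

interpretation factorisation F "{w \<in> lists G. w \<noteq> []}" length "\<lambda>w i. take i w" "\<lambda>w i. drop i w"
proof
  show "w = v \<and> i = j"
    if "i \<le> length w" "j \<le> length v" "take i w = take j v" "drop i w = drop j v"
    for i j and w v :: "'g list"
    using that by (metis append_take_drop_id length_take min.absorb2)
  show "w \<in> {w \<in> lists G. w \<noteq> []}"
    if "i \<le> length w" "take i w \<in> {w \<in> lists G. w \<noteq> []}" "drop i w \<in> {w \<in> lists G. w \<noteq> []}" for i w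
    using that by (metis (mono_tags, lifting) append_in_lists_conv append_take_drop_id mem_Collect_eq
        take_Nil)
qed

lemma free_alg_simps:
  "carrier (free_alg F G) = carrier (free_mod F {w \<in> lists G. w \<noteq> []})"
  "zero (free_alg F G) = zero (free_mod F {w \<in> lists G. w \<noteq> []})"
  "add (free_alg F G) = add (free_mod F {w \<in> lists G. w \<noteq> []})"
  "smult (free_alg F G) = smult (free_mod F {w \<in> lists G. w \<noteq> []})"
  by (simp_all add: free_alg_def)

lemma free_alg_mult:
  "mult (free_alg F G) = convolution F length (\<lambda>w i. take i w) (\<lambda>w i. drop i w)"
  by (simp add: free_alg_def convolution_def fun_eq_iff)

lemma free_alg_module: "Module.module F (free_alg F G)"
  by (rule module_cong[OF free_mod_module[OF F] free_alg_simps])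

lemma free_alg_basis_closed: "\<lbrakk>w \<in> lists G; w \<noteq> []\<rbrakk> \<Longrightarrow> basis_elem F w \<in> carrier (free_alg F G)"
  by (simp add: free_alg_simps basis_elem_closed[OF F])

lemma free_alg_basis_mult:
  "basis_elem F w \<otimes>\<^bsub>free_alg F G\<^esub> basis_elem F v = basis_elem F (w @ v)"
  using convolution_basis[of "length w" "w @ v"] by (simp add: free_alg_mult)

lemma free_alg_submodule_induct:
  assumes "submodule H F (free_alg F G)"
    and "\<And>w. \<lbrakk>w \<in> lists G; w \<noteq> []\<rbrakk> \<Longrightarrow> basis_elem F w \<in> H" and "f \<in> carrier (free_alg F G)"
  shows "f \<in> H"
  using free_mod_induct[OF F, of H "{w \<in> lists G. w \<noteq> []}" f] assms
  by (simp add: free_alg_simps submodule_cong[OF free_alg_simps])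

lemma lin_map_free_alg_eqI:
  assumes N: "Module.module F N" and h: "lin_map F (free_alg F G) N h"
    and g: "lin_map F (free_alg F G) N g"
    and "\<And>w. \<lbrakk>w \<in> lists G; w \<noteq> []\<rbrakk> \<Longrightarrow> h (basis_elem F w) = g (basis_elem F w)"
    and f: "f \<in> carrier (free_alg F G)"
  shows "h f = g f"
  using free_alg_submodule_induct[OF submodule_equalizer[OF free_alg_module N h g] _ f] assms(4)
    free_alg_basis_closed by auto

lemma free_alg_mult_left_lin_map:
  "y \<in> carrier (free_alg F G) \<Longrightarrow> lin_map F (free_alg F G) (free_alg F G) (\<lambda>x. x \<otimes>\<^bsub>free_alg F G\<^esub> y)"
  unfolding free_alg_mult
  using convolution_left_lin_map[of y] by (simp add: lin_map_def free_alg_simps)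

lemma free_alg_mult_right_lin_map:
  "x \<in> carrier (free_alg F G) \<Longrightarrow> lin_map F (free_alg F G) (free_alg F G) (\<lambda>y. x \<otimes>\<^bsub>free_alg F G\<^esub> y)"
  unfolding free_alg_mult
  using convolution_right_lin_map[of x] by (simp add: lin_map_def free_alg_simps)

lemma free_alg_nonunital_algebra: "nonunital_algebra F (free_alg F G)"
proof (intro nonunital_algebra.intro nonunital_algebra_axioms.intro free_alg_module)
  note l = free_alg_mult_left_lin_map and r = free_alg_mult_right_lin_map
  show c: "x \<otimes>\<^bsub>free_alg F G\<^esub> y \<in> carrier (free_alg F G)"
    if "x \<in> carrier (free_alg F G)" "y \<in> carrier (free_alg F G)" for x y
    using lin_map_closed[OF l] that by blast
  note eqI = lin_map_free_alg_eqI[OF free_alg_module]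
  fix x y z
  assume x: "x \<in> carrier (free_alg F G)" and y: "y \<in> carrier (free_alg F G)"
    and z: "z \<in> carrier (free_alg F G)"
  note cl = free_alg_basis_closed
  \<comment> \<open>Both sides are linear in each of the three arguments. Replacing these by basis
    words one after the other leaves the associativity of concatenation.\<close>
  show "x \<otimes>\<^bsub>free_alg F G\<^esub> y \<otimes>\<^bsub>free_alg F G\<^esub> z = x \<otimes>\<^bsub>free_alg F G\<^esub> (y \<otimes>\<^bsub>free_alg F G\<^esub> z)"
  proof (rule eqI[OF lin_map_comp[OF l[OF y] l[OF z]] l[OF c[OF y z]] _ x])
    fix u assume u: "u \<in> lists G" "u \<noteq> []"
    show "basis_elem F u \<otimes>\<^bsub>free_alg F G\<^esub> y \<otimes>\<^bsub>free_alg F G\<^esub> z =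
      basis_elem F u \<otimes>\<^bsub>free_alg F G\<^esub> (y \<otimes>\<^bsub>free_alg F G\<^esub> z)"
    proof (rule eqI[OF lin_map_comp[OF r[OF cl[OF u]] l[OF z]]
          lin_map_comp[OF l[OF z] r[OF cl[OF u]]] _ y])
      fix v assume v: "v \<in> lists G" "v \<noteq> []"
      show "basis_elem F u \<otimes>\<^bsub>free_alg F G\<^esub> basis_elem F v \<otimes>\<^bsub>free_alg F G\<^esub> z =
        basis_elem F u \<otimes>\<^bsub>free_alg F G\<^esub> (basis_elem F v \<otimes>\<^bsub>free_alg F G\<^esub> z)"
        by (rule eqI[OF r[OF c[OF cl[OF u] cl[OF v]]]
          lin_map_comp[OF r[OF cl[OF v]] r[OF cl[OF u]]] _ z]) (simp add: free_alg_basis_mult)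
    qed
  qed
next
  note l = free_alg_mult_left_lin_map and r = free_alg_mult_right_lin_map
  fix x y z c
  assume x: "x \<in> carrier (free_alg F G)" and y: "y \<in> carrier (free_alg F G)"
  show "(x \<oplus>\<^bsub>free_alg F G\<^esub> y) \<otimes>\<^bsub>free_alg F G\<^esub> z =
      x \<otimes>\<^bsub>free_alg F G\<^esub> z \<oplus>\<^bsub>free_alg F G\<^esub> y \<otimes>\<^bsub>free_alg F G\<^esub> z" if "z \<in> carrier (free_alg F G)"
    using lin_map_add[OF l[OF that] x y] .
  show "x \<otimes>\<^bsub>free_alg F G\<^esub> (y \<oplus>\<^bsub>free_alg F G\<^esub> z) =
      x \<otimes>\<^bsub>free_alg F G\<^esub> y \<oplus>\<^bsub>free_alg F G\<^esub> x \<otimes>\<^bsub>free_alg F G\<^esub> z" if "z \<in> carrier (free_alg F G)"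
    using lin_map_add[OF r[OF x] y that] .
  assume c: "c \<in> carrier F"
  show "(c \<odot>\<^bsub>free_alg F G\<^esub> x) \<otimes>\<^bsub>free_alg F G\<^esub> y = c \<odot>\<^bsub>free_alg F G\<^esub> (x \<otimes>\<^bsub>free_alg F G\<^esub> y)"
    using lin_map_smult[OF l[OF y] c x] .
  show "x \<otimes>\<^bsub>free_alg F G\<^esub> (c \<odot>\<^bsub>free_alg F G\<^esub> y) = c \<odot>\<^bsub>free_alg F G\<^esub> (x \<otimes>\<^bsub>free_alg F G\<^esub> y)"
    using lin_map_smult[OF r[OF x] c y] .
qed

lemma free_alg_induct:
  assumes H: "submodule H F (free_alg F G)"
    and m: "\<And>x y. \<lbrakk>x \<in> H; y \<in> H\<rbrakk> \<Longrightarrow> x \<otimes>\<^bsub>free_alg F G\<^esub> y \<in> H"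
    and g: "\<And>l. l \<in> G \<Longrightarrow> basis_elem F [l] \<in> H" and f: "f \<in> carrier (free_alg F G)"
  shows "f \<in> H"
proof (rule free_alg_submodule_induct[OF H _ f])
  fix w assume "w \<in> lists G" "w \<noteq> []"
  then show "basis_elem F w \<in> H"
  proof (induction w rule: lists.induct)
    case (Cons l w)
    \<comment> \<open>A one-letter word is a generator and must not be split further: the empty word
      is not an element of the algebra.\<close>
    show ?case
    proof (cases "w = []")
      case True
      then show ?thesis using Cons.hyps g by simp
    next
      case False
      then have "basis_elem F [l] \<otimes>\<^bsub>free_alg F G\<^esub> basis_elem F w \<in> H"
        using m[OF g Cons.IH] Cons.hyps by simp
      then show ?thesis by (simp add: free_alg_basis_mult)
    qed
  qed simp
qed

end

section \<open>Unital right modules\<close>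

context right_module
begin

lemma act_left_lin_map: "a \<in> carrier A \<Longrightarrow> lin_map F M M (\<lambda>m. m \<triangleleft>\<^bsub>M\<^esub> a)"
  by (rule lin_mapI) (simp_all add: act_closed act_add_left act_smult_left)

lemma act_right_lin_map: "m \<in> carrier M \<Longrightarrow> lin_map F A M (\<lambda>a. m \<triangleleft>\<^bsub>M\<^esub> a)"
  by (rule lin_mapI) (simp_all add: act_closed act_add_right act_smult_right)

lemma act_span_submodule:
  "submodule (generate (add_monoid M) {m \<triangleleft>\<^bsub>M\<^esub> a | m a. m \<in> carrier M \<and> a \<in> carrier A}) F M"
proof (rule generate_submodule[OF module_axioms])
  fix c x assume c: "c \<in> carrier F" and "x \<in> {m \<triangleleft>\<^bsub>M\<^esub> a | m a. m \<in> carrier M \<and> a \<in> carrier A}"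
  then obtain m a where m: "m \<in> carrier M" "a \<in> carrier A" "x = m \<triangleleft>\<^bsub>M\<^esub> a"
    by blast
  then have "c \<odot>\<^bsub>M\<^esub> x = (c \<odot>\<^bsub>M\<^esub> m) \<triangleleft>\<^bsub>M\<^esub> a"
    using c by (simp add: act_smult_left)
  with m c show "c \<odot>\<^bsub>M\<^esub> x \<in> {m \<triangleleft>\<^bsub>M\<^esub> a | m a. m \<in> carrier M \<and> a \<in> carrier A}"
    by blast
qed (auto intro: act_closed)

lemma unitalI:
  assumes "\<And>m. m \<in> carrier M \<Longrightarrow>
    m \<in> generate (add_monoid M) {m \<triangleleft>\<^bsub>M\<^esub> a | m a. m \<in> carrier M \<and> a \<in> carrier A}"
  shows "unital_right_module F A M"
  by unfold_locales (use assms submoduleE(1)[OF act_span_submodule] in blast)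

end

lemma (in unital_right_module) unital_induct:
  assumes H: "submodule H F M"
    and a: "\<And>m a. \<lbrakk>m \<in> carrier M; a \<in> carrier A\<rbrakk> \<Longrightarrow> m \<triangleleft>\<^bsub>M\<^esub> a \<in> H" and m: "m \<in> carrier M"
  shows "m \<in> H"
proof -
  have "{m \<triangleleft>\<^bsub>M\<^esub> a | m a. m \<in> carrier M \<and> a \<in> carrier A} \<subseteq> H"
    using a by blast
  then have "generate (add_monoid M) {m \<triangleleft>\<^bsub>M\<^esub> a | m a. m \<in> carrier M \<and> a \<in> carrier A} \<subseteq> H"
    using M.add.generate_subgroup_incl H by (simp add: submodule_def)
  then show ?thesis
    using unital m by auto
qed

lemma mod_hom_lin_map: "f \<in> mod_hom F A M N \<Longrightarrow> lin_map F M N f"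
  by (auto simp: mod_hom_def lin_map_def)

lemma mod_hom_act:
  "\<lbrakk>f \<in> mod_hom F A M N; x \<in> carrier M; a \<in> carrier A\<rbrakk> \<Longrightarrow> f (x \<triangleleft>\<^bsub>M\<^esub> a) = f x \<triangleleft>\<^bsub>N\<^esub> a"
  by (simp add: mod_hom_def)

text \<open>\<open>h\<close> is the formula at hand and \<open>f\<close> its extensional version:
  morphisms must be \<open>undefined\<close> off the carrier, while maps such as
  \<open>induced\<close> are given everywhere.\<close>

lemma mod_homI:
  assumes "lin_map F M N h"
    and "\<And>x a. \<lbrakk>x \<in> carrier M; a \<in> carrier A\<rbrakk> \<Longrightarrow> h (x \<triangleleft>\<^bsub>M\<^esub> a) = h x \<triangleleft>\<^bsub>N\<^esub> a"
    and "\<And>x. x \<in> carrier M \<Longrightarrow> f x = h x" "f \<in> extensional (carrier M)"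
    and "right_module F A M"
  shows "f \<in> mod_hom F A M N"
proof -
  interpret right_module F A M by fact
  show ?thesis
    using assms(1-4) by (auto simp: mod_hom_def lin_map_def PiE_def act_closed)
qed

lemma mod_isoI:
  assumes M: "right_module F A M" and N: "right_module F A N" and f: "f \<in> mod_hom F A M N"
    and inj: "inj_on f (carrier M)" and surj: "f ` carrier M = carrier N"
  shows "f \<in> mod_iso F A M N"
proof -
  interpret M: right_module F A M by (rule M)
  interpret N: right_module F A N by (rule N)
  note fl = mod_hom_lin_map[OF f]
  note fc = lin_map_closed[OF fl]
  let ?i = "inv_into (carrier M) f"
  \<comment> \<open>The inverse is cut down to the carrier because morphisms are extensional;
    linearity is checked on \<open>?i\<close> itself.\<close>
  define g where "g = restrict ?i (carrier N)"
  have i: "?i y \<in> carrier M" "f (?i y) = y" if "y \<in> carrier N" for y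
    using that surj inv_into_into[of y f "carrier M"] f_inv_into_f[of y f "carrier M"] by auto
  have i_eq: "?i y = x" if "x \<in> carrier M" "f x = y" for x y
    using inv_into_f_f[OF inj that(1)] that(2) by simp
  have il: "lin_map F N M ?i"
    by (rule lin_mapI) (simp_all add: i i_eq lin_map_add[OF fl] lin_map_smult[OF fl])
  have "g \<in> mod_hom F A N M"
  proof (rule mod_homI[OF il _ _ _ N])
    show "?i (x \<triangleleft>\<^bsub>N\<^esub> a) = ?i x \<triangleleft>\<^bsub>M\<^esub> a" if "x \<in> carrier N" "a \<in> carrier A" for x a
      using f i that by (intro i_eq) (simp_all add: M.act_closed mod_hom_def)
  qed (simp_all add: g_def)
  moreover have "compose (carrier M) g f = mod_id M" "compose (carrier N) f g = mod_id N"
    unfolding compose_def mod_id_def using i i_eq fc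
    by (auto simp: g_def fun_eq_iff restrict_def)
  ultimately show ?thesis
    using f unfolding mod_iso_def by blast
qed

lemma mod_hom_extensional: "f \<in> mod_hom F A M N \<Longrightarrow> f \<in> extensional (carrier M)"
  by (simp add: mod_hom_def PiE_def)

lemma mod_id_hom: "right_module F A M \<Longrightarrow> mod_id M \<in> mod_hom F A M M"
  by (rule mod_homI[of F M M "\<lambda>x. x"]) (auto simp: mod_id_def intro!: lin_mapI)

lemma mod_hom_compose:
  assumes M: "right_module F A M" and f: "f \<in> mod_hom F A M N" and g: "g \<in> mod_hom F A N L"
  shows "compose (carrier M) g f \<in> mod_hom F A M L"
  by (rule mod_homI[OF lin_map_comp[OF mod_hom_lin_map[OF f] mod_hom_lin_map[OF g]] _ _ _ M])
    (use f g in \<open>auto simp: mod_hom_def compose_def\<close>)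

lemma is_functorD:
  assumes "is_functor F A B T"
  shows "M \<in> right_mods F A \<Longrightarrow> fobj T M \<in> right_mods F B"
    and "\<lbrakk>M \<in> right_mods F A; N \<in> right_mods F A; f \<in> mod_hom F A M N\<rbrakk> \<Longrightarrow>
      fmor T M N f \<in> mod_hom F B (fobj T M) (fobj T N)"
    and "M \<in> right_mods F A \<Longrightarrow> fmor T M M (mod_id M) = mod_id (fobj T M)"
    and "\<lbrakk>M \<in> right_mods F A; N \<in> right_mods F A; P \<in> right_mods F A;
        f \<in> mod_hom F A M N; g \<in> mod_hom F A N P\<rbrakk> \<Longrightarrow>
      fmor T M P (compose (carrier M) g f) =
      compose (carrier (fobj T M)) (fmor T N P g) (fmor T M N f)"
  using assms unfolding is_functor_def by blast+

lemma comp_is_functor: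
  fixes T :: "('k, 'a, 'm, 'b, 'n) mod_functor" and S :: "('k, 'b, 'n, 'c, 'p) mod_functor"
  assumes T: "is_functor F A B T" and S: "is_functor F B C S"
  shows "is_functor F A C (comp_functor S T)"
  unfolding is_functor_def comp_functor_def mod_functor.simps
proof (intro conjI ballI)
  fix M N P :: "('k, 'a, 'm) rmodule" and f g
  assume o: "M \<in> right_mods F A" "N \<in> right_mods F A" "P \<in> right_mods F A"
    and f: "f \<in> mod_hom F A M N" and g: "g \<in> mod_hom F A N P"
  show "fmor S (fobj T M) (fobj T P) (fmor T M P (compose (carrier M) g f)) =
    compose (carrier (fobj S (fobj T M))) (fmor S (fobj T N) (fobj T P) (fmor T N P g))
      (fmor S (fobj T M) (fobj T N) (fmor T M N f))"
    unfolding is_functorD(4)[OF T o f g]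
    by (rule is_functorD(4)[OF S]) (simp_all add: is_functorD[OF T] o f g)
qed (simp_all add: is_functorD[OF T] is_functorD[OF S])

section \<open>Restriction and tensor products\<close>

lemma restriction_functor_simps:
  "carrier (fobj (restriction_functor \<phi>) M) = carrier M"
  "zero (fobj (restriction_functor \<phi>) M) = zero M"
  "add (fobj (restriction_functor \<phi>) M) = add M"
  "smult (fobj (restriction_functor \<phi>) M) = smult M"
  "ract (fobj (restriction_functor \<phi>) M) = (\<lambda>m a. m \<triangleleft>\<^bsub>M\<^esub> \<phi> a)"
  by (simp_all add: restriction_functor_def)

text \<open>A restricted module can fail to be unital, as M = M B does not give M = M \<phi>(A). The
  assumption \<open>unit\<close> isolates this point; for Leavitt path algebras it is supplied by
  local units in the image of \<phi>.\<close>

lemma restriction_is_functor: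
  fixes F :: "('k, 'z) ring_scheme" and A :: "('k, 'a, 'x) module_scheme"
    and B :: "('k, 'b, 'y) module_scheme"
  assumes \<phi>: "lin_map F A B \<phi>"
    and \<phi>_mult: "\<And>x y. \<lbrakk>x \<in> carrier A; y \<in> carrier A\<rbrakk> \<Longrightarrow> \<phi> (x \<otimes>\<^bsub>A\<^esub> y) = \<phi> x \<otimes>\<^bsub>B\<^esub> \<phi> y"
    and unit: "\<And>(M :: ('k, 'b, 'm) rmodule) m. \<lbrakk>unital_right_module F B M; m \<in> carrier M\<rbrakk> \<Longrightarrow>
      m \<in> generate (add_monoid (fobj (restriction_functor \<phi>) M))
        {m \<triangleleft>\<^bsub>M\<^esub> \<phi> a | m a. m \<in> carrier M \<and> a \<in> carrier A}"
  shows "is_functor F B A (restriction_functor \<phi> :: ('k, 'b, 'm, 'a, 'm) mod_functor)"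
proof -
  let ?R = "restriction_functor \<phi> :: ('k, 'b, 'm, 'a, 'm) mod_functor"
  note s = restriction_functor_simps[of \<phi>]
  have "unital_right_module F A (fobj ?R M)" if M: "unital_right_module F B M" for M
  proof -
    interpret M: unital_right_module F B M by (rule M)
    have "right_module F A (fobj ?R M)"
      by (intro right_module.intro right_module_axioms.intro
          module_cong[OF M.module_axioms s(1-4)])
        (simp_all add: s M.act_closed M.act_add_left M.act_add_right M.act_smult_left
          M.act_smult_right M.act_assoc lin_map_closed[OF \<phi>] lin_map_add[OF \<phi>]
          lin_map_smult[OF \<phi>] \<phi>_mult)
    then show ?thesis
      by (rule right_module.unitalI) (use unit[OF M] in \<open>simp add: s cong: rev_conj_cong\<close>)
  qed
  moreover have "f \<in> mod_hom F A (fobj ?R M) (fobj ?R N)" if "f \<in> mod_hom F B M N" for f M N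
    using that lin_map_closed[OF \<phi>] by (auto simp: mod_hom_def s)
  ultimately show ?thesis
    unfolding is_functor_def right_mods_def by (auto simp: restriction_functor_def mod_id_def)
qed

section \<open>The tensor product: universal property, right action and functoriality\<close>

definition balanced_map ::
  "('k, 'z) ring_scheme \<Rightarrow> ('k, 'a, 'y) module_scheme \<Rightarrow> ('k, 'a, 'm) rmodule \<Rightarrow>
    ('k, 'a, 'b, 'n) bimodule \<Rightarrow> ('k, 'p, 'w) module_scheme \<Rightarrow> ('m \<Rightarrow> 'n \<Rightarrow> 'p) \<Rightarrow> bool" where
  "balanced_map F A M N P k \<longleftrightarrow>
    (\<forall>n\<in>carrier N. lin_map F M P (\<lambda>m. k m n)) \<and>
    (\<forall>m\<in>carrier M. lin_map F N P (\<lambda>n. k m n)) \<and>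
    (\<forall>m\<in>carrier M. \<forall>a\<in>carrier A. \<forall>n\<in>carrier N. k (m \<triangleleft>\<^bsub>M\<^esub> a) n = k m (a \<triangleright>\<^bsub>N\<^esub> n))"

text \<open>\<open>lact_closed\<close> keeps the balancing relations inside the space of pairs;
  \<open>lact_act\<close> makes them stable under the right action of B, so that this action
  descends to the quotient.\<close>

locale tensor_product =
  M: right_module F A M + N: right_module F B N + B: nonunital_algebra F B
  for F :: "('k, 'z) ring_scheme" (structure)
    and A :: "('k, 'a, 'x) module_scheme" and B :: "('k, 'b, 'y) module_scheme"
    and M :: "('k, 'a, 'm) rmodule" and N :: "('k, 'a, 'b, 'n) bimodule" +
  assumes lact_closed: "\<lbrakk>a \<in> carrier A; n \<in> carrier N\<rbrakk> \<Longrightarrow> a \<triangleright>\<^bsub>N\<^esub> n \<in> carrier N"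
    and lact_act: "\<lbrakk>a \<in> carrier A; n \<in> carrier N; b \<in> carrier B\<rbrakk> \<Longrightarrow>
      (a \<triangleright>\<^bsub>N\<^esub> n) \<triangleleft>\<^bsub>N\<^esub> b = a \<triangleright>\<^bsub>N\<^esub> (n \<triangleleft>\<^bsub>N\<^esub> b)"
begin

abbreviation P where "P \<equiv> pair_mod F M N"
abbreviation K where "K \<equiv> tensor_rels F A M N"
abbreviation T where "T \<equiv> tensor F A M N"

definition tens :: "'m \<Rightarrow> 'n \<Rightarrow> ('m \<times> 'n \<Rightarrow> 'k) set" where
  "tens m n = K +>\<^bsub>P\<^esub> basis_elem F (m, n)"

lemma P_module: "Module.module F P"
  by (rule free_mod_module[OF M.R.is_cring])

lemma pair_closed: "\<lbrakk>m \<in> carrier M; n \<in> carrier N\<rbrakk> \<Longrightarrow> basis_elem F (m, n) \<in> carrier P"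
  by (rule basis_elem_closed[OF M.R.is_cring]) simp

definition rel_gens :: "('m \<times> 'n \<Rightarrow> 'k) set" where
  "rel_gens = 
     {basis_elem F (m \<oplus>\<^bsub>M\<^esub> m', n) \<ominus>\<^bsub>P\<^esub> (basis_elem F (m, n) \<oplus>\<^bsub>P\<^esub> basis_elem F (m', n)) | m m' n.
         m \<in> carrier M \<and> m' \<in> carrier M \<and> n \<in> carrier N} \<union>
      {basis_elem F (m, n \<oplus>\<^bsub>N\<^esub> n') \<ominus>\<^bsub>P\<^esub> (basis_elem F (m, n) \<oplus>\<^bsub>P\<^esub> basis_elem F (m, n')) | m n n'.
         m \<in> carrier M \<and> n \<in> carrier N \<and> n' \<in> carrier N} \<union>
      {basis_elem F (c \<odot>\<^bsub>M\<^esub> m, n) \<ominus>\<^bsub>P\<^esub> c \<odot>\<^bsub>P\<^esub> basis_elem F (m, n) | c m n.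
         c \<in> carrier F \<and> m \<in> carrier M \<and> n \<in> carrier N} \<union>
      {basis_elem F (m, c \<odot>\<^bsub>N\<^esub> n) \<ominus>\<^bsub>P\<^esub> c \<odot>\<^bsub>P\<^esub> basis_elem F (m, n) | c m n.
         c \<in> carrier F \<and> m \<in> carrier M \<and> n \<in> carrier N} \<union>
      {basis_elem F (m \<triangleleft>\<^bsub>M\<^esub> a, n) \<ominus>\<^bsub>P\<^esub> basis_elem F (m, a \<triangleright>\<^bsub>N\<^esub> n) | m a n.
         m \<in> carrier M \<and> a \<in> carrier A \<and> n \<in> carrier N}"

lemma tensor_rels_eq: "K = span_gen F P rel_gens"
  by (simp only: tensor_rels_def rel_gens_def Let_def)

lemma rel_gens_carrier: "rel_gens \<subseteq> carrier P"
proof -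
  interpret P: Module.module F P by (rule P_module)
  note p = pair_closed and mc = P.M.minus_closed P.M.a_closed P.smult_closed
  show ?thesis
    unfolding rel_gens_def
    by (intro Un_least subsetI)
      (clarify; intro mc p; (simp only: M.M.a_closed N.M.a_closed M.smult_closed N.smult_closed M.act_closed
        lact_closed)?)+
qed

lemma K_submodule: "submodule K F P"
  unfolding tensor_rels_eq by (rule span_gen_submodule[OF P_module rel_gens_carrier])

sublocale Q: module_quotient F P K T
  by (intro module_quotient.intro module_quotient_axioms.intro P_module K_submodule)
    (simp_all only: tensor_def Let_def module.simps partial_object.simps monoid.simps ring.simps)

lemma T_module: "Module.module F T"
  by (rule Q.quotient_module)

lemma tens_closed: "\<lbrakk>m \<in> carrier M; n \<in> carrier N\<rbrakk> \<Longrightarrow> tens m n \<in> carrier T"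
  unfolding tens_def by (intro Q.coset_in pair_closed)

text \<open>Each of the five laws says that a difference of elements of \<open>P\<close> lies in
  \<open>K\<close>, and that difference is literally one of the generating relations.\<close>

lemma balanced_map_tens: "balanced_map F A M N T tens"
proof -
  note p = pair_closed and K = span_gen_incl[of rel_gens F P, folded tensor_rels_eq, THEN subsetD]
  have 1: "tens (m \<oplus>\<^bsub>M\<^esub> m') n = tens m n \<oplus>\<^bsub>T\<^esub> tens m' n"
    if "m \<in> carrier M" "m' \<in> carrier M" "n \<in> carrier N" for m m' n
    unfolding tens_def Q.coset_add[OF p[OF that(1,3)] p[OF that(2,3)]]
    by (subst Q.coset_eq_iff[OF p Q.M.a_closed[OF p p]], (simp add: that)+,
        rule K, unfold rel_gens_def, use that in blast)
  have 2: "tens m (n \<oplus>\<^bsub>N\<^esub> n') = tens m n \<oplus>\<^bsub>T\<^esub> tens m n'"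
    if "m \<in> carrier M" "n \<in> carrier N" "n' \<in> carrier N" for m n n'
    unfolding tens_def Q.coset_add[OF p[OF that(1,2)] p[OF that(1,3)]]
    by (subst Q.coset_eq_iff[OF p Q.M.a_closed[OF p p]], (simp add: that)+,
        rule K, unfold rel_gens_def, use that in blast)
  have 3: "tens (c \<odot>\<^bsub>M\<^esub> m) n = c \<odot>\<^bsub>T\<^esub> tens m n"
    if "c \<in> carrier F" "m \<in> carrier M" "n \<in> carrier N" for c m n
    unfolding tens_def Q.coset_smult[OF that(1) p[OF that(2,3)]]
    by (subst Q.coset_eq_iff[OF p Q.smult_closed[OF _ p]], (simp add: that)+,
        rule K, unfold rel_gens_def, use that in blast)
  have 4: "tens m (c \<odot>\<^bsub>N\<^esub> n) = c \<odot>\<^bsub>T\<^esub> tens m n"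
    if "c \<in> carrier F" "m \<in> carrier M" "n \<in> carrier N" for c m n
    unfolding tens_def Q.coset_smult[OF that(1) p[OF that(2,3)]]
    by (subst Q.coset_eq_iff[OF p Q.smult_closed[OF _ p]], (simp add: that)+,
        rule K, unfold rel_gens_def, use that in blast)
  have 5: "tens (m \<triangleleft>\<^bsub>M\<^esub> a) n = tens m (a \<triangleright>\<^bsub>N\<^esub> n)"
    if "m \<in> carrier M" "a \<in> carrier A" "n \<in> carrier N" for m a n
    unfolding tens_def
    by (subst Q.coset_eq_iff[OF p p], (simp add: that M.act_closed lact_closed)+,
        rule K, unfold rel_gens_def, use that in blast)
  show ?thesis
    unfolding balanced_map_def
    by (intro conjI ballI lin_mapI) (simp_all add: 1 2 3 4 5 tens_closed)
qed

lemma tens_lin_map_left: "n \<in> carrier N \<Longrightarrow> lin_map F M T (\<lambda>m. tens m n)"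
  and tens_lin_map_right: "m \<in> carrier M \<Longrightarrow> lin_map F N T (\<lambda>n. tens m n)"
  and tens_balanced: "\<lbrakk>m \<in> carrier M; a \<in> carrier A; n \<in> carrier N\<rbrakk> \<Longrightarrow>
    tens (m \<triangleleft>\<^bsub>M\<^esub> a) n = tens m (a \<triangleright>\<^bsub>N\<^esub> n)"
  using balanced_map_tens by (simp_all add: balanced_map_def)

text \<open>A map agreeing with a balanced map on pairs kills the five families of generators, hence
  their span. The lemma is used twofold: for an arbitrary target it gives the universal property;
  for a map of pairs followed by the projection to a tensor product it shows that the map preserves
  relations.\<close>

lemma K_kernel:
  assumes L: "Module.module F L" and h: "lin_map F P L h"
    and k: "balanced_map F A M N L k"
    and hk: "\<And>m n. \<lbrakk>m \<in> carrier M; n \<in> carrier N\<rbrakk> \<Longrightarrow> h (basis_elem F (m, n)) = k m n"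
    and x: "x \<in> K"
  shows "h x = \<zero>\<^bsub>L\<^esub>"
proof -
  interpret L: Module.module F L by (rule L)
  note p = pair_closed and c = Q.M.a_closed Q.smult_closed M.M.a_closed N.M.a_closed M.smult_closed
    N.smult_closed M.act_closed lact_closed
  have kl: "lin_map F M L (\<lambda>m. k m n)" if "n \<in> carrier N" for n
    using k that by (simp add: balanced_map_def)
  have kr: "lin_map F N L (\<lambda>n. k m n)" if "m \<in> carrier M" for m
    using k that by (simp add: balanced_map_def)
  have kb: "k (m \<triangleleft>\<^bsub>M\<^esub> a) n = k m (a \<triangleright>\<^bsub>N\<^esub> n)"
    if "m \<in> carrier M" "a \<in> carrier A" "n \<in> carrier N" for m a n
    using k that by (simp add: balanced_map_def)
  note kc = lin_map_closed[OF kl]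
  note s = lin_map_minus[OF P_module L h] lin_map_add[OF h] lin_map_smult[OF h] hk
    lin_map_add[OF kl] lin_map_add[OF kr] lin_map_smult[OF kl] lin_map_smult[OF kr]
  have z: "x \<ominus>\<^bsub>L\<^esub> x = \<zero>\<^bsub>L\<^esub>" if "x \<in> carrier L" for x
    using that by (simp add: a_minus_def L.M.r_neg)
  have "rel_gens \<subseteq> {x \<in> carrier P. h x = \<zero>\<^bsub>L\<^esub>}"
  proof
    fix x assume g: "x \<in> rel_gens"
    then have "h x = \<zero>\<^bsub>L\<^esub>"
      unfolding rel_gens_def
      by (elim UnE CollectE exE conjE; hypsubst)
        (simp_all add: s p c kb kc z)
    then show "x \<in> {x \<in> carrier P. h x = \<zero>\<^bsub>L\<^esub>}"
      using rel_gens_carrier g by blast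
  qed
  from span_gen_minimal[OF submodule_equalizer[OF P_module L h lin_map_const_zero[OF L]] this] x
  show ?thesis
    by (auto simp: tensor_rels_eq)
qed

lemma tensor_lift:
  assumes L: "Module.module F L" and k: "balanced_map F A M N L k"
  shows "\<exists>g. lin_map F T L g \<and> (\<forall>m\<in>carrier M. \<forall>n\<in>carrier N. g (tens m n) = k m n)"
proof -
  let ?k = "\<lambda>(m, n). k m n"
  have kc: "?k \<in> carrier M \<times> carrier N \<rightarrow> carrier L"
    using k by (auto simp: balanced_map_def lin_map_def)
  let ?h = "lin_ext F L ?k"
  have h: "lin_map F P L ?h"
    by (rule lin_ext_lin_map[OF M.R.is_cring L kc])
  have hk: "?h (basis_elem F (m, n)) = k m n" if "m \<in> carrier M" "n \<in> carrier N" for m n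
    using lin_ext_basis[OF M.R.is_cring L kc, of "(m, n)"] that by simp
  obtain g where "lin_map F T L g" "\<forall>x\<in>carrier P. g (K +>\<^bsub>P\<^esub> x) = ?h x"
    using Q.quotient_factor[OF L h K_kernel[OF L h k hk]] by blast
  then show ?thesis
    using hk pair_closed unfolding tens_def by (intro exI[of _ g]) simp
qed

lemma tensor_induct:
  assumes H: "submodule H F T"
    and t: "\<And>m n. \<lbrakk>m \<in> carrier M; n \<in> carrier N\<rbrakk> \<Longrightarrow> tens m n \<in> H" and x: "x \<in> carrier T"
  shows "x \<in> H"
proof -
  obtain y where y: "y \<in> carrier P" "x = K +>\<^bsub>P\<^esub> y"
    using Q.coset_ex[OF x] by blast
  have "y \<in> {y \<in> carrier P. K +>\<^bsub>P\<^esub> y \<in> H}"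
    by (rule free_mod_induct[OF M.R.is_cring
          submodule_vimage[OF P_module T_module Q.coset_lin_map H] _ y(1)])
      (use t pair_closed in \<open>auto simp: tens_def\<close>)
  then show ?thesis
    using y by simp
qed

lemma lin_map_tensor_eqI:
  assumes L: "Module.module F L" and h: "lin_map F T L h" and g: "lin_map F T L g"
    and "\<And>m n. \<lbrakk>m \<in> carrier M; n \<in> carrier N\<rbrakk> \<Longrightarrow> h (tens m n) = g (tens m n)"
    and x: "x \<in> carrier T"
  shows "h x = g x"
  using tensor_induct[OF submodule_equalizer[OF T_module L h g] _ x] assms(4) tens_closed by auto

lemma
  assumes b: "b \<in> carrier B"
  shows tensor_act_lin_map: "lin_map F T T (\<lambda>X. X \<triangleleft>\<^bsub>T\<^esub> b)"
    and tens_act: "\<And>m n. \<lbrakk>m \<in> carrier M; n \<in> carrier N\<rbrakk> \<Longrightarrow> tens m n \<triangleleft>\<^bsub>T\<^esub> b = tens m (n \<triangleleft>\<^bsub>N\<^esub> b)"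
proof -
  let ?k = "\<lambda>(m, n). basis_elem F (m, n \<triangleleft>\<^bsub>N\<^esub> b)"
  have kc: "?k \<in> carrier M \<times> carrier N \<rightarrow> carrier P"
    using b by (auto intro!: pair_closed N.act_closed)
  let ?h = "lin_ext F P ?k"
  have h: "lin_map F P P ?h"
    by (rule lin_ext_lin_map[OF M.R.is_cring P_module kc])
  have hk: "?h (basis_elem F (m, n)) = basis_elem F (m, n \<triangleleft>\<^bsub>N\<^esub> b)"
    if "m \<in> carrier M" "n \<in> carrier N" for m n
    using lin_ext_basis[OF M.R.is_cring P_module kc, of "(m, n)"] that by simp
  have bal: "balanced_map F A M N T (\<lambda>m n. tens m (n \<triangleleft>\<^bsub>N\<^esub> b))"
    unfolding balanced_map_def using b
    by (simp add: tens_lin_map_left tens_balanced lact_act N.act_closed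
        lin_map_comp[OF N.act_left_lin_map[OF b] tens_lin_map_right])
  \<comment> \<open>Composed with the projection, \<open>?h\<close> is m, n \<mapsto> m \<otimes> n
    b on pairs. This is balanced because the two actions on N commute, so the composite vanishes on
    \<open>K\<close>, which means that \<open>?h\<close> maps \<open>K\<close> into
    \<open>K\<close>.\<close>
  have HK: "?h x \<in> K" if "x \<in> K" for x
  proof -
    have "x \<in> carrier P"
      using that Q.submoduleE(1)[OF K_submodule] by blast
    moreover have "K +>\<^bsub>P\<^esub> ?h x = \<zero>\<^bsub>T\<^esub>"
      by (rule K_kernel[OF T_module lin_map_comp[OF h Q.coset_lin_map] bal _ that])
        (simp only: hk tens_def)
    ultimately show ?thesis
      using Q.coset_zero_iff[OF lin_map_closed[OF h]] by blast
  qed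
  have act: "(K +>\<^bsub>P\<^esub> x) \<triangleleft>\<^bsub>T\<^esub> b = K +>\<^bsub>P\<^esub> ?h x" if "x \<in> carrier P" for x
    using induced_coset[OF Q.module_quotient_axioms Q.module_quotient_axioms h HK that]
    by (simp add: tensor_def Let_def)
  show "tens m n \<triangleleft>\<^bsub>T\<^esub> b = tens m (n \<triangleleft>\<^bsub>N\<^esub> b)" if "m \<in> carrier M" "n \<in> carrier N" for m n
    unfolding tens_def act[OF pair_closed[OF that]] hk[OF that] ..
  show "lin_map F T T (\<lambda>X. X \<triangleleft>\<^bsub>T\<^esub> b)"
  proof (rule Q.lin_map_quotientI)
    show "lin_map F P T (\<lambda>x. (K +>\<^bsub>P\<^esub> x) \<triangleleft>\<^bsub>T\<^esub> b)"
      using lin_map_comp[OF h Q.coset_lin_map] act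
      by (simp add: lin_map_def Pi_iff)
  qed
qed

text \<open>The laws in X hold because each b acts by a linear map. The laws in b are equations
  between linear maps of X, so they are checked on pure tensors, where they are the module laws of
  N.\<close>

lemma tensor_right_module: "right_module F B T"
proof (intro right_module.intro right_module_axioms.intro T_module)
  note l = tensor_act_lin_map and cl = lin_map_closed[OF tensor_act_lin_map]
  note t = lin_map_add[OF tens_lin_map_right] lin_map_smult[OF tens_lin_map_right] tens_act N.act_closed
    N.act_add_right N.act_smult_right N.act_assoc
  fix X b c assume X: "X \<in> carrier T" and b: "b \<in> carrier B"
  show "X \<triangleleft>\<^bsub>T\<^esub> b \<in> carrier T"
    by (rule cl[OF b X])
  show "(X \<oplus>\<^bsub>T\<^esub> Y) \<triangleleft>\<^bsub>T\<^esub> b = X \<triangleleft>\<^bsub>T\<^esub> b \<oplus>\<^bsub>T\<^esub> Y \<triangleleft>\<^bsub>T\<^esub> b" if "Y \<in> carrier T" for Y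
    by (rule lin_map_add[OF l[OF b] X that])
  show "(c \<odot>\<^bsub>T\<^esub> X) \<triangleleft>\<^bsub>T\<^esub> b = c \<odot>\<^bsub>T\<^esub> (X \<triangleleft>\<^bsub>T\<^esub> b)" if "c \<in> carrier F"
    by (rule lin_map_smult[OF l[OF b] that X])
  show "X \<triangleleft>\<^bsub>T\<^esub> (b \<oplus>\<^bsub>B\<^esub> d) = X \<triangleleft>\<^bsub>T\<^esub> b \<oplus>\<^bsub>T\<^esub> X \<triangleleft>\<^bsub>T\<^esub> d" if d: "d \<in> carrier B" for d
    by (rule lin_map_tensor_eqI[OF T_module l[OF B.M.a_closed[OF b d]]
          lin_map_plus[OF T_module l[OF b] l[OF d]] _ X])
      (simp add: t b d)
  show "X \<triangleleft>\<^bsub>T\<^esub> (c \<odot>\<^bsub>B\<^esub> b) = c \<odot>\<^bsub>T\<^esub> (X \<triangleleft>\<^bsub>T\<^esub> b)" if c: "c \<in> carrier F"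
    by (rule lin_map_tensor_eqI[OF T_module l[OF B.smult_closed[OF c b]]
          lin_map_smult_fun[OF T_module l[OF b] c] _ X])
      (simp add: t b c)
  show "X \<triangleleft>\<^bsub>T\<^esub> (b \<otimes>\<^bsub>B\<^esub> d) = X \<triangleleft>\<^bsub>T\<^esub> b \<triangleleft>\<^bsub>T\<^esub> d" if d: "d \<in> carrier B" for d
    by (rule lin_map_tensor_eqI[OF T_module l[OF B.mult_closed[OF b d]]
          lin_map_comp[OF l[OF b] l[OF d]] _ X])
      (simp add: t b d B.mult_closed)
qed

text \<open>Unitality is inherited from N: the products n b generate N and m \<otimes> n b = (m
  \<otimes> n) b. One induction reduces X to pure tensors, a second one reduces n to
  products.\<close>

lemma tensor_unital:
  assumes "unital_right_module F B N"
  shows "unital_right_module F B T"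
proof (rule right_module.unitalI[OF tensor_right_module])
  fix X assume X: "X \<in> carrier T"
  let ?G = "generate (add_monoid T) {m \<triangleleft>\<^bsub>T\<^esub> b | m b. m \<in> carrier T \<and> b \<in> carrier B}"
  have G: "submodule ?G F T"
    by (rule right_module.act_span_submodule[OF tensor_right_module])
  show "X \<in> ?G"
  proof (rule tensor_induct[OF G _ X])
    fix m n assume m: "m \<in> carrier M" and n: "n \<in> carrier N"
    have "n \<in> {n \<in> carrier N. tens m n \<in> ?G}"
    proof (rule unital_right_module.unital_induct[OF assms
          submodule_vimage[OF N.module_axioms T_module tens_lin_map_right[OF m] G] _ n])
      fix n b assume n: "n \<in> carrier N" and b: "b \<in> carrier B"
      have "tens m n \<triangleleft>\<^bsub>T\<^esub> b \<in> ?G"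
        using tens_closed[OF m n] b by (blast intro: generate.incl)
      then show "n \<triangleleft>\<^bsub>N\<^esub> b \<in> {n \<in> carrier N. tens m n \<in> ?G}"
        using tens_act[OF b m n] N.act_closed[OF n b] by simp
    qed
    then show "tens m n \<in> ?G"
      by simp
  qed
qed

end

lemma tensor_mor:
  assumes M: "tensor_product F A B M N" and M': "tensor_product F A B M' N"
    and f: "f \<in> mod_hom F A M M'"
  shows "tensor_mor F A N M M' f \<in> mod_hom F B (tensor F A M N) (tensor F A M' N)"
    and "\<And>m n. \<lbrakk>m \<in> carrier M; n \<in> carrier N\<rbrakk> \<Longrightarrow>
      tensor_mor F A N M M' f (tensor_product.tens F A M N m n) =
      tensor_product.tens F A M' N (f m) n"
proof -
  interpret M: tensor_product F A B M N by (rule M)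
  interpret M': tensor_product F A B M' N by (rule M')
  note fl = mod_hom_lin_map[OF f]
  note fc = lin_map_closed[OF fl]
  have f_act: "f (m \<triangleleft>\<^bsub>M\<^esub> a) = f m \<triangleleft>\<^bsub>M'\<^esub> a" if "m \<in> carrier M" "a \<in> carrier A" for m a
    using f that by (simp add: mod_hom_def)
  let ?k = "\<lambda>(m, n). basis_elem F (f m, n)"
  have kc: "?k \<in> carrier M \<times> carrier N \<rightarrow> carrier M'.P"
    by (auto intro!: M'.pair_closed fc)
  let ?h = "lin_ext F M'.P ?k"
  have h: "lin_map F M.P M'.P ?h"
    by (rule lin_ext_lin_map[OF M.M.R.is_cring M'.P_module kc])
  have hk: "?h (basis_elem F (m, n)) = basis_elem F (f m, n)"
    if "m \<in> carrier M" "n \<in> carrier N" for m n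
    using lin_ext_basis[OF M.M.R.is_cring M'.P_module kc, of "(m, n)"] that by simp
  have bal: "balanced_map F A M N M'.T (\<lambda>m n. M'.tens (f m) n)"
    unfolding balanced_map_def
    by (simp add: M'.tens_lin_map_right fc f_act M'.tens_balanced
        lin_map_comp[OF fl M'.tens_lin_map_left])
  \<comment> \<open>As for the action of b: since f is A-linear, m, n \<mapsto> f(m) \<otimes> n is
    balanced, and its vanishing on the relations of M places their images among the relations of
    M'.\<close>
  have HK: "?h x \<in> M'.K" if "x \<in> M.K" for x
  proof -
    have "x \<in> carrier M.P"
      using that M.Q.submoduleE(1)[OF M.K_submodule] by blast
    moreover have "M'.K +>\<^bsub>M'.P\<^esub> ?h x = \<zero>\<^bsub>M'.T\<^esub>"
      by (rule M.K_kernel[OF M'.T_module lin_map_comp[OF h M'.Q.coset_lin_map] bal _ that])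
        (simp only: hk M'.tens_def)
    ultimately show ?thesis
      using M'.Q.coset_zero_iff[OF lin_map_closed[OF h]] by blast
  qed
  let ?g = "induced M'.P M'.K ?h"
  have g: "?g (M.K +>\<^bsub>M.P\<^esub> x) = M'.K +>\<^bsub>M'.P\<^esub> ?h x" if "x \<in> carrier M.P" for x
    by (rule induced_coset[OF M.Q.module_quotient_axioms M'.Q.module_quotient_axioms h HK that])
  have gl: "lin_map F M.T M'.T ?g"
  proof (rule M.Q.lin_map_quotientI)
    show "lin_map F M.P M'.T (\<lambda>x. ?g (M.K +>\<^bsub>M.P\<^esub> x))"
      using lin_map_comp[OF h M'.Q.coset_lin_map] g
      by (simp add: lin_map_def Pi_iff)
  qed
  have gt: "?g (M.tens m n) = M'.tens (f m) n" if "m \<in> carrier M" "n \<in> carrier N" for m n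
    unfolding M.tens_def g[OF M.pair_closed[OF that]] hk[OF that] M'.tens_def ..
  show "tensor_mor F A N M M' f \<in> mod_hom F B M.T M'.T"
  proof (rule mod_homI[OF gl])
    show "?g (x \<triangleleft>\<^bsub>M.T\<^esub> b) = ?g x \<triangleleft>\<^bsub>M'.T\<^esub> b" if x: "x \<in> carrier M.T" and b: "b \<in> carrier B" for x b
      by (rule M.lin_map_tensor_eqI[OF M'.T_module lin_map_comp[OF M.tensor_act_lin_map[OF b] gl]
            lin_map_comp[OF gl M'.tensor_act_lin_map[OF b]] _ x])
        (simp add: gt M.tens_act M'.tens_act b M.N.act_closed fc)
  qed (simp_all add: tensor_mor_def M.tensor_right_module)
  show "tensor_mor F A N M M' f (M.tens m n) = M'.tens (f m) n"
    if "m \<in> carrier M" "n \<in> carrier N" for m n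
    using that by (simp add: tensor_mor_def M.tens_closed gt)
qed

lemma tensor_is_functor:
  fixes N :: "('k, 'a, 'b, 'n) bimodule"
  assumes B: "nonunital_algebra F B" and N: "unital_right_module F B N"
    and lact_closed: "\<And>a n. \<lbrakk>a \<in> carrier A; n \<in> carrier N\<rbrakk> \<Longrightarrow> a \<triangleright>\<^bsub>N\<^esub> n \<in> carrier N"
    and lact_act: "\<And>a n b. \<lbrakk>a \<in> carrier A; n \<in> carrier N; b \<in> carrier B\<rbrakk> \<Longrightarrow>
      (a \<triangleright>\<^bsub>N\<^esub> n) \<triangleleft>\<^bsub>N\<^esub> b = a \<triangleright>\<^bsub>N\<^esub> (n \<triangleleft>\<^bsub>N\<^esub> b)"
  shows "is_functor F A B (tensor_functor F A N :: ('k, 'a, 'm, 'b, _) mod_functor)"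
proof -
  have T: "tensor_product F A B M N" if "M \<in> right_mods F A" for M :: "('k, 'a, 'm) rmodule"
    using that B N lact_closed lact_act
    by (intro tensor_product.intro tensor_product_axioms.intro)
      (auto simp: right_mods_def unital_right_module_def)
  \<comment> \<open>Morphisms out of a tensor product are determined on pure tensors, and
    extensionality turns agreement on the carrier into equality. Both functor laws are proved this
    way.\<close>
  have eqI: "h = g"
    if M: "M \<in> right_mods F A" and M': "M' \<in> right_mods F A"
      and h: "h \<in> mod_hom F B (tensor F A M N) (tensor F A M' N)"
      and g: "g \<in> mod_hom F B (tensor F A M N) (tensor F A M' N)"
      and "\<And>m n. \<lbrakk>m \<in> carrier M; n \<in> carrier N\<rbrakk> \<Longrightarrow>
        h (tensor_product.tens F A M N m n) = g (tensor_product.tens F A M N m n)"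
    for M M' :: "('k, 'a, 'm) rmodule" and h g
  proof -
    interpret M: tensor_product F A B M N by (rule T[OF M])
    interpret M': tensor_product F A B M' N by (rule T[OF M'])
    show ?thesis
      by (rule extensionalityI[OF mod_hom_extensional[OF h] mod_hom_extensional[OF g]])
        (rule M.lin_map_tensor_eqI[OF M'.T_module mod_hom_lin_map[OF h] mod_hom_lin_map[OF g] that(5)])
  qed
  have tc: "tensor_product.tens F A M N m n \<in> carrier (tensor F A M N)"
    if "M \<in> right_mods F A" "m \<in> carrier M" "n \<in> carrier N" for M :: "('k, 'a, 'm) rmodule" and m n
    using tensor_product.tens_closed[OF T[OF that(1)] that(2,3)] .
  note mor = tensor_mor[OF T T]
  note R = tensor_product.tensor_right_module[OF T]
  have RM: "right_module F A M" if "M \<in> right_mods F A" for M :: "('k, 'a, 'm) rmodule"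
    using that by (simp add: right_mods_def unital_right_module_def)
  have id: "tensor_mor F A N M M (mod_id M) = mod_id (tensor F A M N)"
    if M: "M \<in> right_mods F A" for M :: "('k, 'a, 'm) rmodule"
    by (rule eqI[OF M M mor(1)[OF M M mod_id_hom[OF RM[OF M]]] mod_id_hom[OF R[OF M]]])
      (simp add: mor(2)[OF M M mod_id_hom[OF RM[OF M]], unfolded mod_id_def] mod_id_def tc[OF M])
  have comp: "tensor_mor F A N M L (compose (carrier M) g f) =
      compose (carrier (tensor F A M N)) (tensor_mor F A N M' L g) (tensor_mor F A N M M' f)"
    if M: "M \<in> right_mods F A" and M': "M' \<in> right_mods F A" and L: "L \<in> right_mods F A"
      and f: "f \<in> mod_hom F A M M'" and g: "g \<in> mod_hom F A M' L"
    for M M' L :: "('k, 'a, 'm) rmodule" and f g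
  proof -
    note gf = mod_hom_compose[OF RM[OF M] f g]
    note c = mod_hom_compose[OF R[OF M] mor(1)[OF M M' f] mor(1)[OF M' L g]]
    show ?thesis
      by (rule eqI[OF M L mor(1)[OF M L gf] c])
        (simp add: mor(2)[OF M L gf] mor(2)[OF M M' f] mor(2)[OF M' L g] compose_eq tc[OF M]
          lin_map_closed[OF mod_hom_lin_map[OF f]])
  qed
  have U: "tensor F A M N \<in> right_mods F B" if "M \<in> right_mods F A" for M :: "('k, 'a, 'm) rmodule"
    using tensor_product.tensor_unital[OF T[OF that] N] by (simp add: right_mods_def)
  show ?thesis
    unfolding is_functor_def tensor_functor_def mod_functor.simps
    using U mor(1) id comp by blast
qed

section \<open>Leavitt path algebras\<close>

text \<open>Local units form a net indexed by the finite subsets of \<open>V\<close>, hence the eventual statement.\<close>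

definition eventually_fixed :: "'v set \<Rightarrow> ('v set \<Rightarrow> 'm \<Rightarrow> 'm) \<Rightarrow> 'm \<Rightarrow> bool" where
  "eventually_fixed V h x \<longleftrightarrow> (\<exists>W\<^sub>0. finite W\<^sub>0 \<and> W\<^sub>0 \<subseteq> V \<and>
     (\<forall>W. finite W \<longrightarrow> W\<^sub>0 \<subseteq> W \<longrightarrow> W \<subseteq> V \<longrightarrow> h W x = x))"

lemma eventually_fixedI:
  assumes "finite W\<^sub>0" "W\<^sub>0 \<subseteq> V"
    and "\<And>W. \<lbrakk>finite W; W\<^sub>0 \<subseteq> W; W \<subseteq> V\<rbrakk> \<Longrightarrow> h W x = x"
  shows "eventually_fixed V h x"
  using assms by (auto simp: eventually_fixed_def)

lemma eventually_fixed_witness: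
  assumes "eventually_fixed V h x"
  obtains W where "finite W" "W \<subseteq> V" "h W x = x"
proof -
  from assms obtain W where "finite W" "W \<subseteq> V"
    "\<forall>W'. finite W' \<longrightarrow> W \<subseteq> W' \<longrightarrow> W' \<subseteq> V \<longrightarrow> h W' x = x"
    unfolding eventually_fixed_def by (elim exE conjE)
  then show thesis
    using that[of W] by simp
qed

text \<open>The union of two thresholds serves both elements because the condition concerns all
  larger sets; one fixing set for each element would not combine. Needed for sums and, in
  \<open>counit_iso\<close>, for comparing two elements by the same unit.\<close>

lemma eventually_fixed_common:
  assumes "eventually_fixed V h x" "eventually_fixed V h' y"
  obtains W\<^sub>0 where "finite W\<^sub>0" "W\<^sub>0 \<subseteq> V"
    "\<And>W. \<lbrakk>finite W; W\<^sub>0 \<subseteq> W; W \<subseteq> V\<rbrakk> \<Longrightarrow> h W x = x"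
    "\<And>W. \<lbrakk>finite W; W\<^sub>0 \<subseteq> W; W \<subseteq> V\<rbrakk> \<Longrightarrow> h' W y = y"
proof -
  obtain W\<^sub>1 where W1: "finite W\<^sub>1" "W\<^sub>1 \<subseteq> V"
      "\<And>W. \<lbrakk>finite W; W\<^sub>1 \<subseteq> W; W \<subseteq> V\<rbrakk> \<Longrightarrow> h W x = x"
    using assms(1) unfolding eventually_fixed_def by blast
  obtain W\<^sub>2 where W2: "finite W\<^sub>2" "W\<^sub>2 \<subseteq> V"
      "\<And>W. \<lbrakk>finite W; W\<^sub>2 \<subseteq> W; W \<subseteq> V\<rbrakk> \<Longrightarrow> h' W y = y"
    using assms(2) unfolding eventually_fixed_def by blast
  show thesis
    by (rule that[of "W\<^sub>1 \<union> W\<^sub>2"]) (use W1 W2 in auto)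
qed

lemma eventually_fixed_submodule:
  assumes M: "Module.module F M" and h: "\<And>W. \<lbrakk>finite W; W \<subseteq> V\<rbrakk> \<Longrightarrow> lin_map F M M (h W)"
  shows "submodule {x \<in> carrier M. eventually_fixed V h x} F M"
proof -
  interpret M: Module.module F M by (rule M)
  show ?thesis
  proof (rule M.submodule_if_smult_add)
    show "\<zero>\<^bsub>M\<^esub> \<in> {x \<in> carrier M. eventually_fixed V h x}"
      using eventually_fixedI[of "{}" V h "\<zero>\<^bsub>M\<^esub>"] lin_map_zero[OF M M h] by simp
    show "x \<oplus>\<^bsub>M\<^esub> y \<in> {x \<in> carrier M. eventually_fixed V h x}"
      if "x \<in> {x \<in> carrier M. eventually_fixed V h x}"
        "y \<in> {x \<in> carrier M. eventually_fixed V h x}" for x y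
    proof -
      from that have xy: "x \<in> carrier M" "y \<in> carrier M"
          "eventually_fixed V h x" "eventually_fixed V h y"
        by auto
      from eventually_fixed_common[OF this(3,4)] obtain W\<^sub>0 where W0: "finite W\<^sub>0" "W\<^sub>0 \<subseteq> V"
        "\<And>W. \<lbrakk>finite W; W\<^sub>0 \<subseteq> W; W \<subseteq> V\<rbrakk> \<Longrightarrow> h W x = x"
        "\<And>W. \<lbrakk>finite W; W\<^sub>0 \<subseteq> W; W \<subseteq> V\<rbrakk> \<Longrightarrow> h W y = y"
        by blast
      have "eventually_fixed V h (x \<oplus>\<^bsub>M\<^esub> y)"
        by (rule eventually_fixedI[OF W0(1,2)]) (simp add: lin_map_add[OF h] xy W0(3,4))
      with xy show ?thesis
        by simp
    qed
    show "c \<odot>\<^bsub>M\<^esub> x \<in> {x \<in> carrier M. eventually_fixed V h x}"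
      if c: "c \<in> carrier F" and "x \<in> {x \<in> carrier M. eventually_fixed V h x}" for c x
    proof -
      from that(2) obtain W\<^sub>0 where x: "x \<in> carrier M" and W0: "finite W\<^sub>0" "W\<^sub>0 \<subseteq> V"
        "\<And>W. \<lbrakk>finite W; W\<^sub>0 \<subseteq> W; W \<subseteq> V\<rbrakk> \<Longrightarrow> h W x = x"
        unfolding eventually_fixed_def by blast
      have "eventually_fixed V h (c \<odot>\<^bsub>M\<^esub> x)"
        by (rule eventually_fixedI[OF W0(1,2)]) (simp add: lin_map_smult[OF h] c x W0(3))
      with c x show ?thesis
        by simp
    qed
  qed auto
qed

section \<open>The Leavitt path algebra: generators and relations\<close>

locale leavitt = finitely_separated_digraph \<Gamma> \<P> + F: cring F
  for F :: "('k, 'z) ring_scheme" and \<Gamma> :: "('v, 'e) pre_digraph" and \<P> :: "'e set set"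
begin

abbreviation W where "W \<equiv> lpa_free F \<Gamma>"
abbreviation I where "I \<equiv> lpa_ideal F \<Gamma> \<P>"
abbreviation L where "L \<equiv> leavitt_path_alg F \<Gamma> \<P>"
abbreviation Pa where "Pa \<equiv> path_alg F \<Gamma>"
abbreviation \<phi> where "\<phi> \<equiv> path_alg_to_lpa F \<Gamma> \<P>"

definition cls :: "('v, 'e) letter list \<Rightarrow> (('v, 'e) letter list \<Rightarrow> 'k) set" where
  "cls w = I +>\<^bsub>W\<^esub> basis_elem F w"

abbreviation "vx v \<equiv> cls [Vert v]"
abbreviation "ar e \<equiv> cls [Arr e]"
abbreviation "gh e \<equiv> cls [Ghost e]"

lemma letters_iff [simp]:
  "Vert v \<in> letters \<Gamma> \<longleftrightarrow> v \<in> verts \<Gamma>"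
  "Arr e \<in> letters \<Gamma> \<longleftrightarrow> e \<in> arcs \<Gamma>"
  "Ghost e \<in> letters \<Gamma> \<longleftrightarrow> e \<in> arcs \<Gamma>"
  by (auto simp: letters_def)

lemma part_arcs: "\<lbrakk>X \<in> \<P>; e \<in> X\<rbrakk> \<Longrightarrow> e \<in> arcs \<Gamma>"
  using partition by (auto simp: partition_on_def)

lemma rels_carrier: "rels_V F \<Gamma> \<union> rels_E F \<Gamma> \<union> rels_SCK1 F \<Gamma> \<P> \<union> rels_SCK2 F \<Gamma> \<P> \<subseteq> carrier W"
proof -
  interpret W: Module.module F W by (rule free_alg_module[OF F.is_cring])
  note b = free_alg_basis_closed[OF F.is_cring]
  note d = W.M.minus_closed
  have "rels_V F \<Gamma> \<subseteq> carrier W"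
    unfolding rels_V_def by (clarify, rule d) (simp_all add: b)
  moreover have "rels_E F \<Gamma> \<subseteq> carrier W"
    unfolding rels_E_def by (clarify, elim insertE emptyE; hypsubst; rule d; simp add: b)
  moreover have "rels_SCK1 F \<Gamma> \<P> \<subseteq> carrier W"
    unfolding rels_SCK1_def by (clarify, rule d) (simp_all add: b part_arcs)
  moreover have "rels_SCK2 F \<Gamma> \<P> \<subseteq> carrier W"
    unfolding rels_SCK2_def
    by (clarify, rule d, simp add: b part_arcs, rule W.M.finsum_closed, simp add: b part_arcs Pi_iff)
  ultimately show ?thesis
    by simp
qed

sublocale ideal: algebra_ideal F W I
  unfolding lpa_ideal_def
  by (rule ideal_gen_ideal[OF free_alg_nonunital_algebra[OF F.is_cring] rels_carrier])

lemma L_algebra: "nonunital_algebra F L"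
  unfolding leavitt_path_alg_def by (rule ideal.quotient_nonunital_algebra)

sublocale L: nonunital_algebra F L
  by (rule L_algebra)

lemmas coset_in = ideal.quotient.coset_in[folded leavitt_path_alg_def]
  and coset_ex = ideal.quotient.coset_ex[folded leavitt_path_alg_def]
  and coset_mult = ideal.coset_mult[folded leavitt_path_alg_def]
  and coset_lin_map = ideal.quotient.coset_lin_map[folded leavitt_path_alg_def]

lemma basis_closed: "\<lbrakk>w \<in> lists (letters \<Gamma>); w \<noteq> []\<rbrakk> \<Longrightarrow> basis_elem F w \<in> carrier W"
  by (rule free_alg_basis_closed[OF F.is_cring])

lemma cls_closed: "\<lbrakk>w \<in> lists (letters \<Gamma>); w \<noteq> []\<rbrakk> \<Longrightarrow> cls w \<in> carrier L"
  unfolding cls_def by (intro coset_in basis_closed)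

lemma cls_append:
  "\<lbrakk>w \<in> lists (letters \<Gamma>); w \<noteq> []; u \<in> lists (letters \<Gamma>); u \<noteq> []\<rbrakk> \<Longrightarrow>
    cls (w @ u) = cls w \<otimes>\<^bsub>L\<^esub> cls u"
  by (simp add: cls_def coset_mult[OF basis_closed basis_closed] free_alg_basis_mult[OF F.is_cring])

lemma gen_closed [simp]:
  "v \<in> verts \<Gamma> \<Longrightarrow> vx v \<in> carrier L"
  "e \<in> arcs \<Gamma> \<Longrightarrow> ar e \<in> carrier L"
  "e \<in> arcs \<Gamma> \<Longrightarrow> gh e \<in> carrier L"
  by (simp_all add: cls_closed)

text \<open>L is generated as an algebra by the letters, because the free algebra is. Both the
  existence of local units and the sliding property are proved by showing that the good elements
  form a subalgebra containing the letters.\<close>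

lemma L_induct:
  assumes H: "submodule H F L"
    and m: "\<And>x y. \<lbrakk>x \<in> H; y \<in> H\<rbrakk> \<Longrightarrow> x \<otimes>\<^bsub>L\<^esub> y \<in> H"
    and g: "\<And>l. l \<in> letters \<Gamma> \<Longrightarrow> cls [l] \<in> H" and x: "x \<in> carrier L"
  shows "x \<in> H"
proof -
  obtain y where y: "y \<in> carrier W" "x = I +>\<^bsub>W\<^esub> y"
    using coset_ex[OF x] by blast
  have "y \<in> {y \<in> carrier W. I +>\<^bsub>W\<^esub> y \<in> H}"
  proof (rule free_alg_induct[OF F.is_cring
        submodule_vimage[OF ideal.module_axioms L.module_axioms coset_lin_map H] _ _ y(1)])
    fix a b assume "a \<in> {y \<in> carrier W. I +>\<^bsub>W\<^esub> y \<in> H}" "b \<in> {y \<in> carrier W. I +>\<^bsub>W\<^esub> y \<in> H}"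
    then show "a \<otimes>\<^bsub>W\<^esub> b \<in> {y \<in> carrier W. I +>\<^bsub>W\<^esub> y \<in> H}"
      using m[of "I +>\<^bsub>W\<^esub> a" "I +>\<^bsub>W\<^esub> b"] coset_mult[of a b] ideal.mult_closed[of a b] by simp
  next
    fix l assume "l \<in> letters \<Gamma>"
    then show "basis_elem F [l] \<in> {y \<in> carrier W. I +>\<^bsub>W\<^esub> y \<in> H}"
      using g[of l] basis_closed[of "[l]"] by (simp add: cls_def)
  qed
  then show ?thesis
    using y by simp
qed

lemma rel_coset:
  assumes "x \<ominus>\<^bsub>W\<^esub> y \<in> rels_V F \<Gamma> \<union> rels_E F \<Gamma> \<union> rels_SCK1 F \<Gamma> \<P> \<union> rels_SCK2 F \<Gamma> \<P>"
    and "x \<in> carrier W" "y \<in> carrier W"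
  shows "I +>\<^bsub>W\<^esub> x = I +>\<^bsub>W\<^esub> y"
proof -
  have "x \<ominus>\<^bsub>W\<^esub> y \<in> I"
    unfolding lpa_ideal_def by (rule subsetD[OF ideal_gen_incl assms(1)])
  then show ?thesis
    using ideal.quotient.coset_eq_iff[OF assms(2,3)] by simp
qed

lemma coset_zero: "I +>\<^bsub>W\<^esub> \<zero>\<^bsub>W\<^esub> = \<zero>\<^bsub>L\<^esub>"
  by (rule lin_map_zero[OF ideal.module_axioms L.module_axioms coset_lin_map])

lemma vx_vx: "\<lbrakk>v \<in> verts \<Gamma>; w \<in> verts \<Gamma>\<rbrakk> \<Longrightarrow> vx v \<otimes>\<^bsub>L\<^esub> vx w = (if v = w then vx v else \<zero>\<^bsub>L\<^esub>)"
proof -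
  assume v: "v \<in> verts \<Gamma>" and w: "w \<in> verts \<Gamma>"
  have "cls [Vert v, Vert w] = I +>\<^bsub>W\<^esub> (if v = w then basis_elem F [Vert v] else \<zero>\<^bsub>W\<^esub>)"
    unfolding cls_def
    by (rule rel_coset) (use v w in \<open>auto simp: rels_V_def intro!: basis_closed\<close>)
  then show ?thesis
    using cls_append[of "[Vert v]" "[Vert w]"] v w
    by (cases "v = w") (simp_all add: cls_def coset_zero)
qed

lemma rel_E:
  assumes e: "e \<in> arcs \<Gamma>"
  shows "vx (tail \<Gamma> e) \<otimes>\<^bsub>L\<^esub> ar e = ar e" "ar e \<otimes>\<^bsub>L\<^esub> vx (head \<Gamma> e) = ar e"
    "vx (head \<Gamma> e) \<otimes>\<^bsub>L\<^esub> gh e = gh e" "gh e \<otimes>\<^bsub>L\<^esub> vx (tail \<Gamma> e) = gh e"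
proof -
  have "cls [Vert (tail \<Gamma> e), Arr e] = ar e" "cls [Arr e, Vert (head \<Gamma> e)] = ar e"
    "cls [Vert (head \<Gamma> e), Ghost e] = gh e" "cls [Ghost e, Vert (tail \<Gamma> e)] = gh e"
    unfolding cls_def
    by (rule rel_coset; use e in \<open>auto simp: rels_E_def intro!: basis_closed\<close>)+
  then show "vx (tail \<Gamma> e) \<otimes>\<^bsub>L\<^esub> ar e = ar e" "ar e \<otimes>\<^bsub>L\<^esub> vx (head \<Gamma> e) = ar e"
    "vx (head \<Gamma> e) \<otimes>\<^bsub>L\<^esub> gh e = gh e" "gh e \<otimes>\<^bsub>L\<^esub> vx (tail \<Gamma> e) = gh e"
    using cls_append[of "[Vert (tail \<Gamma> e)]" "[Arr e]"] cls_append[of "[Arr e]" "[Vert (head \<Gamma> e)]"]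
      cls_append[of "[Vert (head \<Gamma> e)]" "[Ghost e]"] cls_append[of "[Ghost e]" "[Vert (tail \<Gamma> e)]"] e
    by simp_all
qed

lemma gh_ar:
  assumes X: "X \<in> \<P>" and e: "e \<in> X" and f: "f \<in> X"
  shows "gh e \<otimes>\<^bsub>L\<^esub> ar f = (if e = f then vx (head \<Gamma> e) else \<zero>\<^bsub>L\<^esub>)"
proof -
  have ef: "e \<in> arcs \<Gamma>" "f \<in> arcs \<Gamma>"
    using part_arcs X e f by auto
  have "cls [Ghost e, Arr f] = I +>\<^bsub>W\<^esub> (if e = f then basis_elem F [Vert (head \<Gamma> e)] else \<zero>\<^bsub>W\<^esub>)"
    unfolding cls_def
    by (rule rel_coset) (use X e f ef in \<open>auto simp: rels_SCK1_def intro!: basis_closed\<close>)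
  then show ?thesis
    using cls_append[of "[Ghost e]" "[Arr f]"] ef
    by (cases "e = f") (simp_all add: cls_def coset_zero)
qed

text \<open>Finite separation first enters here, as SCK2 is imposed for finite parts only. The arrow
  \<open>e\<close> serves to name the source sX.\<close>

lemma sum_ar_gh:
  assumes X: "X \<in> \<P>" and e: "e \<in> X"
  shows "vx (tail \<Gamma> e) = (\<Oplus>\<^bsub>L\<^esub>f\<in>X. ar f \<otimes>\<^bsub>L\<^esub> gh f)"
proof -
  note Xa = part_arcs[OF X]
  have b: "basis_elem F [Arr f, Ghost f] \<in> carrier W" if "f \<in> X" for f
    using Xa[OF that] by (simp add: basis_closed)
  have "vx (tail \<Gamma> e) = I +>\<^bsub>W\<^esub> (\<Oplus>\<^bsub>W\<^esub>f\<in>X. basis_elem F [Arr f, Ghost f])"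
    unfolding cls_def
  proof (rule rel_coset)
    show "(\<Oplus>\<^bsub>W\<^esub>f\<in>X. basis_elem F [Arr f, Ghost f]) \<in> carrier W"
      by (rule ideal.M.finsum_closed) (use b in auto)
  qed (use X e Xa[OF e] finite_parts[OF X] in \<open>auto simp: rels_SCK2_def intro!: basis_closed\<close>)
  also have "\<dots> = (\<Oplus>\<^bsub>L\<^esub>f\<in>X. cls [Arr f, Ghost f])"
    unfolding cls_def
    by (rule lin_map_finsum[OF ideal.module_axioms L.module_axioms coset_lin_map finite_parts[OF X] b])
  also have "\<dots> = (\<Oplus>\<^bsub>L\<^esub>f\<in>X. ar f \<otimes>\<^bsub>L\<^esub> gh f)"
  proof (rule L.M.finsum_cong')
    show "cls [Arr f, Ghost f] = ar f \<otimes>\<^bsub>L\<^esub> gh f" if "f \<in> X" for f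
      using cls_append[of "[Arr f]" "[Ghost f]"] Xa[OF that] by simp
  qed (use Xa L.mult_closed in auto)
  finally show ?thesis .
qed

section \<open>The path algebra and its homomorphism to L\<close>

lemma path_target_eq: "path_target \<Gamma> u es = awlast u es"
  by (simp add: path_target_def)

lemma path_append_iff:
  "(u, es @ fs) \<in> paths \<Gamma> \<longleftrightarrow> (u, es) \<in> paths \<Gamma> \<and> (path_target \<Gamma> u es, fs) \<in> paths \<Gamma>"
proof -
  \<comment> \<open>The end of a walk is determined by its start and its arrows, so the existential
    in \<open>paths\<close> can be instantiated with \<open>awlast\<close>.\<close>
  have "awlast u es = v" if "awalk u es v" for v
    using that by simp
  then have "(\<exists>v. awalk u es v) \<longleftrightarrow> awalk u es (awlast u es)"
    by metis
  then show ?thesis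
    unfolding paths_def path_target_eq mem_Collect_eq case_prod_conv awalk_append_iff by simp
qed

lemma path_letters:
  assumes "(u, es) \<in> paths \<Gamma>"
  shows "u \<in> verts \<Gamma>" "set es \<subseteq> arcs \<Gamma>" "path_target \<Gamma> u es \<in> verts \<Gamma>"
  using assms awalk_last_in_verts
  by (auto simp: paths_def path_target_eq awalk_def)

lemma path_simple:
  "v \<in> verts \<Gamma> \<Longrightarrow> (v, []) \<in> paths \<Gamma>" "e \<in> arcs \<Gamma> \<Longrightarrow> (tail \<Gamma> e, [e]) \<in> paths \<Gamma>"
  using arc_implies_awalk by (auto simp: paths_def awalk_Nil_iff)

text \<open>The second factor of a cut begins where the first one ends, so only composable pairs
  occur as factors. A vertex has the single cut 0, which makes it idempotent.\<close>

sublocale path: factorisation F "paths \<Gamma>" "\<lambda>(u, es). length es" "\<lambda>(u, es) i. (u, take i es)"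
  "\<lambda>(u, es) i. (path_target \<Gamma> u (take i es), drop i es)"
proof
  fix i j and w v :: "'v \<times> 'e list"
  obtain u es u' es' where [simp]: "w = (u, es)" "v = (u', es')"
    by (cases w, cases v) auto
  assume "i \<le> (case w of (u, es) \<Rightarrow> length es)" "j \<le> (case v of (u, es) \<Rightarrow> length es)"
    "(case w of (u, es) \<Rightarrow> \<lambda>i. (u, take i es)) i = (case v of (u, es) \<Rightarrow> \<lambda>i. (u, take i es)) j"
    "(case w of (u, es) \<Rightarrow> \<lambda>i. (path_target \<Gamma> u (take i es), drop i es)) i =
     (case v of (u, es) \<Rightarrow> \<lambda>i. (path_target \<Gamma> u (take i es), drop i es)) j"
  then have h: "i \<le> length es" "j \<le> length es'" "u = u'" "take i es = take j es'"
    "drop i es = drop j es'"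
    by simp_all
  have "es = es'"
    using h(4,5) by (metis append_take_drop_id)
  moreover have "i = j"
    using arg_cong[OF h(4), of length] h(1,2) by simp
  ultimately show "w = v \<and> i = j"
    using h(3) by simp
next
  fix i and w :: "'v \<times> 'e list"
  obtain u es where [simp]: "w = (u, es)"
    by (cases w) auto
  assume "(case w of (u, es) \<Rightarrow> \<lambda>i. (u, take i es)) i \<in> paths \<Gamma>"
    "(case w of (u, es) \<Rightarrow> \<lambda>i. (path_target \<Gamma> u (take i es), drop i es)) i \<in> paths \<Gamma>"
  then show "w \<in> paths \<Gamma>"
    using path_append_iff[of u "take i es" "drop i es"] by simp
qed

lemma path_alg_simps:
  "carrier Pa = carrier (free_mod F (paths \<Gamma>))"
  "zero Pa = zero (free_mod F (paths \<Gamma>))"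
  "add Pa = add (free_mod F (paths \<Gamma>))"
  "smult Pa = smult (free_mod F (paths \<Gamma>))"
  by (simp_all add: path_alg_def)

lemma path_alg_mult:
  "mult Pa = convolution F (\<lambda>(u, es). length es) (\<lambda>(u, es) i. (u, take i es))
    (\<lambda>(u, es) i. (path_target \<Gamma> u (take i es), drop i es))"
  by (simp add: path_alg_def convolution_def fun_eq_iff)

lemma Pa_module: "Module.module F Pa"
  by (rule module_cong[OF free_mod_module[OF F.is_cring] path_alg_simps])

lemma path_basis_closed: "p \<in> paths \<Gamma> \<Longrightarrow> basis_elem F p \<in> carrier Pa"
  by (simp add: path_alg_simps basis_elem_closed[OF F.is_cring])

lemma path_mult_left_lin_map: "y \<in> carrier Pa \<Longrightarrow> lin_map F Pa Pa (\<lambda>x. x \<otimes>\<^bsub>Pa\<^esub> y)"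
  unfolding path_alg_mult
  using path.convolution_left_lin_map[of y] by (simp add: lin_map_def path_alg_simps)

lemma path_mult_right_lin_map: "x \<in> carrier Pa \<Longrightarrow> lin_map F Pa Pa (\<lambda>y. x \<otimes>\<^bsub>Pa\<^esub> y)"
  unfolding path_alg_mult
  using path.convolution_right_lin_map[of x] by (simp add: lin_map_def path_alg_simps)

lemma path_basis_mult:
  "basis_elem F (u, es) \<otimes>\<^bsub>Pa\<^esub> basis_elem F (v, fs) =
    (if path_target \<Gamma> u es = v then basis_elem F (u, es @ fs) else \<zero>\<^bsub>Pa\<^esub>)"
proof (cases "path_target \<Gamma> u es = v")
  case True
  then show ?thesis
    using path.convolution_basis[of "length es" "(u, es @ fs)"] by (simp add: path_alg_mult)
next
  case False
  have "convolution F (\<lambda>(u, es). length es) (\<lambda>(u, es) i. (u, take i es))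
    (\<lambda>(u, es) i. (path_target \<Gamma> u (take i es), drop i es))
    (basis_elem F (u, es)) (basis_elem F (v, fs)) = (\<lambda>_. \<zero>\<^bsub>F\<^esub>)"
    by (rule path.convolution_basis_zero) (use False in auto)
  then show ?thesis
    using False by (simp add: path_alg_mult path_alg_simps(2) free_mod_simps[OF F.is_cring])
qed

lemma lin_map_path_eqI:
  assumes N: "Module.module F N" and h: "lin_map F Pa N h" and g: "lin_map F Pa N g"
    and "\<And>u es. (u, es) \<in> paths \<Gamma> \<Longrightarrow> h (basis_elem F (u, es)) = g (basis_elem F (u, es))"
    and f: "f \<in> carrier Pa"
  shows "h f = g f"
proof -
  have "lin_map F (free_mod F (paths \<Gamma>)) N h" "lin_map F (free_mod F (paths \<Gamma>)) N g"
    using h g by (simp_all add: lin_map_def path_alg_simps)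
  from lin_map_free_eqI[OF F.is_cring N this, of f] assms(4) f show ?thesis
    by (simp add: path_alg_simps split_paired_all)
qed

text \<open>The leading vertex keeps the word of a path of length 0 nonempty, as the free non-unital
  algebra requires.\<close>

abbreviation path_word :: "'v \<Rightarrow> 'e list \<Rightarrow> ('v, 'e) letter list" where
  "path_word u es \<equiv> Vert u # map Arr es"

lemma path_word_letters:
  assumes "(u, es) \<in> paths \<Gamma>"
  shows "path_word u es \<in> lists (letters \<Gamma>)"
  using path_letters(1,2)[OF assms] by (auto simp: subset_iff)

lemma phi_lin_map: "lin_map F Pa L \<phi>"
  and phi_basis: "(u, es) \<in> paths \<Gamma> \<Longrightarrow> \<phi> (basis_elem F (u, es)) = cls (path_word u es)"
proof -
  let ?k = "\<lambda>(u, es). basis_elem F (path_word u es)"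
  have k: "?k \<in> paths \<Gamma> \<rightarrow> carrier W"
    using path_word_letters basis_closed by auto
  have "lin_map F (free_mod F (paths \<Gamma>)) L \<phi>"
    unfolding path_alg_to_lpa_def
    by (rule lin_map_comp[OF lin_ext_lin_map[OF F.is_cring ideal.module_axioms k] coset_lin_map])
  then show "lin_map F Pa L \<phi>"
    by (simp add: lin_map_def path_alg_simps)
  show "\<phi> (basis_elem F (u, es)) = cls (path_word u es)" if "(u, es) \<in> paths \<Gamma>"
    using lin_ext_basis[OF F.is_cring ideal.module_axioms k that]
    by (simp add: path_alg_to_lpa_def cls_def)
qed

lemmas phi_closed = lin_map_closed[OF phi_lin_map]

lemma phi_simple:
  "v \<in> verts \<Gamma> \<Longrightarrow> \<phi> (basis_elem F (v, [])) = vx v"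
  "e \<in> arcs \<Gamma> \<Longrightarrow> \<phi> (basis_elem F (tail \<Gamma> e, [e])) = ar e"
  using phi_basis[OF path_simple(1)] phi_basis[OF path_simple(2)]
    cls_append[of "[Vert (tail \<Gamma> e)]" "[Arr e]"] rel_E(1) by simp_all

definition letter_target :: "('v, 'e) letter \<Rightarrow> 'v" where
  "letter_target l = (case l of Vert v \<Rightarrow> v | Arr e \<Rightarrow> head \<Gamma> e | Ghost e \<Rightarrow> tail \<Gamma> e)"

lemma letter_target_verts: "l \<in> letters \<Gamma> \<Longrightarrow> letter_target l \<in> verts \<Gamma>"
  by (cases l) (simp_all add: letter_target_def)

text \<open>Relation (E) covers only the vertex that is the target of the letter. For the other
  vertices the target is inserted between the letter and v, and (V) annihilates the product of the
  two vertices.\<close>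

lemma letter_vx:
  assumes l: "l \<in> letters \<Gamma>" and v: "v \<in> verts \<Gamma>"
  shows "cls [l] \<otimes>\<^bsub>L\<^esub> vx v = (if letter_target l = v then cls [l] else \<zero>\<^bsub>L\<^esub>)"
proof -
  have t: "vx (letter_target l) \<in> carrier L" and lc: "cls [l] \<in> carrier L"
    using letter_target_verts[OF l] l by (simp_all add: cls_closed)
  have unit: "cls [l] \<otimes>\<^bsub>L\<^esub> vx (letter_target l) = cls [l]"
    using l by (cases l) (simp_all add: letter_target_def vx_vx rel_E(2,4))
  have zero: "cls [l] \<otimes>\<^bsub>L\<^esub> \<zero>\<^bsub>L\<^esub> = \<zero>\<^bsub>L\<^esub>"
    by (rule lin_map_zero[OF L.module_axioms L.module_axioms L.mult_right_lin_map[OF lc]])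
  have "cls [l] \<otimes>\<^bsub>L\<^esub> vx v = (cls [l] \<otimes>\<^bsub>L\<^esub> vx (letter_target l)) \<otimes>\<^bsub>L\<^esub> vx v"
    by (simp only: unit)
  also have "\<dots> = cls [l] \<otimes>\<^bsub>L\<^esub> (vx (letter_target l) \<otimes>\<^bsub>L\<^esub> vx v)"
    by (rule L.mult_assoc[OF lc t gen_closed(1)[OF v]])
  also have "\<dots> = (if letter_target l = v then cls [l] else \<zero>\<^bsub>L\<^esub>)"
    by (simp only: vx_vx[OF letter_target_verts[OF l] v] unit zero if_distrib[of "\<lambda>x. cls [l] \<otimes>\<^bsub>L\<^esub> x"])
  finally show ?thesis .
qed

text \<open>Right multiplication by a vertex concerns only the last letter, hence the path is split
  at its end; a path of length 0 is itself a vertex and falls under (V).\<close>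

lemma path_vx:
  assumes p: "(u, es) \<in> paths \<Gamma>" and v: "v \<in> verts \<Gamma>"
  shows "cls (path_word u es) \<otimes>\<^bsub>L\<^esub> vx v =
    (if path_target \<Gamma> u es = v then cls (path_word u es) else \<zero>\<^bsub>L\<^esub>)"
proof (cases es rule: rev_cases)
  case Nil
  then show ?thesis
    using vx_vx[OF path_letters(1)[OF p] v] by (simp add: path_target_eq)
next
  case (snoc fs e)
  have pw: "path_word u fs \<in> lists (letters \<Gamma>)" and e: "e \<in> arcs \<Gamma>"
    using path_word_letters[OF p] path_letters(2)[OF p] snoc by auto
  have t: "path_target \<Gamma> u es = head \<Gamma> e"
    using snoc by (simp add: path_target_eq awalk_verts_conv)
  have split: "cls (path_word u es) = cls (path_word u fs) \<otimes>\<^bsub>L\<^esub> ar e"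
    using cls_append[OF pw, of "[Arr e]"] e snoc by simp
  have fc: "cls (path_word u fs) \<in> carrier L"
    by (rule cls_closed[OF pw]) simp
  show ?thesis
    unfolding split t
      L.mult_assoc[OF fc gen_closed(2)[OF e] gen_closed(1)[OF v]]
      letter_vx[of "Arr e", OF _ v, simplified, OF e]
    using lin_map_zero[OF L.module_axioms L.module_axioms L.mult_right_lin_map[OF fc]]
    by (simp add: letter_target_def)
qed

text \<open>The vertex at the head of the second word is absorbed or annihilated by the first path,
  by \<open>path_vx\<close>. If the second path is a vertex, nothing remains behind that vertex and
  there is no word to append, hence the case distinction.\<close>

lemma path_mult:
  assumes p: "(u, es) \<in> paths \<Gamma>" and q: "(v, fs) \<in> paths \<Gamma>"
  shows "cls (path_word u es) \<otimes>\<^bsub>L\<^esub> cls (path_word v fs) =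
    (if path_target \<Gamma> u es = v then cls (path_word u (es @ fs)) else \<zero>\<^bsub>L\<^esub>)"
proof (cases "fs = []")
  case True
  then show ?thesis
    using path_vx[OF p path_letters(1)[OF q]] by simp
next
  case False
  note v = path_letters(1)[OF q]
  have fl: "map Arr fs \<in> lists (letters \<Gamma>)"
    using path_word_letters[OF q] by simp
  have fc: "cls (map Arr fs) \<in> carrier L"
    using cls_closed[OF fl] False by simp
  have pc: "cls (path_word u es) \<in> carrier L"
    by (rule cls_closed[OF path_word_letters[OF p]]) simp
  have "cls (path_word v fs) = vx v \<otimes>\<^bsub>L\<^esub> cls (map Arr fs)"
    using cls_append[of "[Vert v]" "map Arr fs"] fl v False by simp
  then have "cls (path_word u es) \<otimes>\<^bsub>L\<^esub> cls (path_word v fs) =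
      (cls (path_word u es) \<otimes>\<^bsub>L\<^esub> vx v) \<otimes>\<^bsub>L\<^esub> cls (map Arr fs)"
    using L.mult_assoc[OF pc gen_closed(1)[OF v] fc] by simp
  also have "\<dots> = (if path_target \<Gamma> u es = v then cls (path_word u (es @ fs)) else \<zero>\<^bsub>L\<^esub>)"
    unfolding path_vx[OF p v]
    using cls_append[OF path_word_letters[OF p] _ fl] False
      lin_map_zero[OF L.module_axioms L.module_axioms L.mult_left_lin_map[OF fc]]
    by simp
  finally show ?thesis .
qed

text \<open>Linearity in x and then in y reduces this to basis paths, where both sides concatenate
  or vanish under the same condition.\<close>

lemma phi_mult:
  assumes x: "x \<in> carrier Pa" and y: "y \<in> carrier Pa"
  shows "\<phi> (x \<otimes>\<^bsub>Pa\<^esub> y) = \<phi> x \<otimes>\<^bsub>L\<^esub> \<phi> y"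
proof (rule lin_map_path_eqI[OF L.module_axioms
      lin_map_comp[OF path_mult_left_lin_map[OF y] phi_lin_map]
      lin_map_comp[OF phi_lin_map L.mult_left_lin_map[OF phi_closed[OF y]]] _ x])
  fix u es assume p: "(u, es) \<in> paths \<Gamma>"
  note pc = path_basis_closed[OF p]
  show "\<phi> (basis_elem F (u, es) \<otimes>\<^bsub>Pa\<^esub> y) = \<phi> (basis_elem F (u, es)) \<otimes>\<^bsub>L\<^esub> \<phi> y"
  proof (rule lin_map_path_eqI[OF L.module_axioms
        lin_map_comp[OF path_mult_right_lin_map[OF pc] phi_lin_map]
        lin_map_comp[OF phi_lin_map L.mult_right_lin_map[OF phi_closed[OF pc]]] _ y])
    fix v fs assume q: "(v, fs) \<in> paths \<Gamma>"
    have "(u, es @ fs) \<in> paths \<Gamma>" if "path_target \<Gamma> u es = v"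
      using path_append_iff[of u es fs] p q that by simp
    then show "\<phi> (basis_elem F (u, es) \<otimes>\<^bsub>Pa\<^esub> basis_elem F (v, fs)) =
        \<phi> (basis_elem F (u, es)) \<otimes>\<^bsub>L\<^esub> \<phi> (basis_elem F (v, fs))"
      unfolding path_basis_mult phi_basis[OF p] phi_basis[OF q] path_mult[OF p q]
      using lin_map_zero[OF Pa_module L.module_axioms phi_lin_map] phi_basis
      by simp
  qed
qed

section \<open>Local units\<close>

definition unit_sum :: "'v set \<Rightarrow> 'v \<times> 'e list \<Rightarrow> 'k" where
  "unit_sum V = (\<Oplus>\<^bsub>Pa\<^esub>v\<in>V. basis_elem F (v, []))"

abbreviation "lu V \<equiv> \<phi> (unit_sum V)"

lemma unit_sum_closed: "V \<subseteq> verts \<Gamma> \<Longrightarrow> unit_sum V \<in> carrier Pa"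
proof -
  assume V: "V \<subseteq> verts \<Gamma>"
  interpret Pa: Module.module F Pa by (rule Pa_module)
  show ?thesis
    unfolding unit_sum_def
    by (rule Pa.M.finsum_closed) (use V path_basis_closed[OF path_simple(1)] in auto)
qed

lemma lu_eq: "\<lbrakk>finite V; V \<subseteq> verts \<Gamma>\<rbrakk> \<Longrightarrow> lu V = (\<Oplus>\<^bsub>L\<^esub>v\<in>V. vx v)"
proof -
  assume f: "finite V" and V: "V \<subseteq> verts \<Gamma>"
  have "lu V = (\<Oplus>\<^bsub>L\<^esub>v\<in>V. \<phi> (basis_elem F (v, [])))"
    unfolding unit_sum_def
    by (rule lin_map_finsum[OF Pa_module L.module_axioms phi_lin_map f])
      (use V path_basis_closed[OF path_simple(1)] in auto)
  also have "\<dots> = (\<Oplus>\<^bsub>L\<^esub>v\<in>V. vx v)"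
    by (rule L.M.finsum_cong') (use V phi_simple(1) in auto)
  finally show ?thesis .
qed

lemma lu_closed: "V \<subseteq> verts \<Gamma> \<Longrightarrow> lu V \<in> carrier L"
  by (rule phi_closed[OF unit_sum_closed])

text \<open>In the sum over V only the target of the letter survives. Hence every finite V
  containing that vertex works, as \<open>eventually_fixed\<close> demands.\<close>

lemma letter_lu:
  assumes l: "l \<in> letters \<Gamma>" and V: "finite V" "V \<subseteq> verts \<Gamma>" "letter_target l \<in> V"
  shows "cls [l] \<otimes>\<^bsub>L\<^esub> lu V = cls [l]"
proof -
  have lc: "cls [l] \<in> carrier L"
    using l by (simp add: cls_closed)
  have "cls [l] \<otimes>\<^bsub>L\<^esub> lu V = (\<Oplus>\<^bsub>L\<^esub>v\<in>V. cls [l] \<otimes>\<^bsub>L\<^esub> vx v)"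
    unfolding lu_eq[OF V(1,2)]
    by (rule lin_map_finsum[OF L.module_axioms L.module_axioms L.mult_right_lin_map[OF lc] V(1)])
      (use V(2) gen_closed(1) in auto)
  also have "\<dots> = (\<Oplus>\<^bsub>L\<^esub>v\<in>V. if letter_target l = v then cls [l] else \<zero>\<^bsub>L\<^esub>)"
    by (rule L.M.finsum_cong') (use V(2) letter_vx[OF l] lc in auto)
  also have "\<dots> = cls [l]"
    by (rule L.M.add.finprod_singleton[OF V(3,1)]) (use lc in simp)
  finally show ?thesis .
qed

text \<open>In x y the unit meets only y, so a threshold for y is one for x y. Sums are handled by
  merging thresholds, and a letter has its target as threshold.\<close>

lemma mult_lu_eventually:
  assumes x: "x \<in> carrier L"
  shows "eventually_fixed (verts \<Gamma>) (\<lambda>V x. x \<otimes>\<^bsub>L\<^esub> lu V) x"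
proof -
  let ?H = "{x \<in> carrier L. eventually_fixed (verts \<Gamma>) (\<lambda>V x. x \<otimes>\<^bsub>L\<^esub> lu V) x}"
  have "x \<in> ?H"
  proof (rule L_induct[OF _ _ _ x])
    show "submodule ?H F L"
      by (rule eventually_fixed_submodule[OF L.module_axioms L.mult_left_lin_map[OF lu_closed]])
    fix x y assume "x \<in> ?H" "y \<in> ?H"
    then have xy: "x \<in> carrier L" "y \<in> carrier L"
      and ev: "eventually_fixed (verts \<Gamma>) (\<lambda>V x. x \<otimes>\<^bsub>L\<^esub> lu V) y"
      by simp_all
    from ev obtain V\<^sub>0 where V0: "finite V\<^sub>0" "V\<^sub>0 \<subseteq> verts \<Gamma>"
        "\<And>V. \<lbrakk>finite V; V\<^sub>0 \<subseteq> V; V \<subseteq> verts \<Gamma>\<rbrakk> \<Longrightarrow> y \<otimes>\<^bsub>L\<^esub> lu V = y"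
      unfolding eventually_fixed_def by blast
    have "eventually_fixed (verts \<Gamma>) (\<lambda>V x. x \<otimes>\<^bsub>L\<^esub> lu V) (x \<otimes>\<^bsub>L\<^esub> y)"
      by (rule eventually_fixedI[OF V0(1,2)]) (simp add: L.mult_assoc[OF xy lu_closed] V0(3))
    then show "x \<otimes>\<^bsub>L\<^esub> y \<in> ?H"
      using L.mult_closed[OF xy] by simp
  next
    fix l assume l: "l \<in> letters \<Gamma>"
    have "eventually_fixed (verts \<Gamma>) (\<lambda>V x. x \<otimes>\<^bsub>L\<^esub> lu V) (cls [l])"
      by (rule eventually_fixedI[of "{letter_target l}"])
        (simp_all add: letter_target_verts[OF l] letter_lu[OF l])
    then show "cls [l] \<in> ?H"
      using l by (simp add: cls_closed)
  qed
  then show ?thesis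
    by simp
qed

text \<open>Since M = M L, it is enough to treat products m x, and these inherit a threshold from
  x.\<close>

lemma act_lu_eventually:
  assumes M: "unital_right_module F L M" and m: "m \<in> carrier M"
  shows "eventually_fixed (verts \<Gamma>) (\<lambda>V m. m \<triangleleft>\<^bsub>M\<^esub> lu V) m"
proof -
  interpret M: unital_right_module F L M by (rule M)
  let ?H = "{m \<in> carrier M. eventually_fixed (verts \<Gamma>) (\<lambda>V m. m \<triangleleft>\<^bsub>M\<^esub> lu V) m}"
  have "m \<in> ?H"
  proof (rule M.unital_induct[OF _ _ m])
    show "submodule ?H F M"
      by (rule eventually_fixed_submodule[OF M.module_axioms M.act_left_lin_map[OF lu_closed]])
    fix m x assume mx: "m \<in> carrier M" "x \<in> carrier L"
    from mult_lu_eventually[OF mx(2)] obtain V\<^sub>0 where V0: "finite V\<^sub>0" "V\<^sub>0 \<subseteq> verts \<Gamma>"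
        "\<And>V. \<lbrakk>finite V; V\<^sub>0 \<subseteq> V; V \<subseteq> verts \<Gamma>\<rbrakk> \<Longrightarrow> x \<otimes>\<^bsub>L\<^esub> lu V = x"
      unfolding eventually_fixed_def by blast
    have "eventually_fixed (verts \<Gamma>) (\<lambda>V m. m \<triangleleft>\<^bsub>M\<^esub> lu V) (m \<triangleleft>\<^bsub>M\<^esub> x)"
      by (rule eventually_fixedI[OF V0(1,2)]) (simp add: M.act_assoc[OF mx lu_closed, symmetric] V0(3))
    then show "m \<triangleleft>\<^bsub>M\<^esub> x \<in> ?H"
      using M.act_closed[OF mx] by simp
  qed
  then show ?thesis
    by simp
qed

section \<open>The counit\<close>

abbreviation "BL \<equiv> algebra_bimodule \<phi> L"
abbreviation "res M \<equiv> fobj (restriction_functor \<phi>) M"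

lemma algebra_bimodule_simps:
  "carrier BL = carrier L" "zero BL = zero L" "add BL = add L" "smult BL = smult L"
  "ract BL = mult L" "lact BL = (\<lambda>a x. \<phi> a \<otimes>\<^bsub>L\<^esub> x)"
  by (simp_all add: algebra_bimodule_def fun_eq_iff)

lemma BL_right_module: "right_module F L BL"
  by (intro right_module.intro right_module_axioms.intro
      module_cong[OF L.module_axioms algebra_bimodule_simps(1-4)])
    (simp_all add: algebra_bimodule_simps L.mult_closed L.mult_add_left L.mult_add_right
      L.mult_smult_left L.mult_smult_right L.mult_assoc)

lemma BL_unital: "unital_right_module F L BL"
proof (rule right_module.unitalI[OF BL_right_module])
  fix x assume "x \<in> carrier BL"
  then have x: "x \<in> carrier L"
    by (simp add: algebra_bimodule_simps)
  from mult_lu_eventually[OF x] obtain V where V: "V \<subseteq> verts \<Gamma>" "x \<otimes>\<^bsub>L\<^esub> lu V = x"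
    by (rule eventually_fixed_witness)
  have "x \<triangleleft>\<^bsub>BL\<^esub> lu V = x"
    using V(2) by (simp add: algebra_bimodule_simps)
  then have "x = x \<triangleleft>\<^bsub>BL\<^esub> lu V \<and> x \<in> carrier BL \<and> lu V \<in> carrier L"
    using \<open>x \<in> carrier BL\<close> lu_closed[OF V(1)] by simp
  then show "x \<in> generate (add_monoid BL) {m \<triangleleft>\<^bsub>BL\<^esub> a | m a. m \<in> carrier BL \<and> a \<in> carrier L}"
    by (intro generate.incl CollectI) (rule exI)+
qed

text \<open>This is why \<open>unit_sum\<close> lives in the path algebra: a local unit of L that
  fixes m is the image of a path algebra element, so m is itself a product with such an image and
  the restricted module stays unital.\<close>

lemma restriction_unit:
  assumes M: "unital_right_module F L M" and m: "m \<in> carrier M"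
  shows "m \<in> generate (add_monoid (res M)) {m \<triangleleft>\<^bsub>M\<^esub> \<phi> a | m a. m \<in> carrier M \<and> a \<in> carrier Pa}"
proof -
  from act_lu_eventually[OF M m] obtain V where V: "V \<subseteq> verts \<Gamma>" "m \<triangleleft>\<^bsub>M\<^esub> lu V = m"
    by (rule eventually_fixed_witness)
  have "m = m \<triangleleft>\<^bsub>M\<^esub> lu V \<and> m \<in> carrier M \<and> unit_sum V \<in> carrier Pa"
    using V m unit_sum_closed[OF V(1)] by simp
  then show ?thesis
    by (intro generate.incl CollectI) (rule exI)+
qed

lemma forgetful_is_functor:
  "is_functor F L Pa (forgetful_functor F \<Gamma> \<P> :: (_, _, 'm, _, 'm) mod_functor)"
  unfolding forgetful_functor_def
  by (rule restriction_is_functor[OF phi_lin_map phi_mult restriction_unit])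

lemma lpa_tensor_is_functor:
  "is_functor F Pa L (lpa_tensor_functor F \<Gamma> \<P> :: (_, _, 'm, _, _) mod_functor)"
  unfolding lpa_tensor_functor_def
  by (rule tensor_is_functor[OF L_algebra BL_unital])
    (simp_all add: algebra_bimodule_simps L.mult_closed phi_closed L.mult_assoc)

end

section \<open>Sliding elements of L through the tensor product\<close>

locale leavitt_module = leavitt F \<Gamma> \<P> + U: unital_right_module F "leavitt_path_alg F \<Gamma> \<P>" M
  for F :: "('k, 'z) ring_scheme" and \<Gamma> :: "('v, 'e) pre_digraph" and \<P> :: "'e set set"
    and M :: "('k, (('v, 'e) letter list \<Rightarrow> 'k) set, 'm) rmodule"
begin

lemma res_right_module: "right_module F Pa (res M)"
proof -
  have "res M \<in> right_mods F Pa"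
    using forgetful_is_functor U.unital_right_module_axioms
    unfolding is_functor_def forgetful_functor_def right_mods_def by blast
  then show ?thesis
    by (simp add: right_mods_def unital_right_module_def)
qed

sublocale tp: tensor_product F Pa L "res M" BL
  by (intro tensor_product.intro tensor_product_axioms.intro res_right_module BL_right_module L_algebra)
    (simp_all add: algebra_bimodule_simps L.mult_closed phi_closed L.mult_assoc)

lemma tens_closed: "\<lbrakk>m \<in> carrier M; x \<in> carrier L\<rbrakk> \<Longrightarrow> tp.tens m x \<in> carrier tp.T"
  using tp.tens_closed by (simp add: algebra_bimodule_simps restriction_functor_simps)

lemma tens_left: "x \<in> carrier L \<Longrightarrow> lin_map F M tp.T (\<lambda>m. tp.tens m x)"
  using tp.tens_lin_map_left[of x]
  by (simp add: algebra_bimodule_simps restriction_functor_simps lin_map_def)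

lemma tens_right: "m \<in> carrier M \<Longrightarrow> lin_map F L tp.T (\<lambda>x. tp.tens m x)"
  using tp.tens_lin_map_right[of m]
  by (simp add: algebra_bimodule_simps restriction_functor_simps lin_map_def)

lemma tens_slide_path:
  "\<lbrakk>m \<in> carrier M; a \<in> carrier Pa; x \<in> carrier L\<rbrakk> \<Longrightarrow>
    tp.tens (m \<triangleleft>\<^bsub>M\<^esub> \<phi> a) x = tp.tens m (\<phi> a \<otimes>\<^bsub>L\<^esub> x)"
  using tp.tens_balanced[of m a x] by (simp add: algebra_bimodule_simps restriction_functor_simps)

lemma tens_slide_vx:
  assumes "m \<in> carrier M" "v \<in> verts \<Gamma>" "x \<in> carrier L"
  shows "tp.tens (m \<triangleleft>\<^bsub>M\<^esub> vx v) x = tp.tens m (vx v \<otimes>\<^bsub>L\<^esub> x)"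
  using tens_slide_path[OF assms(1) path_basis_closed[OF path_simple(1)[OF assms(2)]] assms(3)]
  by (simp only: phi_simple(1)[OF assms(2)])

lemma tens_slide_ar:
  assumes "m \<in> carrier M" "e \<in> arcs \<Gamma>" "x \<in> carrier L"
  shows "tp.tens (m \<triangleleft>\<^bsub>M\<^esub> ar e) x = tp.tens m (ar e \<otimes>\<^bsub>L\<^esub> x)"
  using tens_slide_path[OF assms(1) path_basis_closed[OF path_simple(2)[OF assms(2)]] assms(3)]
  by (simp only: phi_simple(2)[OF assms(2)])

text \<open>
  Inserting \<open>\<Sum>\<^sub>f f f\<^sup>*\<close> between \<open>m e\<^sup>*\<close> and \<open>x\<close>, every \<open>f\<close> may move to the left, where SCK1
  kills all summands except \<open>f = e\<close>. Finiteness of the part of \<open>e\<close> is needed for SCK2.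
\<close>

lemma tens_slide_gh:
  assumes m: "m \<in> carrier M" and e: "e \<in> arcs \<Gamma>" and x: "x \<in> carrier L"
  shows "tp.tens (m \<triangleleft>\<^bsub>M\<^esub> gh e) x = tp.tens m (gh e \<otimes>\<^bsub>L\<^esub> x)"
proof -
  obtain X where X: "X \<in> \<P>" "e \<in> X"
    using e partition by (auto simp: partition_on_def)
  note Xa = part_arcs[OF X(1)]
  let ?s = "tail \<Gamma> e" and ?t = "head \<Gamma> e" and ?n = "m \<triangleleft>\<^bsub>M\<^esub> gh e"
  have st: "?s \<in> verts \<Gamma>" "?t \<in> verts \<Gamma>"
    using e by simp_all
  have n: "?n \<in> carrier M"
    by (rule U.act_closed[OF m gen_closed(3)[OF e]])
  have c: "gh f \<otimes>\<^bsub>L\<^esub> x \<in> carrier L" "ar f \<otimes>\<^bsub>L\<^esub> gh f \<in> carrier L"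
    "ar f \<otimes>\<^bsub>L\<^esub> (gh f \<otimes>\<^bsub>L\<^esub> x) \<in> carrier L" if "f \<in> X" for f
    using Xa[OF that] x by (simp_all add: L.mult_closed)
  \<comment> \<open>A ghost ends at the source of its arrow. This vertex sX is what SCK2 expands,
    and being a path it may first cross the tensor sign.\<close>
  have "?n = ?n \<triangleleft>\<^bsub>M\<^esub> vx ?s"
    using U.act_assoc[OF m gen_closed(3)[OF e] gen_closed(1)[OF st(1)]] rel_E(4)[OF e] by simp
  then have "tp.tens ?n x = tp.tens ?n (vx ?s \<otimes>\<^bsub>L\<^esub> x)"
    using tens_slide_vx[OF n st(1) x] by simp
  also have "vx ?s \<otimes>\<^bsub>L\<^esub> x = (\<Oplus>\<^bsub>L\<^esub>f\<in>X. ar f \<otimes>\<^bsub>L\<^esub> gh f) \<otimes>\<^bsub>L\<^esub> x"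
    by (simp only: sum_ar_gh[OF X])
  also have "\<dots> = (\<Oplus>\<^bsub>L\<^esub>f\<in>X. ar f \<otimes>\<^bsub>L\<^esub> gh f \<otimes>\<^bsub>L\<^esub> x)"
    by (rule lin_map_finsum[OF L.module_axioms L.module_axioms L.mult_left_lin_map[OF x]
          finite_parts[OF X(1)] c(2)])
  also have "\<dots> = (\<Oplus>\<^bsub>L\<^esub>f\<in>X. ar f \<otimes>\<^bsub>L\<^esub> (gh f \<otimes>\<^bsub>L\<^esub> x))"
  proof (rule L.M.finsum_cong'[OF refl])
    show "ar f \<otimes>\<^bsub>L\<^esub> gh f \<otimes>\<^bsub>L\<^esub> x = ar f \<otimes>\<^bsub>L\<^esub> (gh f \<otimes>\<^bsub>L\<^esub> x)" if "f \<in> X" for f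
      using Xa[OF that] x by (simp add: L.mult_assoc)
  qed (use c(3) in simp)
  also have "tp.tens ?n \<dots> = (\<Oplus>\<^bsub>tp.T\<^esub>f\<in>X. tp.tens ?n (ar f \<otimes>\<^bsub>L\<^esub> (gh f \<otimes>\<^bsub>L\<^esub> x)))"
    by (rule lin_map_finsum[OF L.module_axioms tp.T_module tens_right[OF n] finite_parts[OF X(1)] c(3)])
  also have "\<dots> = (\<Oplus>\<^bsub>tp.T\<^esub>f\<in>X. if e = f then tp.tens m (gh f \<otimes>\<^bsub>L\<^esub> x) else \<zero>\<^bsub>tp.T\<^esub>)"
  proof (rule tp.Q.quotient_module[THEN Module.module.axioms(2), THEN abelian_group.axioms(1),
        THEN abelian_monoid.finsum_cong', OF refl])
    fix f assume f: "f \<in> X"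
    have "tp.tens ?n (ar f \<otimes>\<^bsub>L\<^esub> (gh f \<otimes>\<^bsub>L\<^esub> x)) = tp.tens (?n \<triangleleft>\<^bsub>M\<^esub> ar f) (gh f \<otimes>\<^bsub>L\<^esub> x)"
      by (rule tens_slide_ar[OF n Xa[OF f] c(1)[OF f], symmetric])
    also have "?n \<triangleleft>\<^bsub>M\<^esub> ar f = m \<triangleleft>\<^bsub>M\<^esub> (gh e \<otimes>\<^bsub>L\<^esub> ar f)"
      by (rule U.act_assoc[OF m gen_closed(3)[OF e] gen_closed(2)[OF Xa[OF f]], symmetric])
    also have "\<dots> = (if e = f then m \<triangleleft>\<^bsub>M\<^esub> vx ?t else \<zero>\<^bsub>M\<^esub>)"
      using lin_map_zero[OF L.module_axioms U.module_axioms U.act_right_lin_map[OF m]]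
      by (simp add: gh_ar[OF X f])
    also have "tp.tens \<dots> (gh f \<otimes>\<^bsub>L\<^esub> x) =
        (if e = f then tp.tens m (gh f \<otimes>\<^bsub>L\<^esub> x) else \<zero>\<^bsub>tp.T\<^esub>)"
    proof (cases "e = f")
      case True
      \<comment> \<open>The surviving summand leaves the vertex te from SCK1 acting on m; it crosses
        the tensor sign and is absorbed by the ghost of e, which starts at te.\<close>
      have "vx ?t \<otimes>\<^bsub>L\<^esub> (gh e \<otimes>\<^bsub>L\<^esub> x) = gh e \<otimes>\<^bsub>L\<^esub> x"
        using L.mult_assoc[OF gen_closed(1)[OF st(2)] gen_closed(3)[OF e] x] rel_E(3)[OF e] by simp
      then show ?thesis
        using tens_slide_vx[OF m st(2) c(1)[OF X(2)]] True by simp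
    next
      case False
      then show ?thesis
        using lin_map_zero[OF U.module_axioms tp.T_module tens_left[OF c(1)[OF f]]] by simp
    qed
    finally show "tp.tens ?n (ar f \<otimes>\<^bsub>L\<^esub> (gh f \<otimes>\<^bsub>L\<^esub> x)) =
      (if e = f then tp.tens m (gh f \<otimes>\<^bsub>L\<^esub> x) else \<zero>\<^bsub>tp.T\<^esub>)" .
  next
    interpret T: Module.module F tp.T by (rule tp.T_module)
    show "(\<lambda>f. if e = f then tp.tens m (gh f \<otimes>\<^bsub>L\<^esub> x) else \<zero>\<^bsub>tp.T\<^esub>) \<in> X \<rightarrow> carrier tp.T"
      using tens_closed[OF m c(1)] T.M.zero_closed by simp
  qed
  also have "\<dots> = tp.tens m (gh e \<otimes>\<^bsub>L\<^esub> x)"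
  proof -
    interpret T: Module.module F tp.T by (rule tp.T_module)
    show ?thesis
      by (rule T.M.add.finprod_singleton[OF X(2) finite_parts[OF X(1)]])
        (use tens_closed[OF m c(1)] in simp)
  qed
  finally show ?thesis .
qed

lemma tens_slide:
  assumes m: "m \<in> carrier M" and y: "y \<in> carrier L" and x: "x \<in> carrier L"
  shows "tp.tens (m \<triangleleft>\<^bsub>M\<^esub> y) x = tp.tens m (y \<otimes>\<^bsub>L\<^esub> x)"
proof -
  \<comment> \<open>The property is required for all m and x at once: for a product y z it is used
    for z at the pair (m y, x) and for y at the pair (m, z x). As an intersection of equalizers
    \<open>?H\<close> is a submodule.\<close>
  let ?H = "\<Inter>(m, x)\<in>carrier M \<times> carrier L.
    {y \<in> carrier L. tp.tens (m \<triangleleft>\<^bsub>M\<^esub> y) x = tp.tens m (y \<otimes>\<^bsub>L\<^esub> x)}"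
  have memI: "y \<in> ?H" if "y \<in> carrier L" "\<And>m x. \<lbrakk>m \<in> carrier M; x \<in> carrier L\<rbrakk> \<Longrightarrow>
    tp.tens (m \<triangleleft>\<^bsub>M\<^esub> y) x = tp.tens m (y \<otimes>\<^bsub>L\<^esub> x)" for y
    using that by blast
  have memD: "y \<in> carrier L" "\<And>m x. \<lbrakk>m \<in> carrier M; x \<in> carrier L\<rbrakk> \<Longrightarrow>
    tp.tens (m \<triangleleft>\<^bsub>M\<^esub> y) x = tp.tens m (y \<otimes>\<^bsub>L\<^esub> x)" if "y \<in> ?H" for y
    using that m x by blast+
  have "y \<in> ?H"
  proof (rule L_induct[OF _ _ _ y])
    show "submodule ?H F L"
    proof (rule submodule_Int[OF L.module_axioms])
      fix H assume "H \<in> (\<lambda>(m, x). {y \<in> carrier L. tp.tens (m \<triangleleft>\<^bsub>M\<^esub> y) x = tp.tens m (y \<otimes>\<^bsub>L\<^esub> x)}) `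
        (carrier M \<times> carrier L)"
      then obtain m x where mx: "m \<in> carrier M" "x \<in> carrier L"
        and H: "H = {y \<in> carrier L. tp.tens (m \<triangleleft>\<^bsub>M\<^esub> y) x = tp.tens m (y \<otimes>\<^bsub>L\<^esub> x)}"
        by (elim imageE SigmaE) simp
      show "submodule H F L"
        unfolding H
        by (rule submodule_equalizer[OF L.module_axioms tp.T_module
              lin_map_comp[OF U.act_right_lin_map[OF mx(1)] tens_left[OF mx(2)]]
              lin_map_comp[OF L.mult_left_lin_map[OF mx(2)] tens_right[OF mx(1)]]])
    qed (use m x in blast)
  next
    fix y z assume y: "y \<in> ?H" and z: "z \<in> ?H"
    note yc = memD(1)[OF y] and zc = memD(1)[OF z]
    show "y \<otimes>\<^bsub>L\<^esub> z \<in> ?H"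
    proof (rule memI[OF L.mult_closed[OF yc zc]])
      fix m x assume m: "m \<in> carrier M" and x: "x \<in> carrier L"
      show "tp.tens (m \<triangleleft>\<^bsub>M\<^esub> (y \<otimes>\<^bsub>L\<^esub> z)) x = tp.tens m (y \<otimes>\<^bsub>L\<^esub> z \<otimes>\<^bsub>L\<^esub> x)"
        using memD(2)[OF z U.act_closed[OF m yc] x] memD(2)[OF y m L.mult_closed[OF zc x]]
        by (simp add: U.act_assoc[OF m yc zc] L.mult_assoc[OF yc zc x])
    qed
  next
    fix l assume l: "l \<in> letters \<Gamma>"
    show "cls [l] \<in> ?H"
    proof (rule memI)
      show "tp.tens (m \<triangleleft>\<^bsub>M\<^esub> cls [l]) x = tp.tens m (cls [l] \<otimes>\<^bsub>L\<^esub> x)"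
        if "m \<in> carrier M" "x \<in> carrier L" for m x
        using l that by (cases l) (simp_all add: tens_slide_vx tens_slide_ar tens_slide_gh)
    qed (use l in \<open>simp add: cls_closed\<close>)
  qed
  from memD(2)[OF this m x] show ?thesis .
qed

section \<open>The counit and its bijectivity\<close>

definition counit :: "('m \<times> (('v, 'e) letter list \<Rightarrow> 'k) set \<Rightarrow> 'k) set \<Rightarrow> 'm" where
  "counit = restrict (SOME g. lin_map F tp.T M g \<and>
     (\<forall>m\<in>carrier M. \<forall>x\<in>carrier L. g (tp.tens m x) = m \<triangleleft>\<^bsub>M\<^esub> x)) (carrier tp.T)"

lemma counit_lin_map: "lin_map F tp.T M counit"
  and counit_tens: "\<lbrakk>m \<in> carrier M; x \<in> carrier L\<rbrakk> \<Longrightarrow> counit (tp.tens m x) = m \<triangleleft>\<^bsub>M\<^esub> x"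
proof -
  have "balanced_map F Pa (res M) BL M (\<lambda>m x. m \<triangleleft>\<^bsub>M\<^esub> x)"
    unfolding balanced_map_def algebra_bimodule_simps restriction_functor_simps
    using U.act_left_lin_map U.act_right_lin_map
    by (simp add: lin_map_def algebra_bimodule_simps restriction_functor_simps U.act_assoc phi_closed)
  from tp.tensor_lift[OF U.module_axioms this]
  have "\<exists>g. lin_map F tp.T M g \<and> (\<forall>m\<in>carrier M. \<forall>x\<in>carrier L. g (tp.tens m x) = m \<triangleleft>\<^bsub>M\<^esub> x)"
    by (simp add: algebra_bimodule_simps restriction_functor_simps)
  \<comment> \<open>The universal property only asserts existence, so the counit is a choice; its
    values on pure tensors determine it on the carrier, and \<open>restrict\<close> fixes it
    elsewhere.\<close>
  note g = someI_ex[OF this]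
  from lin_map_restrict[OF tp.T_module conjunct1[OF this]]
  show "lin_map F tp.T M counit"
    unfolding counit_def .
  show "counit (tp.tens m x) = m \<triangleleft>\<^bsub>M\<^esub> x" if "m \<in> carrier M" "x \<in> carrier L"
    using g that by (simp add: counit_def tens_closed)
qed

text \<open>Both sides are linear in z, and on pure tensors the claim is the module law m (x y) = (m
  x) y.\<close>

lemma counit_hom: "counit \<in> mod_hom F L tp.T M"
proof (rule mod_homI[OF counit_lin_map _ refl _ tp.tensor_right_module])
  show "counit (z \<triangleleft>\<^bsub>tp.T\<^esub> y) = counit z \<triangleleft>\<^bsub>M\<^esub> y" if z: "z \<in> carrier tp.T" and y: "y \<in> carrier L" for z y
  proof (rule tp.lin_map_tensor_eqI[OF U.module_axioms
        lin_map_comp[OF tp.tensor_act_lin_map[OF y] counit_lin_map]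
        lin_map_comp[OF counit_lin_map U.act_left_lin_map[OF y]] _ z])
    fix m x assume "m \<in> carrier (res M)" "x \<in> carrier BL"
    then have m: "m \<in> carrier M" and x: "x \<in> carrier L"
      by (simp_all add: algebra_bimodule_simps restriction_functor_simps)
    have "tp.tens m x \<triangleleft>\<^bsub>tp.T\<^esub> y = tp.tens m (x \<otimes>\<^bsub>L\<^esub> y)"
      using tp.tens_act[OF y, of m x] m x by (simp add: algebra_bimodule_simps restriction_functor_simps)
    then show "counit (tp.tens m x \<triangleleft>\<^bsub>tp.T\<^esub> y) = counit (tp.tens m x) \<triangleleft>\<^bsub>M\<^esub> y"
      by (simp add: counit_tens[OF m x] counit_tens[OF m L.mult_closed[OF x y]] U.act_assoc[OF m x y])
  qed
qed (simp only: counit_def restrict_extensional)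

text \<open>The map \<open>m \<mapsto> m \<otimes> u\<close>, for a large enough local unit \<open>u\<close>, is inverse to the counit.\<close>

lemma tens_counit_eventually:
  assumes z: "z \<in> carrier tp.T"
  shows "eventually_fixed (verts \<Gamma>) (\<lambda>V z. tp.tens (counit z) (lu V)) z"
proof -
  let ?H = "{z \<in> carrier tp.T. eventually_fixed (verts \<Gamma>) (\<lambda>V z. tp.tens (counit z) (lu V)) z}"
  have "z \<in> ?H"
  proof (rule tp.tensor_induct[OF _ _ z])
    show "submodule ?H F tp.T"
      by (rule eventually_fixed_submodule[OF tp.T_module
            lin_map_comp[OF counit_lin_map tens_left[OF lu_closed]]])
    fix m x assume "m \<in> carrier (res M)" "x \<in> carrier BL"
    then have m: "m \<in> carrier M" and x: "x \<in> carrier L"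
      by (simp_all add: algebra_bimodule_simps restriction_functor_simps)
    from mult_lu_eventually[OF x] obtain V\<^sub>0 where V0: "finite V\<^sub>0" "V\<^sub>0 \<subseteq> verts \<Gamma>"
        "\<And>V. \<lbrakk>finite V; V\<^sub>0 \<subseteq> V; V \<subseteq> verts \<Gamma>\<rbrakk> \<Longrightarrow> x \<otimes>\<^bsub>L\<^esub> lu V = x"
      unfolding eventually_fixed_def by blast
    \<comment> \<open>For z = m \<otimes> x and a unit u with x u = x, sliding gives m x \<otimes> u
      = m \<otimes> x u = m \<otimes> x. So a threshold for x in L serves the pure tensor.\<close>
    have "eventually_fixed (verts \<Gamma>) (\<lambda>V z. tp.tens (counit z) (lu V)) (tp.tens m x)"
      by (rule eventually_fixedI[OF V0(1,2)])
        (simp add: counit_tens[OF m x] tens_slide[OF m x lu_closed] V0(3))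
    then show "tp.tens m x \<in> ?H"
      using tens_closed[OF m x] by simp
  qed
  then show ?thesis
    by simp
qed

text \<open>No single u gives the inverse on all of M in general, so bijectivity is proved
  elementwise. Two elements with equal counit are recovered from it with one common unit; m is the
  image of m \<otimes> u as soon as m u = m.\<close>

lemma counit_iso: "counit \<in> mod_iso F L tp.T M"
proof (rule mod_isoI[OF tp.tensor_right_module U.right_module_axioms counit_hom])
  show "inj_on counit (carrier tp.T)"
  proof (rule inj_onI)
    fix z z' assume z: "z \<in> carrier tp.T" "z' \<in> carrier tp.T" and eq: "counit z = counit z'"
    show "z = z'"
    proof (rule eventually_fixed_common[OF tens_counit_eventually[OF z(1)]
          tens_counit_eventually[OF z(2)]])
      fix V
      assume V: "finite V" "V \<subseteq> verts \<Gamma>"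
        "\<And>V'. \<lbrakk>finite V'; V \<subseteq> V'; V' \<subseteq> verts \<Gamma>\<rbrakk> \<Longrightarrow> tp.tens (counit z) (lu V') = z"
        "\<And>V'. \<lbrakk>finite V'; V \<subseteq> V'; V' \<subseteq> verts \<Gamma>\<rbrakk> \<Longrightarrow> tp.tens (counit z') (lu V') = z'"
      have "z = tp.tens (counit z) (lu V)"
        by (rule V(3)[OF V(1) order_refl V(2), symmetric])
      also have "\<dots> = tp.tens (counit z') (lu V)"
        by (simp only: eq)
      also have "\<dots> = z'"
        by (rule V(4)[OF V(1) order_refl V(2)])
      finally show "z = z'" .
    qed
  qed
  show "counit ` carrier tp.T = carrier M"
  proof
    show "counit ` carrier tp.T \<subseteq> carrier M"
      using lin_map_closed[OF counit_lin_map] by (rule image_subsetI)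
    show "carrier M \<subseteq> counit ` carrier tp.T"
    proof
      fix m assume m: "m \<in> carrier M"
      from act_lu_eventually[OF U.unital_right_module_axioms m]
      obtain V where V: "V \<subseteq> verts \<Gamma>" "m \<triangleleft>\<^bsub>M\<^esub> lu V = m"
        by (rule eventually_fixed_witness)
      have "counit (tp.tens m (lu V)) = m"
        unfolding counit_tens[OF m lu_closed[OF V(1)]] by (rule V(2))
      then show "m \<in> counit ` carrier tp.T"
        by (rule image_eqI[OF sym tens_closed[OF m lu_closed[OF V(1)]]])
    qed
  qed
qed

end

section \<open>Naturality of the counit and the resulting equivalence\<close>

lemma counit_natural:
  assumes M: "leavitt_module F \<Gamma> \<P> M" and N: "leavitt_module F \<Gamma> \<P> N"
    and f: "f \<in> mod_hom F (leavitt_path_alg F \<Gamma> \<P>) M N"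
  defines "S \<equiv> comp_functor (lpa_tensor_functor F \<Gamma> \<P>) (forgetful_functor F \<Gamma> \<P>)"
  shows "compose (carrier (fobj S M)) (leavitt_module.counit F \<Gamma> \<P> N) (fmor S M N f) =
    compose (carrier (fobj S M)) f (leavitt_module.counit F \<Gamma> \<P> M)"
proof -
  interpret M: leavitt_module F \<Gamma> \<P> M by (rule M)
  interpret N: leavitt_module F \<Gamma> \<P> N by (rule N)
  have SM: "fobj S M = M.tp.T"
    by (simp only: S_def comp_functor_def lpa_tensor_functor_def tensor_functor_def
        forgetful_functor_def mod_functor.simps)
  let ?g = "tensor_mor F M.Pa M.BL (M.res M) (M.res N) f"
  have Sf: "fmor S M N f = ?g"
    by (simp only: S_def comp_functor_def lpa_tensor_functor_def tensor_functor_def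
        forgetful_functor_def restriction_functor_def mod_functor.simps)
  have rf: "f \<in> mod_hom F M.Pa (M.res M) (M.res N)"
  proof (rule mod_homI[OF _ _ refl _ M.res_right_module])
    show "lin_map F (M.res M) (M.res N) f"
      using mod_hom_lin_map[OF f] unfolding lin_map_def restriction_functor_simps .
    show "f (x \<triangleleft>\<^bsub>M.res M\<^esub> a) = f x \<triangleleft>\<^bsub>M.res N\<^esub> a" if "x \<in> carrier (M.res M)" "a \<in> carrier M.Pa" for x a
      using mod_hom_act[OF f _ M.phi_closed] that unfolding restriction_functor_simps .
    show "f \<in> extensional (carrier (M.res M))"
      using mod_hom_extensional[OF f] unfolding restriction_functor_simps .
  qed
  note mor = tensor_mor[OF M.tp.tensor_product_axioms N.tp.tensor_product_axioms rf]
  note fl = mod_hom_lin_map[OF f]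
  \<comment> \<open>By linearity only pure tensors matter: one way round the square gives f(m) x,
    the other f(m x), and these agree because f is L-linear.\<close>
  have "N.counit (?g z) = f (M.counit z)" if z: "z \<in> carrier M.tp.T" for z
  proof (rule M.tp.lin_map_tensor_eqI[OF N.U.module_axioms
        lin_map_comp[OF mod_hom_lin_map[OF mor(1)] N.counit_lin_map]
        lin_map_comp[OF M.counit_lin_map fl] _ z])
    fix m x assume mx: "m \<in> carrier (M.res M)" "x \<in> carrier M.BL"
    then have m: "m \<in> carrier M" and x: "x \<in> carrier M.L"
      by (simp_all add: M.algebra_bimodule_simps restriction_functor_simps)
    show "N.counit (?g (M.tp.tens m x)) = f (M.counit (M.tp.tens m x))"
      unfolding mor(2)[OF mx] M.counit_tens[OF m x] N.counit_tens[OF lin_map_closed[OF fl m] x]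
      by (rule mod_hom_act[OF f m x, symmetric])
  qed
  then show ?thesis
    unfolding SM Sf compose_def by (rule restrict_ext)
qed

theorem theorem3p3:
  fixes F :: "('k, 'z) ring_scheme"
    and \<Gamma> :: "('v, 'e) pre_digraph"
    and \<P> :: "'e set set"
  assumes "Ring.field F"
    and "finitely_separated_digraph \<Gamma> \<P>"
  shows "is_functor F (leavitt_path_alg F \<Gamma> \<P>) (path_alg F \<Gamma>)
      (forgetful_functor F \<Gamma> \<P> :: (_, _, 'm, _, 'm) mod_functor) \<and>
    is_functor F (path_alg F \<Gamma>) (leavitt_path_alg F \<Gamma> \<P>)
      (lpa_tensor_functor F \<Gamma> \<P> :: (_, _, 'm, _, _) mod_functor) \<and>
    naturally_equivalent F (leavitt_path_alg F \<Gamma> \<P>) (leavitt_path_alg F \<Gamma> \<P>)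
      (comp_functor (lpa_tensor_functor F \<Gamma> \<P>) (forgetful_functor F \<Gamma> \<P>))
      (id_functor :: (_, _, 'm, _, 'm) mod_functor)"
proof -
  interpret F: Ring.field F by fact
  interpret leavitt F \<Gamma> \<P>
    by (intro leavitt.intro assms(2) F.is_cring)
  let ?S = "comp_functor (lpa_tensor_functor F \<Gamma> \<P>) (forgetful_functor F \<Gamma> \<P>) ::
    (_, _, 'm, _, _) mod_functor"
  \<comment> \<open>Every object of the category lies in the locale in which its counit was
    constructed, so the counits form a family over all objects.\<close>
  have LM: "leavitt_module F \<Gamma> \<P> M" if "M \<in> right_mods F L"
    for M :: "('k, (('v, 'e) letter list \<Rightarrow> 'k) set, 'm) rmodule"
    using that by (intro leavitt_module.intro leavitt_axioms) (simp add: right_mods_def)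
  have "is_functor F L L ?S"
    by (rule comp_is_functor[OF forgetful_is_functor lpa_tensor_is_functor])
  moreover have "is_functor F L L (id_functor :: (_, _, 'm, _, 'm) mod_functor)"
    by (simp add: is_functor_def id_functor_def)
  moreover have "leavitt_module.counit F \<Gamma> \<P> M \<in> mod_iso F L (fobj ?S M) (fobj id_functor M)"
    if "M \<in> right_mods F L" for M :: "('k, (('v, 'e) letter list \<Rightarrow> 'k) set, 'm) rmodule"
    using leavitt_module.counit_iso[OF LM[OF that]]
    by (simp add: comp_functor_def lpa_tensor_functor_def tensor_functor_def forgetful_functor_def
        id_functor_def)
  moreover have "compose (carrier (fobj ?S M)) (leavitt_module.counit F \<Gamma> \<P> N) (fmor ?S M N f) =
      compose (carrier (fobj ?S M)) (fmor id_functor M N f) (leavitt_module.counit F \<Gamma> \<P> M)"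
    if "M \<in> right_mods F L" "N \<in> right_mods F L" "f \<in> mod_hom F L M N"
    for M N :: "('k, (('v, 'e) letter list \<Rightarrow> 'k) set, 'm) rmodule" and f
    using counit_natural[OF LM[OF that(1)] LM[OF that(2)] that(3)] by (simp add: id_functor_def)
  ultimately have "naturally_equivalent F L L ?S id_functor"
    unfolding naturally_equivalent_def
    by (intro conjI exI[of _ "leavitt_module.counit F \<Gamma> \<P>"] ballI)
  then show ?thesis
    by (intro conjI forgetful_is_functor lpa_tensor_is_functor)
qed

end
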